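(* Let $G$ be a connected simple split algebraic group of adjoint type over a non-archimedean local field. Suppose $\Gamma$ is a finite-index subgroup of the coroot lattice $\Lambda_r$ with $N=[\Lambda:\Gamma]$, and $\pi$ is a minuscule or fundamental quasi-minuscule representation of $\hat G(\mathbb C)$. Then $$Z(\mathcal A_\Gamma,\pi,u)=(1-u)^{\epsilon(\pi)N}L(\Gamma\backslash W_{\mathrm{ext}},\pi,u)=\prod_{\lambda\in\mathrm{wt}'(\pi)}\bigl(1-u^{\deg(\lambda)}\bigr)^{-N/\deg(\lambda)},$$ where $\epsilon(\pi)$ is the multiplicity of the trivial weight in $\mathrm{wt}(\pi)$ and $\deg(\lambda)$ is the order of $\lambda$ in the quotient group $\Lambda/\Gamma$.
   Context: Let $T$ be a maximal split torus of $G$ with cocharacter group $Y(T)$, roots $\Phi$ and Weyl group $W$. $V=Y(T)\otimes\mathbb R$ carries a $W$-invariant inner product. The coweight lattice is $\Lambda=\{\lambda\in V:\langle\alpha,\lambda\rangle\in\mathbb Z\ \forall\alpha\in\Phi\}$, equal to $Y(T)$ since $G$ is adjoint. $W_{\mathrm{ext}}=\Lambda\rtimes W$ acts on $V$ by isometries, $\Lambda$ acting by translations. The apartment $\mathcal A$ is $V$ with the simplicial structure given by the walls $\{v:\langle\alpha,v\rangle=k\}$, $\alpha\in\Phi$, $k\in\mathbb Z$, and $\mathcal A_\Gamma=\Gamma\backslash\mathcal A$ (here a simplicial torus). $\hat G(\mathbb C)$ is the complex dual group; its weights are identified with elements of $Y(T)=\Lambda$. $\pi$ minuscule or fundamental quasi-minuscule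 means: $\pi$ is irreducible and its nontrivial weights form the $W$-orbit of a fundamental weight of $\hat G(\mathbb C)$. $\mathrm{wt}(\pi)$ is the multiset of weights, $\mathrm{wt}'(\pi)$ the set of nontrivial ones, all of the same length $\ell(\pi)$. **$L$-function.** An irreducible representation $\rho$ of $W_{\mathrm{ext}}$ is unramified if it has a nonzero $W$-fixed vector; then it is the unique unramified subrepresentation of $\mathrm{Ind}_\Lambda^{W_{\mathrm{ext}}}\chi_\rho$ for a character $\chi_\rho$ of $\Lambda$, unique up to $W$. With $\mathrm{Irr}^{\mathrm{unr}}(\Gamma\backslash W_{\mathrm{ext}})$ the multiset of irreducible unramified subrepresentations of $L^2(\Gamma\backslash W_{\mathrm{ext}})$ (with multiplicity), $$L(\Gamma\backslash W_{\mathrm{ext}},\pi,u)=\prod_{\rho\in\mathrm{Irr}^{\mathrm{unr}}(\Gamma\backslash W_{\mathrm{ext}})}\ \prod_{\lambda\in\mathrm{wt}(\pi)}(1-\chi_\rho(\lambda)u)^{-1}.$$ **Zeta function.** A $\pi$-geodesic in $\mathcal A$ is an oriented straight line with the direction of some $\lambda\in\mathrm{wt}'(\pi)$; it is rational if contained in the 1-skeleton of $\mathcal A$. A closed $\pi$-geodesic in $\mathcal A_\Gamma$ is the image of an oriented segment from $v$ to $g(v)$ on a $\pi$-geodesic $L$ with $g\in\Gamma$, $g(L)=L$; it is rational if $L$ is. Two are equivalent if they differ by a change of starting point; primitive means not a repetition of a shorter one; the normalized length $l(c)$ is the length divided by $\ell(\pi)$. Rational closed $\pi$-geodesics start at vertices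 in $\Gamma\backslash\Lambda$, up to equivalence. $Z(\mathcal A_\Gamma,\pi,u)=\prod_c(1-u^{l(c)})^{-1}$ over equivalence classes of primitive rational closed $\pi$-geodesics in $\mathcal A_\Gamma$.
   Formalization: A rational closed π-geodesic is required, besides lying in the 1-skeleton, to pass through a vertex in Γ\Λ; this does not follow from lying in the 1-skeleton (it fails for type C_3 with weights 0, ±e_i and Γ=Λ_r), and without it the formula is false. *)

theory Defs
  imports "HOL-Analysis.Analysis" "HOL-Algebra.Multiplicative_Group"
begin

text \<open>
  The pair (G, T) is represented by the irreducible reduced root system \<Phi> of G in the Euclidean
  space V. Roots are linear forms on V; they are written as vectors by means of the W-invariant inner
  product, so that the pairing of a root \<alpha> with \<mu> in V is \<open>\<alpha> \<bullet> \<mu>\<close>. As G is adjoint, Y(T) is the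
  coweight lattice.
\<close>

definition coroot :: "'v::euclidean_space \<Rightarrow> 'v" where
  "coroot \<alpha> = (2 / (\<alpha> \<bullet> \<alpha>)) *\<^sub>R \<alpha>"

definition root_reflection :: "'v::euclidean_space \<Rightarrow> 'v \<Rightarrow> 'v" where
  "root_reflection \<alpha> v = v - (\<alpha> \<bullet> v) *\<^sub>R coroot \<alpha>"

definition irreducible_root_system :: "'v::euclidean_space set \<Rightarrow> bool" where
  "irreducible_root_system \<Phi> \<longleftrightarrow>
     finite \<Phi> \<and> span \<Phi> = UNIV \<and> 0 \<notin> \<Phi> \<and>
     (\<forall>\<alpha>\<in>\<Phi>. root_reflection \<alpha> ` \<Phi> = \<Phi>) \<and>
     (\<forall>\<alpha>\<in>\<Phi>. \<forall>\<beta>\<in>\<Phi>. \<beta> \<bullet> coroot \<alpha> \<in> \<int>) \<and>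
     (\<forall>\<alpha>\<in>\<Phi>. \<forall>c. c *\<^sub>R \<alpha> \<in> \<Phi> \<longrightarrow> c = 1 \<or> c = -1) \<and>
     \<not> (\<exists>A B. A \<noteq> {} \<and> B \<noteq> {} \<and> A \<union> B = \<Phi> \<and> A \<inter> B = {} \<and> (\<forall>\<alpha>\<in>A. \<forall>\<beta>\<in>B. \<alpha> \<bullet> \<beta> = 0))"

definition root_base :: "'v::euclidean_space set \<Rightarrow> 'v set \<Rightarrow> bool" where
  "root_base \<Phi> \<Delta> \<longleftrightarrow>
     \<Delta> \<subseteq> \<Phi> \<and> independent \<Delta> \<and>
     (\<forall>\<alpha>\<in>\<Phi>. \<exists>n::'v \<Rightarrow> nat. \<alpha> = (\<Sum>\<beta>\<in>\<Delta>. real (n \<beta>) *\<^sub>R \<beta>) \<or> \<alpha> = - (\<Sum>\<beta>\<in>\<Delta>. real (n \<beta>) *\<^sub>R \<beta>))"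

inductive_set weyl_group :: "'v::euclidean_space set \<Rightarrow> ('v \<Rightarrow> 'v) set" for \<Phi> where
  weyl_id: "id \<in> weyl_group \<Phi>"
| weyl_refl: "w \<in> weyl_group \<Phi> \<Longrightarrow> \<alpha> \<in> \<Phi> \<Longrightarrow> root_reflection \<alpha> \<circ> w \<in> weyl_group \<Phi>"

definition coweight_lattice :: "'v::euclidean_space set \<Rightarrow> 'v set" where
  "coweight_lattice \<Phi> = {\<mu>. \<forall>\<alpha>\<in>\<Phi>. \<alpha> \<bullet> \<mu> \<in> \<int>}"

definition coroot_lattice :: "'v::euclidean_space set \<Rightarrow> 'v set" where
  "coroot_lattice \<Phi> = {(\<Sum>\<alpha>\<in>\<Phi>. of_int (n \<alpha>) *\<^sub>R coroot \<alpha>) | n :: 'v \<Rightarrow> int. True}"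

definition lattice_group :: "'v::euclidean_space set \<Rightarrow> 'v monoid" where
  "lattice_group L = \<lparr>carrier = L, monoid.mult = (+), one = 0\<rparr>"

definition lattice_index :: "'v::euclidean_space set \<Rightarrow> 'v set \<Rightarrow> nat" where
  "lattice_index \<Phi> \<Gamma> = card (rcosets\<^bsub>lattice_group (coweight_lattice \<Phi>)\<^esub> \<Gamma>)"

definition weight_degree :: "'v::euclidean_space set \<Rightarrow> 'v set \<Rightarrow> 'v \<Rightarrow> nat" where
  "weight_degree \<Phi> \<Gamma> \<mu> =
     (let A = lattice_group (coweight_lattice \<Phi>) in group.ord (A Mod \<Gamma>) (\<Gamma> #>\<^bsub>A\<^esub> \<mu>))"


subsection \<open>Representations of the dual group\<close>

text \<open>
  The dual group is semisimple and simply connected, since G is adjoint, so that its finite-dimensional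
  representations are those of its Lie algebra. The latter is given by Chevalley generators and
  Serre relations, the generators being indexed by the base \<Delta> of \<Phi>. The simple roots of the dual
  group are the coroots of \<Delta> and its simple coroots are the elements of \<Delta> themselves; hence
  \<open>H \<alpha>\<close> acts on the \<open>\<mu>\<close>-weight space by the scalar \<open>\<alpha> \<bullet> \<mu>\<close>.
\<close>

record ('v, 'n) dual_rep =
  Eop :: "'v \<Rightarrow> complex ^ 'n ^ 'n"
  Fop :: "'v \<Rightarrow> complex ^ 'n ^ 'n"
  Hop :: "'v \<Rightarrow> complex ^ 'n ^ 'n"

definition mat_bracket :: "complex ^ 'n::finite ^ 'n \<Rightarrow> complex ^ 'n ^ 'n \<Rightarrow> complex ^ 'n ^ 'n" where
  "mat_bracket A B = A ** B - B ** A"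

definition is_dual_rep :: "'v::euclidean_space set \<Rightarrow> ('v, 'n::finite) dual_rep \<Rightarrow> bool" where
  "is_dual_rep \<Delta> \<pi> \<longleftrightarrow>
     (\<forall>\<alpha>\<in>\<Delta>. \<forall>\<beta>\<in>\<Delta>.
        mat_bracket (Hop \<pi> \<alpha>) (Hop \<pi> \<beta>) = 0 \<and>
        mat_bracket (Hop \<pi> \<alpha>) (Eop \<pi> \<beta>) = (\<alpha> \<bullet> coroot \<beta>) *\<^sub>R Eop \<pi> \<beta> \<and>
        mat_bracket (Hop \<pi> \<alpha>) (Fop \<pi> \<beta>) = - (\<alpha> \<bullet> coroot \<beta>) *\<^sub>R Fop \<pi> \<beta> \<and>
        mat_bracket (Eop \<pi> \<alpha>) (Fop \<pi> \<beta>) = (if \<alpha> = \<beta> then Hop \<pi> \<alpha> else 0) \<and>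
        (\<alpha> \<noteq> \<beta> \<longrightarrow>
           (mat_bracket (Eop \<pi> \<alpha>) ^^ nat \<lfloor>1 - \<alpha> \<bullet> coroot \<beta>\<rfloor>) (Eop \<pi> \<beta>) = 0 \<and>
           (mat_bracket (Fop \<pi> \<alpha>) ^^ nat \<lfloor>1 - \<alpha> \<bullet> coroot \<beta>\<rfloor>) (Fop \<pi> \<beta>) = 0))"

definition irreducible_dual_rep :: "'v::euclidean_space set \<Rightarrow> ('v, 'n::finite) dual_rep \<Rightarrow> bool" where
  "irreducible_dual_rep \<Delta> \<pi> \<longleftrightarrow>
     is_dual_rep \<Delta> \<pi> \<and>
     (\<forall>S. vec.subspace S \<and>
          (\<forall>\<alpha>\<in>\<Delta>. \<forall>x\<in>S. Eop \<pi> \<alpha> *v x \<in> S \<and> Fop \<pi> \<alpha> *v x \<in> S \<and> Hop \<pi> \<alpha> *v x \<in> S)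
          \<longrightarrow> S = {0} \<or> S = UNIV)"

definition weight_space ::
    "'v::euclidean_space set \<Rightarrow> ('v, 'n::finite) dual_rep \<Rightarrow> 'v \<Rightarrow> (complex ^ 'n) set" where
  "weight_space \<Delta> \<pi> \<mu> = {x. \<forall>\<alpha>\<in>\<Delta>. Hop \<pi> \<alpha> *v x = complex_of_real (\<alpha> \<bullet> \<mu>) *s x}"

definition wt :: "'v::euclidean_space set \<Rightarrow> 'v set \<Rightarrow> ('v, 'n::finite) dual_rep \<Rightarrow> 'v multiset" where
  "wt \<Phi> \<Delta> \<pi> =
     (\<Sum>\<mu>\<in>{\<mu>\<in>coweight_lattice \<Phi>. weight_space \<Delta> \<pi> \<mu> \<noteq> {0}}.
        replicate_mset (vec.dim (weight_space \<Delta> \<pi> \<mu>)) \<mu>)"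

definition wt' :: "'v::euclidean_space set \<Rightarrow> 'v set \<Rightarrow> ('v, 'n::finite) dual_rep \<Rightarrow> 'v set" where
  "wt' \<Phi> \<Delta> \<pi> = set_mset (wt \<Phi> \<Delta> \<pi>) - {0}"

definition trivial_weight_mult ::
    "'v::euclidean_space set \<Rightarrow> 'v set \<Rightarrow> ('v, 'n::finite) dual_rep \<Rightarrow> nat" where
  "trivial_weight_mult \<Phi> \<Delta> \<pi> = count (wt \<Phi> \<Delta> \<pi>) 0"

text \<open>Here \<open>\<omega>\<close> is a fundamental weight of the dual group, that is, a fundamental coweight of \<Phi>.\<close>

definition minuscule_or_fund_quasi_minuscule ::
    "'v::euclidean_space set \<Rightarrow> 'v set \<Rightarrow> ('v, 'n::finite) dual_rep \<Rightarrow> bool" where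
  "minuscule_or_fund_quasi_minuscule \<Phi> \<Delta> \<pi> \<longleftrightarrow>
     irreducible_dual_rep \<Delta> \<pi> \<and>
     (\<exists>\<alpha>\<in>\<Delta>. \<exists>\<omega>. (\<forall>\<beta>\<in>\<Delta>. \<beta> \<bullet> \<omega> = (if \<beta> = \<alpha> then 1 else 0)) \<and>
        wt' \<Phi> \<Delta> \<pi> = {w \<omega> | w. w \<in> weyl_group \<Phi>})"

definition weight_length :: "'v::euclidean_space set \<Rightarrow> 'v set \<Rightarrow> ('v, 'n::finite) dual_rep \<Rightarrow> real" where
  "weight_length \<Phi> \<Delta> \<pi> = (THE r. \<forall>\<mu>\<in>wt' \<Phi> \<Delta> \<pi>. norm \<mu> = r)"


subsection \<open>The extended Weyl group and the L-function\<close>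

text \<open>The semidirect product of \<Lambda> and W, realised through its faithful action on V.\<close>

definition ext_weyl_group :: "'v::euclidean_space set \<Rightarrow> ('v \<Rightarrow> 'v) set" where
  "ext_weyl_group \<Phi> = {(\<lambda>v. \<mu> + w v) | \<mu> w. \<mu> \<in> coweight_lattice \<Phi> \<and> w \<in> weyl_group \<Phi>}"

text \<open>
  Complex functions on the extended Weyl group are functions on all maps from V to V which vanish
  outside the group; the group acts on them by right translation.
\<close>

type_synonym 'v ext_fun = "('v \<Rightarrow> 'v) \<Rightarrow> complex"

definition right_translate :: "('v \<Rightarrow> 'v) \<Rightarrow> 'v ext_fun \<Rightarrow> 'v ext_fun" where
  "right_translate h f = (\<lambda>g. f (g \<circ> h))"

text \<open>
  For \<Gamma> of finite index, the quotient of the extended Weyl group by \<Gamma> is finite, so the condition of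
  square-summability is void.
\<close>

definition L2_quotient :: "'v::euclidean_space set \<Rightarrow> 'v set \<Rightarrow> 'v ext_fun set" where
  "L2_quotient \<Phi> \<Gamma> =
     {f. (\<forall>g. g \<notin> ext_weyl_group \<Phi> \<longrightarrow> f g = 0) \<and>
         (\<forall>\<gamma>\<in>\<Gamma>. \<forall>g\<in>ext_weyl_group \<Phi>. f ((+) \<gamma> \<circ> g) = f g)}"

definition lattice_character :: "'v::euclidean_space set \<Rightarrow> ('v \<Rightarrow> complex) \<Rightarrow> bool" where
  "lattice_character \<Phi> \<psi> \<longleftrightarrow>
     (\<forall>\<mu>\<in>coweight_lattice \<Phi>. \<psi> \<mu> \<noteq> 0 \<and> (\<forall>\<nu>\<in>coweight_lattice \<Phi>. \<psi> (\<mu> + \<nu>) = \<psi> \<mu> * \<psi> \<nu>))"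

definition induced_rep :: "'v::euclidean_space set \<Rightarrow> ('v \<Rightarrow> complex) \<Rightarrow> 'v ext_fun set" where
  "induced_rep \<Phi> \<psi> =
     {f. (\<forall>g. g \<notin> ext_weyl_group \<Phi> \<longrightarrow> f g = 0) \<and>
         (\<forall>\<mu>\<in>coweight_lattice \<Phi>. \<forall>g\<in>ext_weyl_group \<Phi>. f ((+) \<mu> \<circ> g) = \<psi> \<mu> * f g)}"

definition is_subrep :: "'v::euclidean_space set \<Rightarrow> 'v ext_fun set \<Rightarrow> 'v ext_fun set \<Rightarrow> bool" where
  "is_subrep \<Phi> M S \<longleftrightarrow>
     S \<subseteq> M \<and> (\<lambda>_. 0) \<in> S \<and>
     (\<forall>f\<in>S. \<forall>f'\<in>S. (\<lambda>g. f g + f' g) \<in> S) \<and>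
     (\<forall>c. \<forall>f\<in>S. (\<lambda>g. c * f g) \<in> S) \<and>
     (\<forall>h\<in>ext_weyl_group \<Phi>. \<forall>f\<in>S. right_translate h f \<in> S)"

definition is_irreducible_subrep ::
    "'v::euclidean_space set \<Rightarrow> 'v ext_fun set \<Rightarrow> 'v ext_fun set \<Rightarrow> bool" where
  "is_irreducible_subrep \<Phi> M S \<longleftrightarrow>
     is_subrep \<Phi> M S \<and> S \<noteq> {\<lambda>_. 0} \<and> (\<forall>S'. is_subrep \<Phi> S S' \<longrightarrow> S' = {\<lambda>_. 0} \<or> S' = S)"

definition is_unramified :: "'v::euclidean_space set \<Rightarrow> 'v ext_fun set \<Rightarrow> bool" where
  "is_unramified \<Phi> \<rho> \<longleftrightarrow> (\<exists>f\<in>\<rho>. f \<noteq> (\<lambda>_. 0) \<and> (\<forall>w\<in>weyl_group \<Phi>. right_translate w f = f))"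

definition rep_iso :: "'v::euclidean_space set \<Rightarrow> 'v ext_fun set \<Rightarrow> 'v ext_fun set \<Rightarrow> bool" where
  "rep_iso \<Phi> \<rho> \<sigma> \<longleftrightarrow>
     (\<exists>T. bij_betw T \<rho> \<sigma> \<and>
        (\<forall>f\<in>\<rho>. \<forall>f'\<in>\<rho>. T (\<lambda>g. f g + f' g) = (\<lambda>g. T f g + T f' g)) \<and>
        (\<forall>c. \<forall>f\<in>\<rho>. T (\<lambda>g. c * f g) = (\<lambda>g. c * T f g)) \<and>
        (\<forall>h\<in>ext_weyl_group \<Phi>. \<forall>f\<in>\<rho>. T (right_translate h f) = right_translate h (T f)))"

text \<open>A choice of the character \<open>\<chi>\<^sub>\<rho>\<close> attached to \<open>\<rho>\<close>; it is unique up to W.\<close>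

definition rep_character :: "'v::euclidean_space set \<Rightarrow> 'v ext_fun set \<Rightarrow> 'v \<Rightarrow> complex" where
  "rep_character \<Phi> \<rho> =
     (SOME \<psi>. lattice_character \<Phi> \<psi> \<and>
        (\<exists>\<sigma>. is_irreducible_subrep \<Phi> (induced_rep \<Phi> \<psi>) \<sigma> \<and> is_unramified \<Phi> \<sigma> \<and> rep_iso \<Phi> \<rho> \<sigma>))"

text \<open>\<open>D\<close> decomposes \<open>M\<close> as an internal direct sum of irreducible subrepresentations.\<close>

definition irreducible_decomposition ::
    "'v::euclidean_space set \<Rightarrow> 'v ext_fun set \<Rightarrow> 'v ext_fun set set \<Rightarrow> bool" where
  "irreducible_decomposition \<Phi> M D \<longleftrightarrow>
     finite D \<and> (\<forall>\<rho>\<in>D. is_irreducible_subrep \<Phi> M \<rho>) \<and>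
     (\<forall>f\<in>M. \<exists>!p. (\<forall>\<rho>\<in>D. p \<rho> \<in> \<rho>) \<and> (\<forall>\<rho>. \<rho> \<notin> D \<longrightarrow> p \<rho> = (\<lambda>_. 0)) \<and> f = (\<lambda>g. \<Sum>\<rho>\<in>D. p \<rho> g))"

text \<open>
  The multiset of unramified constituents is given by the unramified members of a decomposition;
  isomorphic constituents occur in it as distinct subspaces. Up to isomorphism it does not depend on
  the decomposition chosen.
\<close>

definition Irr_unr :: "'v::euclidean_space set \<Rightarrow> 'v set \<Rightarrow> 'v ext_fun set set" where
  "Irr_unr \<Phi> \<Gamma> =
     {\<rho> \<in> (SOME D. irreducible_decomposition \<Phi> (L2_quotient \<Phi> \<Gamma>) D). is_unramified \<Phi> \<rho>}"

definition L_function ::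
    "'v::euclidean_space set \<Rightarrow> 'v set \<Rightarrow> 'v set \<Rightarrow> ('v, 'n::finite) dual_rep \<Rightarrow> complex \<Rightarrow> complex" where
  "L_function \<Phi> \<Delta> \<Gamma> \<pi> u =
     (\<Prod>\<rho>\<in>Irr_unr \<Phi> \<Gamma>. \<Prod>\<mu>\<in>#wt \<Phi> \<Delta> \<pi>. inverse (1 - rep_character \<Phi> \<rho> \<mu> * u))"


subsection \<open>The apartment and the zeta function\<close>

text \<open>The open face of the wall arrangement which contains \<open>v\<close>.\<close>

definition apt_face :: "'v::euclidean_space set \<Rightarrow> 'v \<Rightarrow> 'v set" where
  "apt_face \<Phi> v = {x. \<forall>\<alpha>\<in>\<Phi>. \<forall>k::int. sgn (\<alpha> \<bullet> x - of_int k) = sgn (\<alpha> \<bullet> v - of_int k)}"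

definition one_skeleton :: "'v::euclidean_space set \<Rightarrow> 'v set" where
  "one_skeleton \<Phi> = {v. aff_dim (apt_face \<Phi> v) \<le> 1}"

definition apt_proj :: "'v::euclidean_space set \<Rightarrow> 'v \<Rightarrow> 'v set" where
  "apt_proj \<Gamma> v = {\<gamma> + v | \<gamma>. \<gamma> \<in> \<Gamma>}"

definition geodesic_line :: "'v::euclidean_space \<Rightarrow> 'v \<Rightarrow> 'v set" where
  "geodesic_line p \<mu> = {p + t *\<^sub>R \<mu> | t. True}"

text \<open>
  The image in the quotient of the oriented segment from \<open>v\<close> to \<open>\<gamma> + v\<close>, parametrised at constant
  speed on [0, 1] and continued to a function on the real line of period 1.
\<close>

definition apt_loop :: "'v::euclidean_space set \<Rightarrow> 'v \<Rightarrow> 'v \<Rightarrow> real \<Rightarrow> 'v set" where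
  "apt_loop \<Gamma> v \<gamma> = (\<lambda>s. apt_proj \<Gamma> (v + s *\<^sub>R \<gamma>))"

text \<open>
  The closed geodesics which arise from a line \<open>L\<close> oriented by \<open>\<mu>\<close>. That \<open>\<gamma>\<close> is a positive multiple
  of \<open>\<mu>\<close> says that the segment from \<open>v\<close> to \<open>\<gamma> + v\<close> is oriented in the same way as \<open>L\<close>.
\<close>

definition closed_geodesic_on ::
    "'v::euclidean_space set \<Rightarrow> 'v set \<Rightarrow> 'v \<Rightarrow> (real \<Rightarrow> 'v set) \<Rightarrow> bool" where
  "closed_geodesic_on \<Gamma> L \<mu> c \<longleftrightarrow>
     (\<exists>v\<in>L. \<exists>\<gamma>\<in>\<Gamma>. (+) \<gamma> ` L = L \<and> (\<exists>t>0. \<gamma> = t *\<^sub>R \<mu>) \<and> c = apt_loop \<Gamma> v \<gamma>)"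

definition closed_geodesic ::
    "'v::euclidean_space set \<Rightarrow> 'v set \<Rightarrow> 'v set \<Rightarrow> ('v, 'n::finite) dual_rep \<Rightarrow> (real \<Rightarrow> 'v set) \<Rightarrow> bool" where
  "closed_geodesic \<Phi> \<Delta> \<Gamma> \<pi> c \<longleftrightarrow>
     (\<exists>p. \<exists>\<mu>\<in>wt' \<Phi> \<Delta> \<pi>. closed_geodesic_on \<Gamma> (geodesic_line p \<mu>) \<mu> c)"

text \<open>
  Besides lying in the 1-skeleton, a rational closed geodesic starts, up to a change of starting
  point, at the image of a point of \<Lambda>. This is a condition: for the roots \<open>\<plusminus>e\<^sub>i \<plusminus> e\<^sub>j\<close>, \<open>\<plusminus>2e\<^sub>i\<close> of type \<open>C\<^sub>3\<close> the line of direction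
  \<open>e\<^sub>1\<close> through (0, 1/2, 0) lies in the 1-skeleton but does not meet \<Lambda>.
\<close>

definition rational_closed_geodesic ::
    "'v::euclidean_space set \<Rightarrow> 'v set \<Rightarrow> 'v set \<Rightarrow> ('v, 'n::finite) dual_rep \<Rightarrow> (real \<Rightarrow> 'v set) \<Rightarrow> bool" where
  "rational_closed_geodesic \<Phi> \<Delta> \<Gamma> \<pi> c \<longleftrightarrow>
     (\<exists>p. \<exists>\<mu>\<in>wt' \<Phi> \<Delta> \<pi>. geodesic_line p \<mu> \<subseteq> one_skeleton \<Phi> \<and>
        closed_geodesic_on \<Gamma> (geodesic_line p \<mu>) \<mu> c) \<and>
     (\<exists>s. c s \<in> apt_proj \<Gamma> ` coweight_lattice \<Phi>)"

definition primitive_closed_geodesic ::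
    "'v::euclidean_space set \<Rightarrow> 'v set \<Rightarrow> 'v set \<Rightarrow> ('v, 'n::finite) dual_rep \<Rightarrow> (real \<Rightarrow> 'v set) \<Rightarrow> bool" where
  "primitive_closed_geodesic \<Phi> \<Delta> \<Gamma> \<pi> c \<longleftrightarrow>
     closed_geodesic \<Phi> \<Delta> \<Gamma> \<pi> c \<and>
     \<not> (\<exists>c'. \<exists>k::nat. closed_geodesic \<Phi> \<Delta> \<Gamma> \<pi> c' \<and> k \<ge> 2 \<and> (\<forall>s. c s = c' (real k * s)))"

definition start_equiv :: "((real \<Rightarrow> 'v set) \<times> (real \<Rightarrow> 'v set)) set" where
  "start_equiv = {(c, c'). \<exists>a. \<forall>s. c' s = c (s + a)}"

definition primitive_rational_classes ::
    "'v::euclidean_space set \<Rightarrow> 'v set \<Rightarrow> 'v set \<Rightarrow> ('v, 'n::finite) dual_rep \<Rightarrow> (real \<Rightarrow> 'v set) set set" where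
  "primitive_rational_classes \<Phi> \<Delta> \<Gamma> \<pi> =
     {c. primitive_closed_geodesic \<Phi> \<Delta> \<Gamma> \<pi> c \<and> rational_closed_geodesic \<Phi> \<Delta> \<Gamma> \<pi> c} // start_equiv"

text \<open>As \<Gamma> is discrete, \<open>c\<close> determines the displacement \<open>\<gamma>\<close>.\<close>

definition loop_length :: "'v::euclidean_space set \<Rightarrow> (real \<Rightarrow> 'v set) \<Rightarrow> real" where
  "loop_length \<Gamma> c = (THE r. \<exists>v. \<exists>\<gamma>\<in>\<Gamma>. c = apt_loop \<Gamma> v \<gamma> \<and> r = norm \<gamma>)"

definition class_length ::
    "'v::euclidean_space set \<Rightarrow> 'v set \<Rightarrow> 'v set \<Rightarrow> ('v, 'n::finite) dual_rep \<Rightarrow> (real \<Rightarrow> 'v set) set \<Rightarrow> real" where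
  "class_length \<Phi> \<Delta> \<Gamma> \<pi> C = (THE l. \<forall>c\<in>C. l = loop_length \<Gamma> c / weight_length \<Phi> \<Delta> \<pi>)"

text \<open>
  The normalised lengths are real numbers by definition, whence \<open>powr\<close>. They turn out to be positive
  integers, and then \<open>u powr l\<close> is the ordinary power, for \<open>u = 0\<close> as well.
\<close>

definition Z_function ::
    "'v::euclidean_space set \<Rightarrow> 'v set \<Rightarrow> 'v set \<Rightarrow> ('v, 'n::finite) dual_rep \<Rightarrow> complex \<Rightarrow> complex" where
  "Z_function \<Phi> \<Delta> \<Gamma> \<pi> u =
     (\<Prod>C\<in>primitive_rational_classes \<Phi> \<Delta> \<Gamma> \<pi>.
        inverse (1 - u powr complex_of_real (class_length \<Phi> \<Delta> \<Gamma> \<pi> C)))"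

end

theory Submission
  imports Defs
begin

text \<open>
  Write \<open>N\<close> for the index of \<open>\<Gamma>\<close> in \<open>\<Lambda>\<close> and \<open>deg \<mu>\<close> for the order of \<open>\<mu>\<close> in \<open>\<Lambda>/\<Gamma>\<close>. The zeta function and
  the normalised L-function are each computed to be the inverse of the product of the factors
  \<open>(1 - u ^ deg \<mu>) ^ (N / deg \<mu>)\<close> over the nontrivial weights \<open>\<mu>\<close> (\<open>Z_function_eq\<close>, \<open>L_function_eq\<close>).

  \<^emph>\<open>Zeta function.\<close> A nontrivial weight \<open>\<mu>\<close> is conjugate to a fundamental coweight. Hence it is
  indivisible in \<open>\<Lambda>\<close>, and the lines with direction \<open>\<mu>\<close> through points of \<open>\<Lambda>\<close> lie in the 1-skeleton. So
  a primitive rational closed geodesic with direction \<open>\<mu>\<close> has displacement \<open>deg \<mu> \<mu>\<close>, and its class is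
  given by a point of \<open>\<Lambda>\<close> modulo \<open>\<Gamma>\<close> and the multiples of \<open>\<mu>\<close>. There are \<open>N / deg \<mu>\<close> such classes
  (\<open>card_geodesic_classes\<close>), all of normalised length \<open>deg \<mu>\<close>.

  \<^emph>\<open>L-function.\<close> Let \<open>S\<close> be the set of nontrivial weights. The sum of the translations by \<open>k \<mu>\<close> for \<open>\<mu>\<close> in
  \<open>S\<close> commutes with the Weyl group, so it acts on the W-fixed vectors of the regular representation,
  that is, on the functions on \<open>\<Lambda>/\<Gamma>\<close>. An unramified constituent \<open>\<rho>\<close> contains exactly one line of fixed
  vectors, on which this operator acts by the sum of the \<open>\<chi>\<^sub>\<rho>(\<mu>)\<^sup>k\<close> (\<open>unramified_constituent\<close>). Its
  trace can also be read off from the indicator functions of the points of \<open>\<Lambda>/\<Gamma>\<close>: it is \<open>N\<close> times the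
  number of \<open>\<mu>\<close> with \<open>k \<mu>\<close> in \<open>\<Gamma>\<close> (\<open>orbit_power_sum\<close>). Thus the numbers \<open>\<chi>\<^sub>\<rho>(\<mu>)\<close> have the same power sums
  as the family containing, for each \<open>\<mu>\<close>, every root of unity of order dividing \<open>deg \<mu>\<close> with
  multiplicity \<open>N / deg \<mu>\<close>; so the two families agree up to order, which gives the Euler product
  (\<open>orbit_euler_product\<close>).

  Two further ingredients are needed. The nontrivial weights have multiplicity one
  (\<open>dim_weight_space\<close>), by the elementary theory of highest weights. The regular representation is
  completely reducible (\<open>ex_decomposition\<close>), by means of an invariant inner product.
\<close>

section \<open>Power sums and roots of unity\<close>

lemma sum_poly_eq_of_power_sums:
  fixes a :: "'i \<Rightarrow> complex" and b :: "'j \<Rightarrow> complex"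
  assumes "\<And>k. (\<Sum>i\<in>I. a i ^ k) = (\<Sum>j\<in>J. b j ^ k)"
  shows "(\<Sum>i\<in>I. poly q (a i)) = (\<Sum>j\<in>J. poly q (b j))"
proof -
  have "(\<Sum>i\<in>I. poly q (a i)) = (\<Sum>k\<le>degree q. Polynomial.coeff q k * (\<Sum>i\<in>I. a i ^ k))"
    by (simp add: poly_altdef sum_distrib_left sum.swap[of _ I])
  also have "\<dots> = (\<Sum>k\<le>degree q. Polynomial.coeff q k * (\<Sum>j\<in>J. b j ^ k))"
    by (simp add: assms)
  also have "\<dots> = (\<Sum>j\<in>J. poly q (b j))"
    by (simp add: poly_altdef sum_distrib_left sum.swap[of _ J])
  finally show ?thesis .
qed

text \<open>Power sums determine a finite family of complex numbers up to order: evaluating at a polynomial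
  that vanishes at all values but one recovers the multiplicity of that value.\<close>

lemma prod_eq_of_power_sums:
  fixes a :: "'i \<Rightarrow> complex" and b :: "'j \<Rightarrow> complex"
  assumes I: "finite I" and J: "finite J"
    and ps: "\<And>k. (\<Sum>i\<in>I. a i ^ k) = (\<Sum>j\<in>J. b j ^ k)"
  shows "(\<Prod>i\<in>I. f (a i) :: complex) = (\<Prod>j\<in>J. f (b j))"
proof -
  define S where "S = a ` I \<union> b ` J"
  have S: "finite S" using I J by (simp add: S_def)
  have mult: "card {i \<in> I. a i = z} = card {j \<in> J. b j = z}" if z: "z \<in> S" for z
  proof -
    define q where "q = (\<Prod>s\<in>S - {z}. [:-s, 1:])"
    have q0: "poly q z \<noteq> 0" using S by (auto simp: q_def poly_prod)
    have q: "poly q s = (if s = z then poly q z else 0)" if "s \<in> S" for s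
      using that S by (auto simp: q_def poly_prod)
    have "(\<Sum>i\<in>I. poly q (a i)) = (\<Sum>i\<in>I. if a i = z then poly q z else 0)"
      by (intro sum.cong refl q) (auto simp: S_def)
    also have "\<dots> = of_nat (card {i \<in> I. a i = z}) * poly q z"
      using I by (simp add: sum.If_cases Int_def)
    finally have 1: "(\<Sum>i\<in>I. poly q (a i)) = of_nat (card {i \<in> I. a i = z}) * poly q z" .
    have "(\<Sum>j\<in>J. poly q (b j)) = (\<Sum>j\<in>J. if b j = z then poly q z else 0)"
      by (intro sum.cong refl q) (auto simp: S_def)
    also have "\<dots> = of_nat (card {j \<in> J. b j = z}) * poly q z"
      using J by (simp add: sum.If_cases Int_def)
    finally have 2: "(\<Sum>j\<in>J. poly q (b j)) = of_nat (card {j \<in> J. b j = z}) * poly q z" .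
    show ?thesis
      using sum_poly_eq_of_power_sums[OF ps, of q] 1 2 q0 by simp
  qed
  have "(\<Prod>i\<in>I. f (a i)) = (\<Prod>z\<in>S. \<Prod>i\<in>{i\<in>I. a i = z}. f (a i))"
    using I S by (intro prod.group[symmetric]) (auto simp: S_def)
  also have "\<dots> = (\<Prod>z\<in>S. f z ^ card {i\<in>I. a i = z})"
    by (intro prod.cong refl) simp
  also have "\<dots> = (\<Prod>z\<in>S. f z ^ card {j\<in>J. b j = z})"
    by (intro prod.cong refl) (simp add: mult)
  also have "\<dots> = (\<Prod>z\<in>S. \<Prod>j\<in>{j\<in>J. b j = z}. f (b j))"
    by (intro prod.cong refl) simp
  also have "\<dots> = (\<Prod>j\<in>J. f (b j))"
    using J S by (intro prod.group) (auto simp: S_def)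
  finally show ?thesis .
qed

lemma prod_one_minus_roots_of_unity:
  fixes u :: complex
  assumes d: "d > 0"
  shows "(\<Prod>\<zeta> | \<zeta> ^ d = 1. 1 - \<zeta> * u) = 1 - u ^ d"
proof -
  define R where "R = {\<zeta>::complex. \<zeta> ^ d = 1}"
  have R: "finite R" "card R = d" using d card_roots_unity_eq[OF d] finite_roots_unity[of d]
    by (auto simp: R_def)
  define p where "p = (\<Prod>\<zeta>\<in>R. [:1, -\<zeta>:]) - (1 - Polynomial.monom 1 d)"
  have roots: "insert 0 R \<subseteq> {x. poly p x = 0}"
  proof
    fix x assume "x \<in> insert 0 R"
    then consider "x = 0" | "x \<in> R" by blast
    then show "x \<in> {x. poly p x = 0}"
    proof cases
      case 1 then show ?thesis using d by (simp add: p_def poly_prod poly_monom)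
    next
      case 2
      then have x: "x ^ d = 1" by (simp add: R_def)
      then have "x \<noteq> 0" using d by (auto simp: power_0_left)
      moreover have "inverse x \<in> R" using x by (simp add: R_def power_inverse)
      ultimately have "(\<Prod>\<zeta>\<in>R. 1 - x * \<zeta>) = 0"
        using R by (intro prod_zero) (auto intro!: bexI[of _ "inverse x"])
      then show ?thesis using x by (simp add: p_def poly_prod poly_monom)
    qed
  qed
  have "degree (\<Prod>\<zeta>\<in>R. [:1, -\<zeta>:]) \<le> sum (\<lambda>\<zeta>. degree [:1, -\<zeta>:]) R"
    using degree_prod_sum_le[OF R(1), of "\<lambda>\<zeta>. [:1, -\<zeta>:]"] by (simp add: o_def)
  also have "\<dots> \<le> (\<Sum>\<zeta>\<in>R. 1)" by (intro sum_mono) simp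
  finally have "degree (\<Prod>\<zeta>\<in>R. [:1, -\<zeta>:]) \<le> d" using R by simp
  moreover have "degree (1 - Polynomial.monom (1::complex) d) \<le> d"
    by (intro degree_diff_le) (auto simp: degree_monom_eq)
  ultimately have deg: "degree p \<le> d" unfolding p_def by (rule degree_diff_le)
  have "p = 0"
  proof (rule ccontr)
    assume p: "p \<noteq> 0"
    have "card (insert 0 R) \<le> card {x. poly p x = 0}"
      using roots poly_roots_finite[OF p] by (intro card_mono)
    also have "\<dots> \<le> d" using card_poly_roots_bound[OF p] deg by simp
    finally have "card (insert 0 R) \<le> d" .
    moreover have "0 \<notin> R" using d by (simp add: R_def power_0_left)
    ultimately show False using R by simp
  qed
  then have "poly p u = 0" by simp
  then show ?thesis by (simp add: p_def poly_prod poly_monom R_def mult.commute)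
qed

lemma power_sum_roots_of_unity:
  assumes d: "d > 0"
  shows "(\<Sum>\<zeta> | \<zeta> ^ d = 1. \<zeta> ^ k) = (if d dvd k then of_nat d else (0::complex))"
proof (cases "d dvd k")
  case True
  then obtain m where "k = d * m" by auto
  then show ?thesis using card_roots_unity_eq[OF d] by (simp add: power_mult)
next
  case False
  define R where "R = {\<zeta>::complex. \<zeta> ^ d = 1}"
  define z where "z = exp (2 * of_real pi * \<i> * of_nat 1 / of_nat d)"
  have zd: "z ^ d = 1"
    using d complex_root_unity[of d 1] by (simp add: z_def)
  have zk: "z ^ k \<noteq> 1"
  proof
    assume "z ^ k = 1"
    then have "exp (2 * of_real pi * \<i> * of_nat k / of_nat d) = (1::complex)"
      by (simp add: z_def exp_of_nat_mult[symmetric] field_simps)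
    then show False using False d complex_root_unity_eq_1[of d k] by simp
  qed
  have z0: "z \<noteq> 0" by (simp add: z_def)
  have "(\<Sum>\<zeta>\<in>R. \<zeta> ^ k) = (\<Sum>\<zeta>\<in>R. (z * \<zeta>) ^ k)"
  proof (rule sum.reindex_bij_witness[of _ "\<lambda>x. z * x" "\<lambda>x. x / z"])
  qed (use zd z0 in \<open>auto simp: R_def power_mult_distrib power_divide\<close>)
  also have "\<dots> = z ^ k * (\<Sum>\<zeta>\<in>R. \<zeta> ^ k)"
    by (simp add: power_mult_distrib sum_distrib_left)
  finally have "(\<Sum>\<zeta>\<in>R. \<zeta> ^ k) = 0" using zk by simp
  then show ?thesis using False by (simp add: R_def)
qed

section \<open>Root systems, Weyl groups and lattices\<close>

lemma coroot_inner_self: "\<alpha> \<noteq> 0 \<Longrightarrow> \<alpha> \<bullet> coroot \<alpha> = 2"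
  by (simp add: coroot_def)

lemma linear_root_reflection: "linear (root_reflection \<alpha>)"
  by (auto simp: linear_iff root_reflection_def algebra_simps)

lemma root_reflection_involutive:
  "\<alpha> \<noteq> 0 \<Longrightarrow> root_reflection \<alpha> (root_reflection \<alpha> v) = v"
  by (simp add: root_reflection_def inner_diff_right coroot_inner_self algebra_simps)

lemma inner_root_reflection:
  assumes "\<alpha> \<noteq> 0"
  shows "root_reflection \<alpha> x \<bullet> root_reflection \<alpha> y = x \<bullet> y"
proof -
  have "\<alpha> \<bullet> \<alpha> \<noteq> 0" using assms by simp
  then show ?thesis
    by (simp add: root_reflection_def coroot_def inner_diff_left inner_diff_right inner_commute field_simps)
qed

lemma eq_zero_if_orthogonal_to_spanning:
  fixes z :: "'v::euclidean_space"
  assumes "span S = UNIV" and "\<And>s. s \<in> S \<Longrightarrow> s \<bullet> z = 0"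
  shows "z = 0"
proof -
  have "orthogonal z z"
    by (rule orthogonal_to_span[of _ S]) (use assms in \<open>auto simp: orthogonal_def inner_commute\<close>)
  then show ?thesis by (simp add: orthogonal_def)
qed

lemma group_lattice_group:
  assumes "0 \<in> L" and "\<And>x y. x \<in> L \<Longrightarrow> y \<in> L \<Longrightarrow> x + y \<in> L" and "\<And>x. x \<in> L \<Longrightarrow> - x \<in> L"
  shows "comm_group (lattice_group L)"
proof (rule comm_groupI)
  fix x assume "x \<in> carrier (lattice_group L)"
  then show "\<exists>y\<in>carrier (lattice_group L). y \<otimes>\<^bsub>lattice_group L\<^esub> x = \<one>\<^bsub>lattice_group L\<^esub>"
    using assms by (intro bexI[of _ "- x"]) (auto simp: lattice_group_def)
qed (use assms(1,2) in \<open>simp_all add: lattice_group_def algebra_simps\<close>)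

lemma r_coset_lattice_group: "\<Gamma> #>\<^bsub>lattice_group L\<^esub> v = apt_proj \<Gamma> v"
  by (auto simp: r_coset_def lattice_group_def apt_proj_def)

lemma rcosets_lattice_group: "rcosets\<^bsub>lattice_group L\<^esub> \<Gamma> = apt_proj \<Gamma> ` L"
  by (auto simp: RCOSETS_def r_coset_lattice_group) (auto simp: lattice_group_def)

text \<open>An irreducible root system with a base. Inside the locale, \<open>\<Lambda>\<close> is the coweight lattice and
  \<open>W\<close> the Weyl group.\<close>

locale root_datum =
  fixes \<Phi> \<Delta> :: "'v::euclidean_space set"
  assumes root_system: "irreducible_root_system \<Phi>"
    and base: "root_base \<Phi> \<Delta>"
begin

abbreviation \<Lambda> :: "'v set" where "\<Lambda> \<equiv> coweight_lattice \<Phi>"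
abbreviation W :: "('v \<Rightarrow> 'v) set" where "W \<equiv> weyl_group \<Phi>"

lemma
  shows finite_roots: "finite \<Phi>" and span_roots: "span \<Phi> = UNIV" and zero_not_root: "0 \<notin> \<Phi>"
    and reflection_roots: "\<alpha> \<in> \<Phi> \<Longrightarrow> root_reflection \<alpha> ` \<Phi> = \<Phi>"
    and root_integral: "\<alpha> \<in> \<Phi> \<Longrightarrow> \<beta> \<in> \<Phi> \<Longrightarrow> \<beta> \<bullet> coroot \<alpha> \<in> \<int>"
  using root_system by (auto simp: irreducible_root_system_def)

lemma base_subset: "\<Delta> \<subseteq> \<Phi>" and independent_base: "independent \<Delta>"
  using base by (auto simp: root_base_def)

lemma base_nonzero: "\<beta> \<in> \<Delta> \<Longrightarrow> \<beta> \<noteq> 0"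
  using base_subset zero_not_root by auto

lemma finite_base: "finite \<Delta>"
  using base_subset finite_roots by (rule finite_subset)

lemma span_base_eq: "span \<Delta> = UNIV"
proof -
  have "\<Phi> \<subseteq> span \<Delta>"
  proof
    fix \<alpha> assume "\<alpha> \<in> \<Phi>"
    then obtain n :: "'v \<Rightarrow> nat" where
      "\<alpha> = (\<Sum>\<beta>\<in>\<Delta>. real (n \<beta>) *\<^sub>R \<beta>) \<or> \<alpha> = - (\<Sum>\<beta>\<in>\<Delta>. real (n \<beta>) *\<^sub>R \<beta>)"
      using base by (auto simp: root_base_def)
    moreover have "(\<Sum>\<beta>\<in>\<Delta>. real (n \<beta>) *\<^sub>R \<beta>) \<in> span \<Delta>"
      by (intro span_sum span_scale span_base)
    ultimately show "\<alpha> \<in> span \<Delta>" by (auto intro: span_neg)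
  qed
  then have "span \<Phi> \<subseteq> span \<Delta>" by (rule span_minimal) simp
  then show ?thesis using span_roots by auto
qed

lemma eq_if_base_inner_eq:
  assumes "\<And>\<beta>. \<beta> \<in> \<Delta> \<Longrightarrow> \<beta> \<bullet> x = \<beta> \<bullet> y"
  shows "x = y"
  using eq_zero_if_orthogonal_to_spanning[OF span_base_eq, of "x - y"] assms
  by (simp add: inner_diff_right)

lemma reflection_in_weyl: "\<alpha> \<in> \<Phi> \<Longrightarrow> root_reflection \<alpha> \<in> W"
  using weyl_refl[OF weyl_id] by fastforce

lemma weyl_comp: "w \<in> W \<Longrightarrow> w' \<in> W \<Longrightarrow> w \<circ> w' \<in> W"
  by (induction rule: weyl_group.induct) (auto simp: comp_assoc intro: weyl_refl)

lemma weyl_linear: "w \<in> W \<Longrightarrow> linear w"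
  by (induction rule: weyl_group.induct) (blast intro: linear_compose linear_root_reflection linear_id)+

lemma weyl_add: "w \<in> W \<Longrightarrow> w (x + y) = w x + w y"
  and weyl_scale: "w \<in> W \<Longrightarrow> w (c *\<^sub>R x) = c *\<^sub>R w x"
  and weyl_zero: "w \<in> W \<Longrightarrow> w 0 = 0"
  using weyl_linear by (auto simp: linear_add linear_scale linear_0)

lemma weyl_inner: "w \<in> W \<Longrightarrow> w x \<bullet> w y = x \<bullet> y"
proof (induction rule: weyl_group.induct)
  case weyl_id
  show ?case by simp
next
  case (weyl_refl w \<alpha>)
  then have "\<alpha> \<noteq> 0" using zero_not_root by blast
  then show ?case using weyl_refl by (simp add: inner_root_reflection)
qed

lemma weyl_norm: "w \<in> W \<Longrightarrow> norm (w x) = norm x"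
  using weyl_inner by (simp add: norm_eq_sqrt_inner)

lemma weyl_roots: "w \<in> W \<Longrightarrow> w ` \<Phi> = \<Phi>"
proof (induction rule: weyl_group.induct)
  case weyl_id
  show ?case by simp
next
  case (weyl_refl w \<alpha>)
  have "(root_reflection \<alpha> \<circ> w) ` \<Phi> = root_reflection \<alpha> ` (w ` \<Phi>)" by (rule image_comp[symmetric])
  then show ?case using weyl_refl reflection_roots by simp
qed

lemma weyl_inverse:
  assumes "w \<in> W"
  obtains w' where "w' \<in> W" "\<And>x. w (w' x) = x" "\<And>x. w' (w x) = x"
proof -
  have "\<exists>w'\<in>W. (\<forall>x. w (w' x) = x) \<and> (\<forall>x. w' (w x) = x)"
    using assms
  proof induction
    case weyl_id
    show ?case using weyl_group.weyl_id by (intro bexI[of _ id]) auto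
  next
    case (weyl_refl w \<alpha>)
    then obtain w' where w': "w' \<in> W" "\<forall>x. w (w' x) = x" "\<forall>x. w' (w x) = x" by blast
    have "\<alpha> \<noteq> 0" using weyl_refl zero_not_root by auto
    then show ?case
      using w' weyl_comp[OF w'(1) reflection_in_weyl[OF weyl_refl.hyps(2)]]
      by (intro bexI[of _ "w' \<circ> root_reflection \<alpha>"]) (auto simp: root_reflection_involutive)
  qed
  then show ?thesis using that by blast
qed

lemma finite_weyl: "finite W"
proof (rule inj_on_finite[of "\<lambda>w. restrict w \<Phi>" W "\<Phi> \<rightarrow>\<^sub>E \<Phi>"])
  show "inj_on (\<lambda>w. restrict w \<Phi>) W"
  proof (rule inj_onI)
    fix w w' assume w: "w \<in> W" "w' \<in> W" and eq: "restrict w \<Phi> = restrict w' \<Phi>"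
    have "w y = w' y" if "y \<in> \<Phi>" for y using eq that by (metis restrict_apply')
    then have "w x = w' x" for x
      using linear_eq_on_span[of w w' \<Phi> x] w weyl_linear span_roots by auto
    then show "w = w'" by auto
  qed
  show "(\<lambda>w. restrict w \<Phi>) ` W \<subseteq> \<Phi> \<rightarrow>\<^sub>E \<Phi>" using weyl_roots by fastforce
  show "finite (\<Phi> \<rightarrow>\<^sub>E \<Phi>)" using finite_roots by (intro finite_PiE) auto
qed

lemma coweight_zero [simp]: "0 \<in> \<Lambda>"
  and coweight_add: "x \<in> \<Lambda> \<Longrightarrow> y \<in> \<Lambda> \<Longrightarrow> x + y \<in> \<Lambda>"
  and coweight_diff: "x \<in> \<Lambda> \<Longrightarrow> y \<in> \<Lambda> \<Longrightarrow> x - y \<in> \<Lambda>"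
  and coweight_neg: "x \<in> \<Lambda> \<Longrightarrow> - x \<in> \<Lambda>"
  by (auto simp: coweight_lattice_def inner_add_right inner_diff_right)

lemma coweight_scale_nat: "x \<in> \<Lambda> \<Longrightarrow> real k *\<^sub>R x \<in> \<Lambda>"
  by (auto simp: coweight_lattice_def)

lemma weyl_coweight:
  assumes w: "w \<in> W" and x: "x \<in> \<Lambda>"
  shows "w x \<in> \<Lambda>"
  unfolding coweight_lattice_def
proof (intro CollectI ballI)
  fix \<alpha> assume \<alpha>: "\<alpha> \<in> \<Phi>"
  obtain w' where w': "w' \<in> W" "\<And>x. w' (w x) = x" using weyl_inverse[OF w] by metis
  have "\<alpha> \<bullet> w x = w' \<alpha> \<bullet> x" using weyl_inner[OF w'(1), of \<alpha> "w x"] w' by simp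
  moreover have "w' \<alpha> \<in> \<Phi>" using weyl_roots[OF w'(1)] \<alpha> by auto
  ultimately show "\<alpha> \<bullet> w x \<in> \<int>" using x by (simp add: coweight_lattice_def)
qed

lemma weyl_coweight_iff:
  assumes w: "w \<in> W"
  shows "w x \<in> \<Lambda> \<longleftrightarrow> x \<in> \<Lambda>"
proof -
  obtain w' where w': "w' \<in> W" "\<And>x. w' (w x) = x" using weyl_inverse[OF w] by metis
  show ?thesis using weyl_coweight[OF w, of x] weyl_coweight[OF w'(1), of "w x"] w'(2) by auto
qed

lemma coroot_coweight: "\<alpha> \<in> \<Phi> \<Longrightarrow> coroot \<alpha> \<in> \<Lambda>"
  using root_integral by (simp add: coweight_lattice_def)

lemma coroot_lattice_coweight: "coroot_lattice \<Phi> \<subseteq> \<Lambda>"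
  unfolding coroot_lattice_def coweight_lattice_def
  using root_integral by (auto simp: inner_sum_right intro!: Ints_sum Ints_mult)

lemma coroot_lattice_add:
  assumes "x \<in> coroot_lattice \<Phi>" "y \<in> coroot_lattice \<Phi>"
  shows "x + y \<in> coroot_lattice \<Phi>"
proof -
  obtain m n :: "'v \<Rightarrow> int" where
    "x = (\<Sum>\<alpha>\<in>\<Phi>. of_int (m \<alpha>) *\<^sub>R coroot \<alpha>)" "y = (\<Sum>\<alpha>\<in>\<Phi>. of_int (n \<alpha>) *\<^sub>R coroot \<alpha>)"
    using assms by (auto simp: coroot_lattice_def)
  then have "x + y = (\<Sum>\<alpha>\<in>\<Phi>. of_int (m \<alpha> + n \<alpha>) *\<^sub>R coroot \<alpha>)"
    by (simp add: sum.distrib scaleR_add_left)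
  then show ?thesis unfolding coroot_lattice_def by (auto intro: exI[of _ "\<lambda>\<alpha>. m \<alpha> + n \<alpha>"])
qed

lemma coroot_lattice_neg:
  assumes "x \<in> coroot_lattice \<Phi>"
  shows "- x \<in> coroot_lattice \<Phi>"
proof -
  obtain n :: "'v \<Rightarrow> int" where "x = (\<Sum>\<alpha>\<in>\<Phi>. of_int (n \<alpha>) *\<^sub>R coroot \<alpha>)"
    using assms by (auto simp: coroot_lattice_def)
  then have "- x = (\<Sum>\<alpha>\<in>\<Phi>. of_int (- n \<alpha>) *\<^sub>R coroot \<alpha>)"
    by (simp add: sum_negf)
  then show ?thesis unfolding coroot_lattice_def by (intro CollectI exI[of _ "\<lambda>\<alpha>. - n \<alpha>"]) simp
qed

lemma coroot_lattice_zero: "0 \<in> coroot_lattice \<Phi>"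
  unfolding coroot_lattice_def by (intro CollectI exI[of _ "\<lambda>_. 0"]) simp

lemma base_coroot_comb_in_coroot_lattice:
  "(\<Sum>\<beta>\<in>\<Delta>. of_int (n \<beta>) *\<^sub>R coroot \<beta>) \<in> coroot_lattice \<Phi>"
proof -
  have "(\<Sum>\<beta>\<in>\<Delta>. of_int (n \<beta>) *\<^sub>R coroot \<beta>) = (\<Sum>\<beta>\<in>\<Phi>. of_int (if \<beta> \<in> \<Delta> then n \<beta> else 0) *\<^sub>R coroot \<beta>)"
    using base_subset finite_roots by (intro sum.mono_neutral_cong_left) auto
  then show ?thesis unfolding coroot_lattice_def
    by (intro CollectI exI[of _ "\<lambda>\<beta>. if \<beta> \<in> \<Delta> then n \<beta> else 0"]) simp
qed

lemma base_coroot_coordinates: obtains t where "v = (\<Sum>\<beta>\<in>\<Delta>. t \<beta> *\<^sub>R coroot \<beta>)"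
proof -
  have "v \<in> range (\<lambda>c. \<Sum>\<beta>\<in>\<Delta>. c \<beta> *\<^sub>R \<beta>)"
    using span_finite[OF finite_base] span_base_eq by simp
  then obtain c where c: "v = (\<Sum>\<beta>\<in>\<Delta>. c \<beta> *\<^sub>R \<beta>)" by (rule rangeE)
  have "v = (\<Sum>\<beta>\<in>\<Delta>. (c \<beta> * (\<beta> \<bullet> \<beta>) / 2) *\<^sub>R coroot \<beta>)"
    unfolding c
  proof (rule sum.cong)
    fix \<beta> assume "\<beta> \<in> \<Delta>"
    then have "\<beta> \<bullet> \<beta> \<noteq> 0" using base_nonzero by simp
    then show "c \<beta> *\<^sub>R \<beta> = (c \<beta> * (\<beta> \<bullet> \<beta>) / 2) *\<^sub>R coroot \<beta>" by (simp add: coroot_def)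
  qed simp
  then show ?thesis by (rule that)
qed

text \<open>Every coset of the coroot lattice in the coweight lattice meets the closed parallelepiped spanned
  by the coroots of the base, which contains only finitely many coweights.\<close>

lemma finite_coweights_mod_coroots:
  obtains F where "finite F" "F \<subseteq> \<Lambda>" "\<And>x. x \<in> \<Lambda> \<Longrightarrow> \<exists>y\<in>F. x - y \<in> coroot_lattice \<Phi>"
proof -
  define F where "F = {x \<in> \<Lambda>. \<exists>t. x = (\<Sum>\<beta>\<in>\<Delta>. t \<beta> *\<^sub>R coroot \<beta>) \<and> (\<forall>\<beta>\<in>\<Delta>. 0 \<le> t \<beta> \<and> t \<beta> \<le> 1)}"
  have sub: "F \<subseteq> \<Lambda>" by (auto simp: F_def)
  define K where "K = (\<lambda>\<alpha>. \<Sum>\<beta>\<in>\<Delta>. \<bar>\<alpha> \<bullet> coroot \<beta>\<bar>)"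
  have bound: "\<bar>\<alpha> \<bullet> x\<bar> \<le> K \<alpha>" if x: "x \<in> F" for \<alpha> x
  proof -
    obtain t where t: "x = (\<Sum>\<beta>\<in>\<Delta>. t \<beta> *\<^sub>R coroot \<beta>)" "\<And>\<beta>. \<beta> \<in> \<Delta> \<Longrightarrow> 0 \<le> t \<beta> \<and> t \<beta> \<le> 1"
      using x unfolding F_def by blast
    have "\<bar>\<alpha> \<bullet> x\<bar> \<le> (\<Sum>\<beta>\<in>\<Delta>. \<bar>t \<beta> * (\<alpha> \<bullet> coroot \<beta>)\<bar>)"
      unfolding t(1) by (simp add: inner_sum_right sum_abs)
    also have "\<dots> \<le> K \<alpha>" unfolding K_def
      by (intro sum_mono) (use t(2) in \<open>auto simp: abs_mult intro: mult_left_le_one_le\<close>)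
    finally show ?thesis .
  qed
  have fin: "finite F"
  proof (rule inj_on_finite)
    show "inj_on (\<lambda>x. \<lambda>\<alpha>\<in>\<Delta>. \<lfloor>\<alpha> \<bullet> x\<rfloor>) F"
    proof (rule inj_onI)
      fix x y assume xy: "x \<in> F" "y \<in> F" and eq: "(\<lambda>\<alpha>\<in>\<Delta>. \<lfloor>\<alpha> \<bullet> x\<rfloor>) = (\<lambda>\<alpha>\<in>\<Delta>. \<lfloor>\<alpha> \<bullet> y\<rfloor>)"
      show "x = y"
      proof (rule eq_if_base_inner_eq)
        fix \<beta> assume \<beta>: "\<beta> \<in> \<Delta>"
        have "\<beta> \<bullet> x \<in> \<int>" "\<beta> \<bullet> y \<in> \<int>"
          using xy \<beta> base_subset sub by (auto simp: coweight_lattice_def)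
        moreover have "\<lfloor>\<beta> \<bullet> x\<rfloor> = \<lfloor>\<beta> \<bullet> y\<rfloor>" using fun_cong[OF eq, of \<beta>] \<beta> by simp
        ultimately show "\<beta> \<bullet> x = \<beta> \<bullet> y" by (metis of_int_floor)
      qed
    qed
    show "(\<lambda>x. \<lambda>\<alpha>\<in>\<Delta>. \<lfloor>\<alpha> \<bullet> x\<rfloor>) ` F \<subseteq> (\<Pi>\<^sub>E \<alpha>\<in>\<Delta>. {\<lfloor>- K \<alpha>\<rfloor>..\<lfloor>K \<alpha>\<rfloor>})"
    proof (intro image_subsetI restrict_PiE_iff[THEN iffD2] ballI)
      fix x \<alpha> assume "x \<in> F"
      from bound[OF this, of \<alpha>] show "\<lfloor>\<alpha> \<bullet> x\<rfloor> \<in> {\<lfloor>- K \<alpha>\<rfloor>..\<lfloor>K \<alpha>\<rfloor>}"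
        by (auto intro!: floor_mono simp: abs_le_iff)
    qed
    show "finite (\<Pi>\<^sub>E \<alpha>\<in>\<Delta>. {\<lfloor>- K \<alpha>\<rfloor>..\<lfloor>K \<alpha>\<rfloor>})"
      using finite_base by (intro finite_PiE) auto
  qed
  have cover: "\<exists>y\<in>F. x - y \<in> coroot_lattice \<Phi>" if x: "x \<in> \<Lambda>" for x
  proof -
    obtain t where t: "x = (\<Sum>\<beta>\<in>\<Delta>. t \<beta> *\<^sub>R coroot \<beta>)" by (rule base_coroot_coordinates)
    define q where "q = (\<Sum>\<beta>\<in>\<Delta>. of_int \<lfloor>t \<beta>\<rfloor> *\<^sub>R coroot \<beta>)"
    have q: "q \<in> coroot_lattice \<Phi>" unfolding q_def by (rule base_coroot_comb_in_coroot_lattice)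
    have "x - q = (\<Sum>\<beta>\<in>\<Delta>. frac (t \<beta>) *\<^sub>R coroot \<beta>)"
      by (simp add: t q_def frac_def sum_subtractf scaleR_diff_left)
    moreover have "x - q \<in> \<Lambda>" using x q coroot_lattice_coweight by (intro coweight_diff) auto
    ultimately have "x - q \<in> F" unfolding F_def
      by (auto intro!: exI[of _ "\<lambda>\<beta>. frac (t \<beta>)"] simp: less_imp_le[OF frac_lt_1])
    then show ?thesis using q by (intro bexI[of _ "x - q"]) auto
  qed
  show thesis using that[OF fin sub cover] .
qed

end

text \<open>A finite-index subgroup \<open>\<Gamma>\<close> of the coroot lattice. It need not be stable under the Weyl group.
  Its cosets \<open>apt_proj \<Gamma> v\<close> are the points of the quotient of \<open>V\<close>.\<close>

locale root_datum_sublattice = root_datum \<Phi> \<Delta> for \<Phi> \<Delta> :: "'v::euclidean_space set" +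
  fixes \<Gamma> :: "'v set"
  assumes sub: "subgroup \<Gamma> (lattice_group (coroot_lattice \<Phi>))"
    and fin_index: "finite (rcosets\<^bsub>lattice_group (coroot_lattice \<Phi>)\<^esub> \<Gamma>)"
begin

abbreviation deg :: "'v \<Rightarrow> nat" where "deg \<equiv> weight_degree \<Phi> \<Gamma>"
abbreviation index :: nat where "index \<equiv> lattice_index \<Phi> \<Gamma>"

lemma \<Gamma>_coroot: "\<Gamma> \<subseteq> coroot_lattice \<Phi>"
  using subgroup.subset[OF sub] by (simp add: lattice_group_def)

lemma \<Gamma>_coweight: "\<gamma> \<in> \<Gamma> \<Longrightarrow> \<gamma> \<in> \<Lambda>"
  using \<Gamma>_coroot coroot_lattice_coweight by auto

lemma \<Gamma>_zero [simp]: "0 \<in> \<Gamma>"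
  using subgroup.one_closed[OF sub] by (simp add: lattice_group_def)

lemma \<Gamma>_add: "x \<in> \<Gamma> \<Longrightarrow> y \<in> \<Gamma> \<Longrightarrow> x + y \<in> \<Gamma>"
  using subgroup.m_closed[OF sub] by (simp add: lattice_group_def)

lemma \<Gamma>_neg: assumes "x \<in> \<Gamma>" shows "- x \<in> \<Gamma>"
proof -
  let ?Q = "lattice_group (coroot_lattice \<Phi>)"
  interpret Q: comm_group ?Q
    by (rule group_lattice_group) (auto intro: coroot_lattice_zero coroot_lattice_add coroot_lattice_neg)
  have "inv\<^bsub>?Q\<^esub> x = - x"
    by (rule Q.inv_equality) (use assms \<Gamma>_coroot coroot_lattice_neg in \<open>auto simp: lattice_group_def\<close>)
  then show ?thesis using subgroup.m_inv_closed[OF sub assms] by simp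
qed

lemma \<Gamma>_diff: "x \<in> \<Gamma> \<Longrightarrow> y \<in> \<Gamma> \<Longrightarrow> x - y \<in> \<Gamma>"
  using \<Gamma>_add[OF _ \<Gamma>_neg] by force

lemma \<Gamma>_scale_nat: "x \<in> \<Gamma> \<Longrightarrow> real k *\<^sub>R x \<in> \<Gamma>"
  by (induction k) (auto simp: algebra_simps intro: \<Gamma>_add)

lemma apt_proj_mem: "x \<in> apt_proj \<Gamma> v \<longleftrightarrow> x - v \<in> \<Gamma>"
  by (auto simp: apt_proj_def intro: exI[of _ "x - v"])

lemma apt_proj_eq: "apt_proj \<Gamma> v = apt_proj \<Gamma> v' \<longleftrightarrow> v - v' \<in> \<Gamma>"
proof
  assume "apt_proj \<Gamma> v = apt_proj \<Gamma> v'"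
  moreover have "v \<in> apt_proj \<Gamma> v" by (simp add: apt_proj_mem)
  ultimately show "v - v' \<in> \<Gamma>" by (simp add: apt_proj_mem)
next
  assume d: "v - v' \<in> \<Gamma>"
  show "apt_proj \<Gamma> v = apt_proj \<Gamma> v'"
  proof (rule Set.set_eqI)
    fix x
    have "x - v' \<in> \<Gamma>" if "x - v \<in> \<Gamma>" using \<Gamma>_add[OF that d] by simp
    moreover have "x - v \<in> \<Gamma>" if "x - v' \<in> \<Gamma>" using \<Gamma>_diff[OF that d] by simp
    ultimately show "x \<in> apt_proj \<Gamma> v \<longleftrightarrow> x \<in> apt_proj \<Gamma> v'" by (auto simp: apt_proj_mem)
  qed
qed

lemma finite_quotient: "finite (apt_proj \<Gamma> ` \<Lambda>)"
proof -
  obtain F where F: "finite F" "F \<subseteq> \<Lambda>" "\<And>x. x \<in> \<Lambda> \<Longrightarrow> \<exists>y\<in>F. x - y \<in> coroot_lattice \<Phi>"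
    using finite_coweights_mod_coroots by blast
  have "finite (apt_proj \<Gamma> ` coroot_lattice \<Phi>)"
    using fin_index by (simp add: rcosets_lattice_group)
  then obtain F' where F': "finite F'" "apt_proj \<Gamma> ` coroot_lattice \<Phi> = apt_proj \<Gamma> ` F'"
    by (metis finite_subset_image subset_refl)
  have "apt_proj \<Gamma> ` \<Lambda> \<subseteq> (\<lambda>(y, z). apt_proj \<Gamma> (y + z)) ` (F \<times> F')"
  proof
    fix C assume "C \<in> apt_proj \<Gamma> ` \<Lambda>"
    then obtain x where x: "x \<in> \<Lambda>" "C = apt_proj \<Gamma> x" by auto
    then obtain y where y: "y \<in> F" "x - y \<in> coroot_lattice \<Phi>" using F by blast
    then have "apt_proj \<Gamma> (x - y) \<in> apt_proj \<Gamma> ` F'" using F'(2) by blast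
    then obtain z where z: "z \<in> F'" "x - y - z \<in> \<Gamma>" by (auto simp: apt_proj_eq)
    then have "C = apt_proj \<Gamma> (y + z)" by (simp add: x apt_proj_eq algebra_simps)
    then show "C \<in> (\<lambda>(y, z). apt_proj \<Gamma> (y + z)) ` (F \<times> F')" using y z by auto
  qed
  then show ?thesis using F(1) F'(1) by (meson finite_SigmaI finite_imageI finite_subset)
qed

lemma lattice_index_eq: "index = card (apt_proj \<Gamma> ` \<Lambda>)"
  by (simp add: lattice_index_def rcosets_lattice_group)

lemma
  assumes \<mu>: "\<mu> \<in> \<Lambda>"
  shows weight_degree_pos: "deg \<mu> > 0"
    and scale_in_\<Gamma>_iff: "real k *\<^sub>R \<mu> \<in> \<Gamma> \<longleftrightarrow> deg \<mu> dvd k"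
    and weight_degree_dvd_index: "deg \<mu> dvd index"
proof -
  let ?A = "lattice_group \<Lambda>"
  interpret A: comm_group ?A
    by (rule group_lattice_group) (auto intro: coweight_add coweight_neg)
  have "subgroup \<Gamma> ?A"
  proof (rule A.subgroupI)
    show "inv\<^bsub>?A\<^esub> x \<in> \<Gamma>" if "x \<in> \<Gamma>" for x
    proof -
      have "inv\<^bsub>?A\<^esub> x = - x"
        by (rule A.inv_equality) (use that \<Gamma>_coweight coweight_neg in \<open>auto simp: lattice_group_def\<close>)
      then show ?thesis using \<Gamma>_neg[OF that] by simp
    qed
    show "\<Gamma> \<noteq> {}" using \<Gamma>_zero by blast
  qed (auto simp: lattice_group_def intro: \<Gamma>_coweight \<Gamma>_add)
  then interpret N: normal \<Gamma> ?A by (rule A.subgroup_imp_normal)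
  interpret Q: group "?A Mod \<Gamma>" by (rule N.factorgroup_is_group)
  have car: "carrier (?A Mod \<Gamma>) = apt_proj \<Gamma> ` \<Lambda>"
    by (simp add: FactGroup_def rcosets_lattice_group)
  let ?c = "\<Gamma> #>\<^bsub>?A\<^esub> \<mu>"
  have c: "?c \<in> carrier (?A Mod \<Gamma>)" using \<mu> by (simp add: car r_coset_lattice_group)
  have pow: "?c [^]\<^bsub>?A Mod \<Gamma>\<^esub> k = apt_proj \<Gamma> (real k *\<^sub>R \<mu>)" for k :: nat
  proof (induction k)
    case 0
    show ?case by (auto simp: apt_proj_def)
  next
    case (Suc k)
    have "?c [^]\<^bsub>?A Mod \<Gamma>\<^esub> Suc k = (\<Gamma> #>\<^bsub>?A\<^esub> (real k *\<^sub>R \<mu>)) <#>\<^bsub>?A\<^esub> ?c"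
      using Suc by (simp add: r_coset_lattice_group)
    also have "\<dots> = \<Gamma> #>\<^bsub>?A\<^esub> (real k *\<^sub>R \<mu> \<otimes>\<^bsub>?A\<^esub> \<mu>)"
      using \<mu> by (intro N.rcos_sum) (auto simp: lattice_group_def coweight_scale_nat)
    also have "\<dots> = apt_proj \<Gamma> (real (Suc k) *\<^sub>R \<mu>)"
      by (simp add: r_coset_lattice_group) (simp add: lattice_group_def algebra_simps)
    finally show ?case .
  qed
  have deg: "deg \<mu> = Q.ord ?c" by (simp add: weight_degree_def Let_def)
  have one: "\<one>\<^bsub>?A Mod \<Gamma>\<^esub> = apt_proj \<Gamma> 0" by (auto simp: apt_proj_def)
  show "real k *\<^sub>R \<mu> \<in> \<Gamma> \<longleftrightarrow> deg \<mu> dvd k"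
    using Q.pow_eq_id[OF c, of k] by (simp only: pow one deg apt_proj_eq) simp
  have fin: "finite (carrier (?A Mod \<Gamma>))" using finite_quotient by (simp add: car)
  show "deg \<mu> > 0" using Q.ord_ge_1[OF fin c] by (simp add: deg)
  show "deg \<mu> dvd index"
    using Q.ord_dvd_group_order[OF c] by (simp add: deg lattice_index_eq order_def car)
qed

end

section \<open>Multiplicity one for the nontrivial weights\<close>

lemma scaleR_matrix_vector_mult:
  fixes A :: "complex ^ 'n ^ 'm"
  shows "(r *\<^sub>R A) *v x = complex_of_real r *s (A *v x)"
proof (rule vec_eq_iff[THEN iffD2], rule allI)
  fix i show "((r *\<^sub>R A) *v x) $ i = (complex_of_real r *s (A *v x)) $ i"
    by (simp add: matrix_vector_mult_def sum_distrib_left) (simp add: scaleR_conv_of_real mult.assoc)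
qed

lemma eigenvectors_sum_eq_zero:
  fixes D :: "complex ^ 'n \<Rightarrow> complex ^ 'n" and t :: "'k \<Rightarrow> complex"
  assumes K: "finite K" and inj: "inj_on t K"
    and add: "\<And>x y. D (x + y) = D x + D y" and scale: "\<And>c x. D (c *s x) = c *s D x"
    and eig: "\<And>k. k \<in> K \<Longrightarrow> D (v k) = t k *s v k" and sum0: "(\<Sum>k\<in>K. v k) = 0"
  shows "\<forall>k\<in>K. v k = 0"
  using K inj eig sum0
proof (induction K arbitrary: v)
  case empty
  then show ?case by simp
next
  case (insert a K)
  have D0: "D 0 = 0" using scale[of 0 0] by simp
  have Dsum: "D (\<Sum>k\<in>K. v k) = (\<Sum>k\<in>K. D (v k))"
    using insert.hyps(1) by (induction K rule: finite_induct) (auto simp: add D0)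
  have va: "v a = - (\<Sum>k\<in>K. v k)" using insert.prems insert.hyps by (simp add: add_eq_0_iff2)
  have "D (v a + (\<Sum>k\<in>K. v k)) = 0" using insert.prems(3) insert.hyps D0 by simp
  then have "t a *s v a + (\<Sum>k\<in>K. t k *s v k) = 0"
    using insert.prems(2) by (simp add: add Dsum)
  moreover have "t a *s v a + (\<Sum>k\<in>K. t a *s v k) = 0"
    by (simp add: va vec.scale_sum_right)
  ultimately have "(\<Sum>k\<in>K. t k *s v k) = (\<Sum>k\<in>K. t a *s v k)"
    by (metis add_left_cancel)
  then have "(\<Sum>k\<in>K. (t k - t a) *s v k) = 0"
    by (simp add: vec.scale_left_diff_distrib sum_subtractf)
  moreover have "D ((t k - t a) *s v k) = t k *s ((t k - t a) *s v k)" if "k \<in> K" for k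
  proof -
    have "D ((t k - t a) *s v k) = (t k - t a) *s (t k *s v k)"
      using that insert.prems(2)[of k] scale[of "t k - t a" "v k"] by simp
    then show ?thesis by (simp only: vec.scale_scale mult.commute)
  qed
  ultimately have z: "\<forall>k\<in>K. (t k - t a) *s v k = 0"
    using insert.prems(1) by (intro insert.IH) auto
  have "v k = 0" if "k \<in> K" for k
  proof -
    have "t k \<noteq> t a" using that insert.prems(1) insert.hyps by (auto simp: inj_on_def)
    then show ?thesis using z[rule_format, OF that] by simp
  qed
  then show ?case using va by simp
qed

lemma matrix_preserves_span:
  fixes A :: "complex ^ 'n ^ 'n"
  assumes "\<And>g. g \<in> G \<Longrightarrow> A *v g \<in> vec.span G" and "v \<in> vec.span G"
  shows "A *v v \<in> vec.span G"
  using assms(2)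
proof (rule vec.span_induct)
  show "vec.subspace {v. A *v v \<in> vec.span G}"
    by (rule vec.subspaceI)
       (auto simp: matrix_vector_right_distrib vector_scalar_commute vec.span_zero
         intro: vec.span_add vec.span_scale)
qed (use assms(1) in auto)

text \<open>The vectors obtained from \<open>x\<close> by applying \<open>k\<close> operators \<open>F\<^sub>\<beta>\<close>.\<close>

primrec lowering_words ::
    "'v::euclidean_space set \<Rightarrow> ('v, 'n::finite) dual_rep \<Rightarrow> complex ^ 'n \<Rightarrow> nat \<Rightarrow> (complex ^ 'n) set" where
  "lowering_words \<Delta> \<pi> x 0 = {x}"
| "lowering_words \<Delta> \<pi> x (Suc k) = (\<Union>\<beta>\<in>\<Delta>. (\<lambda>v. Fop \<pi> \<beta> *v v) ` lowering_words \<Delta> \<pi> x k)"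

text \<open>An irreducible representation of the dual group; \<open>V \<mu>\<close> is its weight space of weight \<open>\<mu>\<close>.\<close>

locale dual_irrep = root_datum \<Phi> \<Delta> for \<Phi> \<Delta> :: "'v::euclidean_space set" +
  fixes \<pi> :: "('v, 'n::finite) dual_rep"
  assumes irrep: "irreducible_dual_rep \<Delta> \<pi>"
begin

abbreviation V :: "'v \<Rightarrow> (complex ^ 'n) set" where "V \<mu> \<equiv> weight_space \<Delta> \<pi> \<mu>"

lemma is_rep: "is_dual_rep \<Delta> \<pi>"
  using irrep by (simp add: irreducible_dual_rep_def)

lemma H_E:
  assumes "\<alpha> \<in> \<Delta>" "\<beta> \<in> \<Delta>"
  shows "Hop \<pi> \<alpha> *v (Eop \<pi> \<beta> *v x)
    = Eop \<pi> \<beta> *v (Hop \<pi> \<alpha> *v x) + complex_of_real (\<alpha> \<bullet> coroot \<beta>) *s (Eop \<pi> \<beta> *v x)"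
proof -
  have "mat_bracket (Hop \<pi> \<alpha>) (Eop \<pi> \<beta>) *v x = ((\<alpha> \<bullet> coroot \<beta>) *\<^sub>R Eop \<pi> \<beta>) *v x"
    using is_rep assms by (simp add: is_dual_rep_def)
  then show ?thesis
    by (simp add: mat_bracket_def matrix_vector_mult_diff_rdistrib matrix_vector_mul_assoc
        scaleR_matrix_vector_mult algebra_simps)
qed

lemma H_F:
  assumes "\<alpha> \<in> \<Delta>" "\<beta> \<in> \<Delta>"
  shows "Hop \<pi> \<alpha> *v (Fop \<pi> \<beta> *v x)
    = Fop \<pi> \<beta> *v (Hop \<pi> \<alpha> *v x) + complex_of_real (- (\<alpha> \<bullet> coroot \<beta>)) *s (Fop \<pi> \<beta> *v x)"
proof -
  have "mat_bracket (Hop \<pi> \<alpha>) (Fop \<pi> \<beta>) *v x = ((- (\<alpha> \<bullet> coroot \<beta>)) *\<^sub>R Fop \<pi> \<beta>) *v x"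
    using is_rep assms by (simp add: is_dual_rep_def)
  then show ?thesis
    by (simp only: mat_bracket_def matrix_vector_mult_diff_rdistrib matrix_vector_mul_assoc
        scaleR_matrix_vector_mult) (simp add: algebra_simps)
qed

lemma E_F:
  assumes "\<alpha> \<in> \<Delta>" "\<beta> \<in> \<Delta>"
  shows "Eop \<pi> \<alpha> *v (Fop \<pi> \<beta> *v x)
    = Fop \<pi> \<beta> *v (Eop \<pi> \<alpha> *v x) + (if \<alpha> = \<beta> then Hop \<pi> \<alpha> *v x else 0)"
proof -
  have "mat_bracket (Eop \<pi> \<alpha>) (Fop \<pi> \<beta>) *v x = (if \<alpha> = \<beta> then Hop \<pi> \<alpha> else 0) *v x"
    using is_rep assms by (simp add: is_dual_rep_def)
  then show ?thesis
    by (simp add: mat_bracket_def matrix_vector_mult_diff_rdistrib matrix_vector_mul_assoc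
        algebra_simps split: if_splits)
qed

lemma H_weight: "x \<in> V \<mu> \<Longrightarrow> \<alpha> \<in> \<Delta> \<Longrightarrow> Hop \<pi> \<alpha> *v x = complex_of_real (\<alpha> \<bullet> \<mu>) *s x"
  by (simp add: weight_space_def)

lemma E_weight:
  assumes "x \<in> V \<mu>" "\<beta> \<in> \<Delta>"
  shows "Eop \<pi> \<beta> *v x \<in> V (\<mu> + coroot \<beta>)"
  unfolding weight_space_def
  using assms by (auto simp: H_E H_weight vector_scalar_commute inner_add_right vec.scale_left_distrib)

lemma F_weight:
  assumes "x \<in> V \<mu>" "\<beta> \<in> \<Delta>"
  shows "Fop \<pi> \<beta> *v x \<in> V (\<mu> - coroot \<beta>)"
  unfolding weight_space_def
  using assms by (auto simp: H_F H_weight vector_scalar_commute inner_diff_right vec.scale_left_diff_distrib)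

lemma subspace_weight_space: "vec.subspace (V \<mu>)"
  by (rule vec.subspaceI)
     (auto simp: weight_space_def matrix_vector_right_distrib vector_scalar_commute vec.scale_right_distrib mult.commute)

lemma zero_weight_space [simp]: "0 \<in> V \<mu>"
  using subspace_weight_space by (rule vec.subspace_0)

text \<open>There is a linear form, the height, with value 1 at the coroots of the base. It is written as a
  combination of the elements of the base because these act on the representation through \<open>H\<close>.\<close>

lemma weight_height: "\<exists>c. \<forall>\<beta>\<in>\<Delta>. (\<Sum>\<gamma>\<in>\<Delta>. c \<gamma> * (\<gamma> \<bullet> coroot \<beta>)) = (1::real)"
proof -
  obtain f :: "'v \<Rightarrow> real" where f: "linear f" "\<And>\<beta>. \<beta> \<in> \<Delta> \<Longrightarrow> f \<beta> = \<beta> \<bullet> \<beta> / 2"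
    using linear_independent_extend[OF independent_base, of "\<lambda>\<beta>. \<beta> \<bullet> \<beta> / 2"] by blast
  define h where "h = adjoint f 1"
  have h: "h \<bullet> v = f v" for v
    using adjoint_works[OF f(1), of v 1] by (simp add: h_def inner_commute)
  obtain t where t: "h = (\<Sum>\<beta>\<in>\<Delta>. t \<beta> *\<^sub>R coroot \<beta>)" by (rule base_coroot_coordinates)
  show ?thesis
  proof (intro exI ballI)
    fix \<beta> assume \<beta>: "\<beta> \<in> \<Delta>"
    have "h \<bullet> coroot \<beta> = 1"
      using base_nonzero[OF \<beta>] unfolding h coroot_def linear_scale[OF f(1)] f(2)[OF \<beta>] by simp
    moreover have "coroot \<gamma> \<bullet> x = 2 / (\<gamma> \<bullet> \<gamma>) * (\<gamma> \<bullet> x)" for \<gamma> x :: 'v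
      by (simp add: coroot_def)
    ultimately show "(\<Sum>\<gamma>\<in>\<Delta>. (t \<gamma> * (2 / (\<gamma> \<bullet> \<gamma>))) * (\<gamma> \<bullet> coroot \<beta>)) = 1"
      by (simp only: t inner_sum_left inner_scaleR_left mult.assoc)
  qed
qed

text \<open>A vector killed by all raising operators generates the representation under the lowering
  operators, and lowering strictly decreases the height of the weight; so such a vector spans
  its weight space.\<close>

lemma highest_weight_space_line:
  assumes x: "x \<in> V \<mu>" "x \<noteq> 0" and kill: "\<And>\<beta>. \<beta> \<in> \<Delta> \<Longrightarrow> Eop \<pi> \<beta> *v x = 0"
    and y: "y \<in> V \<mu>"
  shows "\<exists>c. y = c *s x"
proof -
  let ?L = "lowering_words \<Delta> \<pi> x"
  let ?S = "vec.span (\<Union>k. ?L k)"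
  obtain c where c: "\<And>\<beta>. \<beta> \<in> \<Delta> \<Longrightarrow> (\<Sum>\<gamma>\<in>\<Delta>. c \<gamma> * (\<gamma> \<bullet> coroot \<beta>)) = 1"
    using weight_height by blast
  define ht where "ht = (\<lambda>\<nu>. \<Sum>\<gamma>\<in>\<Delta>. c \<gamma> * (\<gamma> \<bullet> \<nu>))"
  define D where "D = (\<lambda>v. \<Sum>\<gamma>\<in>\<Delta>. complex_of_real (c \<gamma>) *s (Hop \<pi> \<gamma> *v v))"
  have D_weight: "D v = complex_of_real (ht \<nu>) *s v" if "v \<in> V \<nu>" for v \<nu>
    using that by (simp add: D_def ht_def H_weight vec.scale_sum_left)
  have D_add: "D (v + v') = D v + D v'" for v v'
    by (simp add: D_def matrix_vector_right_distrib vec.scale_right_distrib sum.distrib)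
  have D_scale: "D (a *s v) = a *s D v" for a v
    by (simp add: D_def vector_scalar_commute vec.scale_sum_right mult.commute)
  \<comment> \<open>\<open>D\<close> is the action of the height; its eigenvalue drops by one with each lowering operator.\<close>
  have word: "\<exists>\<nu>. w \<in> V \<nu> \<and> ht \<nu> = ht \<mu> - real k" if "w \<in> ?L k" for k w
    using that
  proof (induction k arbitrary: w)
    case 0
    then show ?case using x by auto
  next
    case (Suc k)
    then obtain \<beta> v where \<beta>: "\<beta> \<in> \<Delta>" "v \<in> ?L k" "w = Fop \<pi> \<beta> *v v" by auto
    then obtain \<nu> where \<nu>: "v \<in> V \<nu>" "ht \<nu> = ht \<mu> - real k" using Suc.IH by blast
    have "ht (\<nu> - coroot \<beta>) = ht \<mu> - real (Suc k)"
      using c[OF \<beta>(1)] \<nu>(2) by (simp add: ht_def inner_diff_right right_diff_distrib sum_subtractf)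
    then show ?case using F_weight[OF \<nu>(1) \<beta>(1)] \<beta>(3) by blast
  qed
  have F_closed: "Fop \<pi> \<beta> *v v \<in> ?S" if "\<beta> \<in> \<Delta>" "v \<in> ?S" for \<beta> v
  proof (rule matrix_preserves_span[OF _ that(2)])
    fix g assume "g \<in> (\<Union>k. ?L k)"
    then obtain k where "g \<in> ?L k" by blast
    then have "Fop \<pi> \<beta> *v g \<in> ?L (Suc k)" using that(1) by auto
    then show "Fop \<pi> \<beta> *v g \<in> ?S" by (intro vec.span_base) blast
  qed
  have H_word: "Hop \<pi> \<beta> *v g \<in> ?S" if \<beta>: "\<beta> \<in> \<Delta>" and g: "g \<in> ?L k" for \<beta> g k
  proof -
    obtain \<nu> where "g \<in> V \<nu>" using word[OF g] by blast
    moreover have "g \<in> ?S" using g by (intro vec.span_base) blast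
    ultimately show ?thesis using \<beta> by (simp add: H_weight vec.span_scale)
  qed
  have H_closed: "Hop \<pi> \<beta> *v v \<in> ?S" if "\<beta> \<in> \<Delta>" "v \<in> ?S" for \<beta> v
    by (rule matrix_preserves_span[OF _ that(2)]) (use that(1) H_word in blast)
  have E_word: "Eop \<pi> \<alpha> *v g \<in> ?S" if "\<alpha> \<in> \<Delta>" "g \<in> ?L k" for \<alpha> g k
    using that(2)
  proof (induction k arbitrary: g)
    case 0
    then show ?case using kill[OF that(1)] by (simp add: vec.span_zero)
  next
    case (Suc k)
    then obtain \<beta> v where \<beta>: "\<beta> \<in> \<Delta>" "v \<in> ?L k" "g = Fop \<pi> \<beta> *v v" by auto
    have "Fop \<pi> \<beta> *v (Eop \<pi> \<alpha> *v v) \<in> ?S" using Suc.IH \<beta> F_closed by blast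
    moreover have "(if \<alpha> = \<beta> then Hop \<pi> \<alpha> *v v else 0) \<in> ?S"
      using H_word[OF that(1) \<beta>(2)] by (auto simp: vec.span_zero)
    ultimately show ?case unfolding \<beta>(3) E_F[OF that(1) \<beta>(1)] by (rule vec.span_add)
  qed
  have E_closed: "Eop \<pi> \<beta> *v v \<in> ?S" if "\<beta> \<in> \<Delta>" "v \<in> ?S" for \<beta> v
    by (rule matrix_preserves_span[OF _ that(2)]) (use that(1) E_word in blast)
  have "x \<in> ?L 0" by simp
  then have "x \<in> ?S" by (intro vec.span_base) blast
  have "vec.subspace ?S \<and> (\<forall>\<alpha>\<in>\<Delta>. \<forall>v\<in>?S. Eop \<pi> \<alpha> *v v \<in> ?S \<and> Fop \<pi> \<alpha> *v v \<in> ?S \<and> Hop \<pi> \<alpha> *v v \<in> ?S)"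
    using E_closed F_closed H_closed by (simp add: vec.subspace_span)
  then have "?S = {0} \<or> ?S = UNIV" using irrep unfolding irreducible_dual_rep_def by blast
  then have S: "?S = UNIV" using \<open>x \<in> ?S\<close> x(2) by auto
  have "\<exists>n f. (\<forall>k. f k \<in> vec.span (?L k)) \<and> (\<forall>k\<ge>n. f k = 0) \<and> v = (\<Sum>k<n. f k)" (is "?G v")
    if "v \<in> ?S" for v
    using that
  proof (rule vec.span_induct)
    show "vec.subspace {v. ?G v}"
    proof (rule vec.subspaceI)
      show "0 \<in> {v. ?G v}" by (intro CollectI exI[of _ 0] exI[of _ "\<lambda>_. 0"]) (simp add: vec.span_zero)
    next
      fix v v' assume "v \<in> {v. ?G v}" "v' \<in> {v. ?G v}"
      then obtain n f n' f' where
        f: "\<And>k. f k \<in> vec.span (?L k)" "\<And>k. k \<ge> n \<Longrightarrow> f k = 0" "v = (\<Sum>k<n. f k)" and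
        f': "\<And>k. f' k \<in> vec.span (?L k)" "\<And>k. k \<ge> n' \<Longrightarrow> f' k = 0" "v' = (\<Sum>k<n'. f' k)"
        by blast
      have "v = (\<Sum>k<max n n'. f k)" unfolding f(3)
        by (rule sum.mono_neutral_left) (use f(2) in auto)
      moreover have "v' = (\<Sum>k<max n n'. f' k)" unfolding f'(3)
        by (rule sum.mono_neutral_left) (use f'(2) in auto)
      ultimately show "v + v' \<in> {v. ?G v}"
        using f f' by (intro CollectI exI[of _ "max n n'"] exI[of _ "\<lambda>k. f k + f' k"])
          (simp add: vec.span_add sum.distrib)
    next
      fix a v assume "v \<in> {v. ?G v}"
      then obtain n f where
        f: "\<And>k. f k \<in> vec.span (?L k)" "\<And>k. k \<ge> n \<Longrightarrow> f k = 0" "v = (\<Sum>k<n. f k)"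
        by blast
      then show "a *s v \<in> {v. ?G v}"
        by (intro CollectI exI[of _ n] exI[of _ "\<lambda>k. a *s f k"]) (simp add: vec.span_scale vec.scale_sum_right)
    qed
  next
    fix g assume "g \<in> (\<Union>k. ?L k)"
    then obtain k where "g \<in> ?L k" by blast
    then show "?G g"
      by (intro exI[of _ "Suc k"] exI[of _ "\<lambda>j. if j = k then g else 0"])
         (auto simp: vec.span_zero intro: vec.span_base)
  qed
  then obtain n f where f: "\<And>k. f k \<in> vec.span (?L k)" "\<And>k. k \<ge> n \<Longrightarrow> f k = 0" "y = (\<Sum>k<n. f k)"
    using S by blast
  have eig: "D v = complex_of_real (ht \<mu> - real k) *s v" if "v \<in> vec.span (?L k)" for k v
    using that
  proof (rule vec.span_induct)
    show "vec.subspace {v. D v = complex_of_real (ht \<mu> - real k) *s v}"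
      using D_scale[of 0 0]
      by (intro vec.subspaceI) (auto simp: D_add D_scale vec.scale_right_distrib mult.commute)
    show "D g = complex_of_real (ht \<mu> - real k) *s g" if "g \<in> ?L k" for g
      using word[OF that] D_weight by metis
  qed
  \<comment> \<open>As \<open>y\<close> has the height of \<open>x\<close>, it is the component of degree 0 of its own expansion.\<close>
  define g where "g = f(0 := f 0 - y)"
  have "\<forall>k\<in>{..<Suc n}. g k = 0"
  proof (rule eigenvectors_sum_eq_zero[where D = D and t = "\<lambda>k. complex_of_real (ht \<mu> - real k)"])
    show "inj_on (\<lambda>k. complex_of_real (ht \<mu> - real k)) {..<Suc n}" by (auto simp: inj_on_def)
    show "D (g k) = complex_of_real (ht \<mu> - real k) *s g k" if "k \<in> {..<Suc n}" for k
    proof (cases "k = 0")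
      case True
      have "D (f 0 + (-1) *s y) = complex_of_real (ht \<mu>) *s (f 0 + (-1) *s y)"
        unfolding D_add D_scale using eig[OF f(1), of 0] D_weight[OF y]
        by (simp add: vec.scale_right_distrib)
      then show ?thesis using True by (simp add: g_def)
    next
      case False
      then show ?thesis using eig[OF f(1), of k] by (simp add: g_def)
    qed
    have "y = (\<Sum>k<Suc n. f k)" using f(2)[of n] f(3) by simp
    also have "\<dots> = f 0 + (\<Sum>k<n. f (Suc k))" by (rule sum.lessThan_Suc_shift)
    finally have "y = f 0 + (\<Sum>k<n. f (Suc k))" .
    moreover have "(\<Sum>k<Suc n. g k) = g 0 + (\<Sum>k<n. g (Suc k))" by (rule sum.lessThan_Suc_shift)
    ultimately show "(\<Sum>k<Suc n. g k) = 0" by (simp add: g_def algebra_simps)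
  qed (auto simp: D_add D_scale)
  then have "g 0 = 0" by (rule bspec) simp
  then have "y = f 0" by (simp add: g_def)
  moreover have "f 0 \<in> vec.span {x}" using f(1)[of 0] by simp
  ultimately show ?thesis by (auto simp: vec.span_singleton)
qed

end

text \<open>An irreducible representation whose nontrivial weights form the orbit of the fundamental
  coweight \<open>\<omega>\<close> belonging to the element \<open>\<alpha>\<^sub>0\<close> of the base.\<close>

locale minuscule_datum = dual_irrep \<Phi> \<Delta> \<pi>
  for \<Phi> \<Delta> :: "'v::euclidean_space set" and \<pi> :: "('v, 'n::finite) dual_rep" +
  fixes \<alpha>\<^sub>0 \<omega> :: 'v
  assumes \<alpha>\<^sub>0: "\<alpha>\<^sub>0 \<in> \<Delta>"
    and \<omega>: "\<And>\<beta>. \<beta> \<in> \<Delta> \<Longrightarrow> \<beta> \<bullet> \<omega> = (if \<beta> = \<alpha>\<^sub>0 then 1 else 0)"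
    and orbit: "wt' \<Phi> \<Delta> \<pi> = {w \<omega> | w. w \<in> weyl_group \<Phi>}"
begin

abbreviation Wt :: "'v set" where "Wt \<equiv> wt' \<Phi> \<Delta> \<pi>"

lemma \<omega>_weight: "\<omega> \<in> Wt"
  unfolding orbit by (auto intro!: exI[of _ id] weyl_group.weyl_id)

lemma finite_Wt: "finite Wt"
  using finite_weyl by (simp add: orbit setcompr_eq_image)

lemma weyl_Wt:
  assumes w: "w \<in> W" and \<mu>: "\<mu> \<in> Wt"
  shows "w \<mu> \<in> Wt"
proof -
  obtain w' where w': "w' \<in> W" "\<mu> = w' \<omega>" using \<mu> by (auto simp: orbit)
  then have "w \<mu> = (w \<circ> w') \<omega>" by simp
  then show ?thesis using weyl_comp[OF w w'(1)] unfolding orbit by blast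
qed

lemma weyl_bij_Wt:
  assumes w: "w \<in> W" shows "bij_betw w Wt Wt"
proof -
  obtain w' where "w' \<in> W" "\<And>x. w (w' x) = x" "\<And>x. w' (w x) = x" by (rule weyl_inverse[OF w]) blast
  then show ?thesis using weyl_Wt[OF w] weyl_Wt[of w'] by (intro bij_betwI[of _ _ _ w']) auto
qed

lemma norm_Wt: "\<mu> \<in> Wt \<Longrightarrow> norm \<mu> = norm \<omega>"
  by (auto simp: orbit weyl_norm)

lemma Wt_nonzero: "\<mu> \<in> Wt \<Longrightarrow> \<mu> \<noteq> 0"
  by (simp add: wt'_def)

text \<open>Were the set of weights infinite, the sum defining the multiset \<open>wt\<close> would have the default
  value 0, and there would be no nontrivial weights.\<close>

lemma count_wt:
  defines "A \<equiv> {\<mu> \<in> \<Lambda>. V \<mu> \<noteq> {0}}"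
  shows "count (wt \<Phi> \<Delta> \<pi>) \<mu> = (if \<mu> \<in> A then vec.dim (V \<mu>) else 0)"
proof -
  have fin: "finite A"
  proof (rule ccontr)
    assume "infinite A"
    then have "Wt = {}" by (simp add: wt'_def wt_def A_def)
    then show False using \<omega>_weight by simp
  qed
  show ?thesis
    using fin by (simp add: wt_def A_def[symmetric] count_sum sum.delta)
qed

lemma mem_Wt_iff: "\<mu> \<in> Wt \<longleftrightarrow> \<mu> \<in> \<Lambda> \<and> V \<mu> \<noteq> {0} \<and> \<mu> \<noteq> 0"
proof -
  have "vec.dim (V \<mu>) > 0" if "V \<mu> \<noteq> {0}"
  proof (rule ccontr)
    assume "\<not> vec.dim (V \<mu>) > 0"
    then have "V \<mu> \<subseteq> {0}" by (simp add: vec.dim_eq_0)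
    then show False using that zero_weight_space[of \<mu>] by blast
  qed
  then show ?thesis
    unfolding wt'_def by (auto simp: count_wt simp flip: count_greater_zero_iff split: if_splits)
qed

lemma Wt_coweight: "\<mu> \<in> Wt \<Longrightarrow> \<mu> \<in> \<Lambda>"
  by (simp add: mem_Wt_iff)

lemma longer_weight_space_trivial:
  assumes "\<mu> \<in> Wt" "\<nu> \<in> \<Lambda>" "\<nu> \<bullet> \<nu> > \<mu> \<bullet> \<mu>" "y \<in> V \<nu>"
  shows "y = 0"
proof (rule ccontr)
  assume "y \<noteq> 0"
  then have "V \<nu> \<noteq> {0}" using assms(4) by auto
  moreover have "\<nu> \<noteq> 0" using assms(3) inner_ge_zero[of \<mu>] by (metis inner_zero_left not_less)
  ultimately have "\<nu> \<in> Wt" using assms(2) by (simp add: mem_Wt_iff)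
  then have "norm \<nu> = norm \<mu>" using norm_Wt assms(1) by simp
  then show False using assms(3) by (simp add: norm_eq_sqrt_inner)
qed

text \<open>Adding a simple coroot to a weight on the nonnegative side of its wall makes it longer, whereas
  all nontrivial weights have the same length.\<close>

lemma E_kills:
  assumes \<mu>: "\<mu> \<in> Wt" and \<beta>: "\<beta> \<in> \<Delta>" and pos: "\<beta> \<bullet> \<mu> \<ge> 0" and x: "x \<in> V \<mu>"
  shows "Eop \<pi> \<beta> *v x = 0"
proof (rule longer_weight_space_trivial[OF \<mu>])
  have "coroot \<beta> \<bullet> coroot \<beta> > 0" using base_nonzero[OF \<beta>] by (simp add: coroot_def)
  moreover have "\<mu> \<bullet> coroot \<beta> \<ge> 0" using pos by (simp add: coroot_def inner_commute)
  ultimately show "(\<mu> + coroot \<beta>) \<bullet> (\<mu> + coroot \<beta>) > \<mu> \<bullet> \<mu>"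
    unfolding inner_add_left inner_add_right inner_commute[of "coroot \<beta>" \<mu>] by linarith
qed (use E_weight[OF x \<beta>] Wt_coweight[OF \<mu>] \<beta> base_subset coroot_coweight coweight_add in auto)

lemma F_kills:
  assumes \<mu>: "\<mu> \<in> Wt" and \<beta>: "\<beta> \<in> \<Delta>" and neg: "\<beta> \<bullet> \<mu> \<le> 0" and x: "x \<in> V \<mu>"
  shows "Fop \<pi> \<beta> *v x = 0"
proof (rule longer_weight_space_trivial[OF \<mu>])
  have "coroot \<beta> \<bullet> coroot \<beta> > 0" using base_nonzero[OF \<beta>] by (simp add: coroot_def)
  moreover have "\<mu> \<bullet> coroot \<beta> \<le> 0" using neg
    by (auto simp: coroot_def inner_commute intro: divide_nonpos_nonneg mult_nonneg_nonpos)
  ultimately show "(\<mu> - coroot \<beta>) \<bullet> (\<mu> - coroot \<beta>) > \<mu> \<bullet> \<mu>"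
    unfolding inner_diff_left inner_diff_right inner_commute[of "coroot \<beta>" \<mu>] by linarith
qed (use F_weight[OF x \<beta>] Wt_coweight[OF \<mu>] \<beta> base_subset coroot_coweight coweight_diff in auto)

text \<open>Nontrivial weights have multiplicity one. For dominant weights this is
  \<open>highest_weight_space_line\<close>. If \<open>\<beta> \<bullet> \<mu> = - k\<close> is negative, then \<open>E\<^sub>\<beta>\<^sup>k\<close> embeds the weight space
  of \<open>\<mu>\<close> into that of its reflection, which has greater height, so that induction applies.\<close>

lemma weight_space_line:
  assumes "\<mu> \<in> Wt"
  shows "y \<in> V \<mu> \<Longrightarrow> z \<in> V \<mu> \<Longrightarrow> z \<noteq> 0 \<Longrightarrow> \<exists>c. y = c *s z"
proof -
  let ?P = "\<lambda>\<mu>. \<forall>y\<in>V \<mu>. \<forall>z\<in>V \<mu>. z \<noteq> 0 \<longrightarrow> (\<exists>c. y = c *s z)"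
  obtain c where c: "\<And>\<beta>. \<beta> \<in> \<Delta> \<Longrightarrow> (\<Sum>\<gamma>\<in>\<Delta>. c \<gamma> * (\<gamma> \<bullet> coroot \<beta>)) = 1"
    using weight_height by blast
  define ht where "ht = (\<lambda>\<nu>. \<Sum>\<gamma>\<in>\<Delta>. c \<gamma> * (\<gamma> \<bullet> \<nu>))"
  have ht_diff: "ht (x - r *\<^sub>R coroot \<beta>) = ht x - r" if "\<beta> \<in> \<Delta>" for x r \<beta>
  proof -
    have "ht (x - r *\<^sub>R coroot \<beta>) = ht x - r * (\<Sum>\<gamma>\<in>\<Delta>. c \<gamma> * (\<gamma> \<bullet> coroot \<beta>))"
      by (simp add: ht_def inner_diff_right right_diff_distrib sum_subtractf sum_distrib_left mult_ac)
    then show ?thesis using c[OF that] by simp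
  qed
  have "?P \<mu>" if "\<mu> \<in> Wt" for \<mu>
    using that
  proof (induction "card {\<nu> \<in> Wt. ht \<nu> > ht \<mu>}" arbitrary: \<mu> rule: less_induct)
    case less
    show "?P \<mu>"
    proof (cases "\<forall>\<beta>\<in>\<Delta>. \<beta> \<bullet> \<mu> \<ge> 0")
      case True
      then show ?thesis using highest_weight_space_line E_kills[OF less.prems] by blast
    next
      case False
      then obtain \<beta> where \<beta>: "\<beta> \<in> \<Delta>" "\<beta> \<bullet> \<mu> < 0" by auto
      have "\<beta> \<bullet> \<mu> \<in> \<int>" using \<beta>(1) base_subset Wt_coweight[OF less.prems] by (auto simp: coweight_lattice_def)
      then obtain m :: int where m: "\<beta> \<bullet> \<mu> = of_int m" by (elim Ints_cases)
      define k where "k = nat (- m)"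
      have k: "\<beta> \<bullet> \<mu> = - real k" using m \<beta>(2) by (simp add: k_def)
      let ?\<mu>' = "root_reflection \<beta> \<mu>"
      have \<mu>': "?\<mu>' = \<mu> + real k *\<^sub>R coroot \<beta>" by (simp add: root_reflection_def k)
      have \<mu>'_Wt: "?\<mu>' \<in> Wt"
        using weyl_Wt reflection_in_weyl less.prems \<beta>(1) base_subset by blast
      have "ht ?\<mu>' > ht \<mu>" using ht_diff[OF \<beta>(1), of \<mu> "- real k"] \<beta>(2) k by (simp add: \<mu>')
      then have "{\<nu> \<in> Wt. ht \<nu> > ht ?\<mu>'} \<subset> {\<nu> \<in> Wt. ht \<nu> > ht \<mu>}" using \<mu>'_Wt by force
      then have "card {\<nu> \<in> Wt. ht \<nu> > ht ?\<mu>'} < card {\<nu> \<in> Wt. ht \<nu> > ht \<mu>}"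
        by (intro psubset_card_mono) (auto simp: finite_Wt)
      from less.hyps[OF this \<mu>'_Wt] have IH: "?P ?\<mu>'" .
      define e where "e = (\<lambda>v. Eop \<pi> \<beta> *v v)"
      have e_weight: "(e ^^ j) x \<in> V (\<mu> + real j *\<^sub>R coroot \<beta>)" if "x \<in> V \<mu>" for x j
      proof (induction j)
        case (Suc j)
        then show ?case using E_weight[OF Suc \<beta>(1)] by (simp add: e_def algebra_simps)
      qed (use that in simp)
      \<comment> \<open>The standard relation in the representations of \<open>sl\<^sub>2\<close>, for vectors killed by \<open>F\<close> of weight \<open>- k\<close>.\<close>
      have F_e: "Fop \<pi> \<beta> *v (e ^^ Suc j) x = complex_of_real (real (Suc j) * (real k - real j)) *s (e ^^ j) x"
        if x: "x \<in> V \<mu>" for x j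
      proof (induction j)
        case 0
        have "Eop \<pi> \<beta> *v (Fop \<pi> \<beta> *v x) = 0" using F_kills[OF less.prems \<beta>(1) _ x] \<beta>(2) by simp
        then show ?case using E_F[OF \<beta>(1) \<beta>(1), of x] H_weight[OF x \<beta>(1)]
          by (simp add: e_def k eq_neg_iff_add_eq_0 algebra_simps)
      next
        case (Suc j)
        let ?y = "(e ^^ Suc j) x"
        have "Fop \<pi> \<beta> *v (e ^^ Suc (Suc j)) x = Eop \<pi> \<beta> *v (Fop \<pi> \<beta> *v ?y) - Hop \<pi> \<beta> *v ?y"
          using E_F[OF \<beta>(1) \<beta>(1), of ?y] by (simp add: e_def)
        also have "Eop \<pi> \<beta> *v (Fop \<pi> \<beta> *v ?y) = complex_of_real (real (Suc j) * (real k - real j)) *s ?y"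
          unfolding Suc by (simp add: vector_scalar_commute e_def)
        also have "Hop \<pi> \<beta> *v ?y = complex_of_real (- real k + 2 * real (Suc j)) *s ?y"
          using H_weight[OF e_weight[OF x] \<beta>(1), of "Suc j"]
          by (simp only: inner_add_right inner_scaleR_right coroot_inner_self[OF base_nonzero[OF \<beta>(1)]] k mult.commute)
        also have "complex_of_real (real (Suc j) * (real k - real j)) *s ?y
            - complex_of_real (- real k + 2 * real (Suc j)) *s ?y
          = complex_of_real (real (Suc (Suc j)) * (real k - real (Suc j))) *s ?y"
          unfolding vec.scale_left_diff_distrib[symmetric] of_real_diff[symmetric]
          by (rule arg_cong[where f = "\<lambda>t. complex_of_real t *s ?y"]) (simp add: algebra_simps)
        finally show ?case .
      qed
      have e_inj: "x = 0" if "x \<in> V \<mu>" "(e ^^ j) x = 0" "j \<le> k" for x j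
        using that(2,3)
      proof (induction j)
        case (Suc j)
        have "complex_of_real (real (Suc j) * (real k - real j)) *s (e ^^ j) x = 0"
          using F_e[OF that(1), of j] Suc.prems(1) by simp
        moreover have "complex_of_real (real (Suc j) * (real k - real j)) \<noteq> 0"
          using Suc.prems(2) unfolding of_real_eq_0_iff by simp
        ultimately have "(e ^^ j) x = 0" unfolding vec.scale_eq_0_iff by blast
        then show ?case using Suc by simp
      qed simp
      have e_diff: "(e ^^ j) (x - a *s z) = (e ^^ j) x - a *s (e ^^ j) z" for j x a z
        by (induction j) (auto simp: e_def matrix_vector_mult_diff_distrib vector_scalar_commute)
      show ?thesis
      proof (intro ballI impI)
        fix y z assume y: "y \<in> V \<mu>" and z: "z \<in> V \<mu>" "z \<noteq> 0"
        have "(e ^^ k) z \<noteq> 0" using e_inj[OF z(1)] z(2) by blast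
        then obtain a where a: "(e ^^ k) y = a *s (e ^^ k) z"
          using IH e_weight[OF y] e_weight[OF z(1)] unfolding \<mu>' by blast
        have "y - a *s z \<in> V \<mu>"
          using subspace_weight_space y z by (simp add: vec.subspace_diff vec.subspace_scale)
        moreover have "(e ^^ k) (y - a *s z) = 0" using a by (simp add: e_diff)
        ultimately have "y - a *s z = 0" using e_inj by blast
        then show "\<exists>c. y = c *s z" by auto
      qed
    qed
  qed
  then show "y \<in> V \<mu> \<Longrightarrow> z \<in> V \<mu> \<Longrightarrow> z \<noteq> 0 \<Longrightarrow> \<exists>c. y = c *s z" using assms by blast
qed

lemma dim_weight_space:
  assumes \<mu>: "\<mu> \<in> Wt"
  shows "vec.dim (V \<mu>) = 1"
proof -
  obtain x where x: "x \<in> V \<mu>" "x \<noteq> 0" using \<mu> zero_weight_space[of \<mu>] by (auto simp: mem_Wt_iff)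
  have "V \<mu> = vec.span {x}"
    using weight_space_line[OF \<mu> _ x] x subspace_weight_space[of \<mu>]
    by (auto simp: vec.span_singleton vec.subspace_scale)
  then show ?thesis using x by (simp add: vec.dim_span_eq_card_independent)
qed

lemma wt_eq: "wt \<Phi> \<Delta> \<pi> = replicate_mset (trivial_weight_mult \<Phi> \<Delta> \<pi>) 0 + mset_set Wt"
proof (rule multiset_eqI)
  fix \<mu>
  show "count (wt \<Phi> \<Delta> \<pi>) \<mu>
    = count (replicate_mset (trivial_weight_mult \<Phi> \<Delta> \<pi>) 0 + mset_set Wt) \<mu>"
  proof (cases "\<mu> = 0")
    case True
    moreover have "0 \<notin> Wt" using Wt_nonzero by blast
    ultimately show ?thesis by (simp add: trivial_weight_mult_def)
  next
    case False
    show ?thesis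
    proof (cases "\<mu> \<in> Wt")
      case True
      then show ?thesis using False finite_Wt dim_weight_space[OF True]
        by (simp add: count_wt) (simp add: mem_Wt_iff)
    next
      case F: False
      then have "count (wt \<Phi> \<Delta> \<pi>) \<mu> = 0" using False by (simp add: wt'_def not_in_iff)
      then show ?thesis using F False by simp
    qed
  qed
qed

end

section \<open>Complete reducibility\<close>

text \<open>Complex subspaces of a space of functions.\<close>

definition fun_subspace :: "('g \<Rightarrow> complex) set \<Rightarrow> bool" where
  "fun_subspace S \<longleftrightarrow> (\<lambda>_. 0) \<in> S \<and> (\<forall>f\<in>S. \<forall>h\<in>S. (\<lambda>g. f g + h g) \<in> S) \<and> (\<forall>c. \<forall>f\<in>S. (\<lambda>g. c * f g) \<in> S)"

lemma fun_subspace_sum: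
  assumes "fun_subspace S" "finite B" "\<And>b. b \<in> B \<Longrightarrow> h b \<in> S"
  shows "(\<lambda>g. \<Sum>b\<in>B. h b g) \<in> S"
  using assms(2,3)
  by (induction B rule: finite_induct) (use assms(1) in \<open>auto simp: fun_subspace_def\<close>)

lemma fun_subspace_add: "fun_subspace S \<Longrightarrow> f \<in> S \<Longrightarrow> h \<in> S \<Longrightarrow> (\<lambda>g. f g + h g) \<in> S"
  by (simp add: fun_subspace_def)

lemma fun_subspace_scale: "fun_subspace S \<Longrightarrow> f \<in> S \<Longrightarrow> (\<lambda>g. c * f g) \<in> S"
  by (simp add: fun_subspace_def)

lemma fun_subspace_diff:
  assumes "fun_subspace S" "f \<in> S" "h \<in> S"
  shows "(\<lambda>g. f g - h g) \<in> S"
proof -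
  have "(\<lambda>g. (-1) * h g) \<in> S" using assms(1,3) by (rule fun_subspace_scale)
  from fun_subspace_add[OF assms(1,2) this] show ?thesis by simp
qed

text \<open>The standard Hermitian form of functions restricted to the finitely many points
  \<open>e i\<close>, \<open>i \<in> I\<close>. It is degenerate in general, but definite on spaces of functions
  determined by these values.\<close>

locale sample_form =
  fixes I :: "'i set" and e :: "'i \<Rightarrow> 'g"
  assumes finite_I: "finite I"
begin

definition ip :: "('g \<Rightarrow> complex) \<Rightarrow> ('g \<Rightarrow> complex) \<Rightarrow> complex" where
  "ip f h = (\<Sum>i\<in>I. f (e i) * cnj (h (e i)))"

definition definite :: "('g \<Rightarrow> complex) set \<Rightarrow> bool" where
  "definite S \<longleftrightarrow> (\<forall>f\<in>S. ip f f = 0 \<longrightarrow> f = (\<lambda>_. 0))"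

lemma ip_add_left: "ip (\<lambda>g. f g + f' g) h = ip f h + ip f' h"
  by (simp add: ip_def algebra_simps sum.distrib)

lemma ip_diff_left: "ip (\<lambda>g. f g - f' g) h = ip f h - ip f' h"
  by (simp add: ip_def algebra_simps sum_subtractf)

lemma ip_scale_left: "ip (\<lambda>g. c * f g) h = c * ip f h"
  by (simp add: ip_def sum_distrib_left mult.assoc)

lemma ip_sum_left: "ip (\<lambda>g. \<Sum>b\<in>B. k b g) h = (\<Sum>b\<in>B. ip (k b) h)"
  by (simp add: ip_def sum_distrib_right sum.swap[of _ B])

lemma ip_cnj: "ip h f = cnj (ip f h)"
  by (simp add: ip_def mult.commute)

lemma ip_zero_left [simp]: "ip (\<lambda>_. 0) h = 0"
  by (simp add: ip_def)

lemma ip_zero_comm: "ip f h = 0 \<longleftrightarrow> ip h f = 0"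
  using ip_cnj[of f h] by auto

lemma ip_sum_right: "ip h (\<lambda>g. \<Sum>b\<in>B. k b g) = (\<Sum>b\<in>B. ip h (k b))"
  by (simp add: ip_def sum_distrib_left sum.swap[of _ B])

lemma ip_scale_right: "ip h (\<lambda>g. c * f g) = cnj c * ip h f"
  by (simp add: ip_def sum_distrib_left mult_ac)

lemma ip_self: "ip f f = of_real (\<Sum>i\<in>I. (cmod (f (e i)))\<^sup>2)"
  by (simp add: ip_def complex_norm_square del: of_real_power)

text \<open>Bessel's inequality for the coordinate vectors, summed over all coordinates.\<close>

lemma card_orthogonal_le:
  assumes B: "finite B" and nz: "\<And>b. b \<in> B \<Longrightarrow> ip b b \<noteq> 0"
    and orth: "\<And>b c. b \<in> B \<Longrightarrow> c \<in> B \<Longrightarrow> b \<noteq> c \<Longrightarrow> ip b c = 0"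
  shows "card B \<le> card I"
proof -
  define n where "n = (\<lambda>b. \<Sum>i\<in>I. (cmod (b (e i)))\<^sup>2)"
  have n: "ip b b = of_real (n b)" for b by (simp add: ip_self n_def)
  have npos: "n b > 0" if "b \<in> B" for b
  proof -
    have "n b \<ge> 0" unfolding n_def by (intro sum_nonneg) simp
    moreover have "n b \<noteq> 0" using nz[OF that] by (simp add: n)
    ultimately show ?thesis by simp
  qed
  have bessel: "(\<Sum>b\<in>B. (cmod (b (e i)))\<^sup>2 / n b) \<le> 1" if i: "i \<in> I" for i
  proof -
    define c where "c = (\<lambda>b. cnj (b (e i)) / of_real (n b))"
    define q where "q = (\<Sum>b\<in>B. (cmod (b (e i)))\<^sup>2 / n b)"
    define d where "d = (\<lambda>j. if j = i then 1 else (0::complex))"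
    define s where "s = (\<lambda>j. \<Sum>b\<in>B. c b * b (e j))"
    have ds: "(\<Sum>j\<in>I. d j * cnj (s j)) = of_real q"
    proof -
      have "(\<Sum>j\<in>I. d j * cnj (s j)) = (\<Sum>j\<in>I. if j = i then cnj (s i) else 0)"
        by (intro sum.cong) (auto simp: d_def)
      also have "\<dots> = cnj (s i)" using i finite_I by simp
      also have "\<dots> = (\<Sum>b\<in>B. of_real ((cmod (b (e i)))\<^sup>2 / n b))"
        by (simp add: s_def c_def complex_norm_square del: of_real_power)
      finally show ?thesis by (simp add: q_def)
    qed
    have sd: "(\<Sum>j\<in>I. s j * cnj (d j)) = of_real q"
    proof -
      have "(\<Sum>j\<in>I. s j * cnj (d j)) = cnj (\<Sum>j\<in>I. d j * cnj (s j))" by (simp add: mult.commute)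
      then show ?thesis by (simp add: ds)
    qed
    have dd: "(\<Sum>j\<in>I. d j * cnj (d j)) = 1"
      using i finite_I by (simp add: d_def if_distrib cong: if_cong)
    have ss: "(\<Sum>j\<in>I. s j * cnj (s j)) = of_real q"
    proof -
      have "(\<Sum>j\<in>I. s j * cnj (s j)) = ip (\<lambda>g. \<Sum>b\<in>B. c b * b g) (\<lambda>g. \<Sum>b\<in>B. c b * b g)"
        by (simp add: ip_def s_def)
      also have "\<dots> = (\<Sum>b\<in>B. c b * (\<Sum>b'\<in>B. cnj (c b') * ip b b'))"
        by (simp only: ip_sum_left ip_sum_right ip_scale_left ip_scale_right sum_distrib_left)
      also have "\<dots> = (\<Sum>b\<in>B. c b * (\<Sum>b'\<in>B. if b' = b then cnj (c b) * ip b b else 0))"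
        by (intro sum.cong refl arg_cong2[where f = "(*)"]) (auto simp: orth)
      also have "\<dots> = (\<Sum>b\<in>B. c b * (cnj (c b) * of_real (n b)))"
        using B by (simp add: n)
      also have "\<dots> = (\<Sum>b\<in>B. of_real ((cmod (b (e i)))\<^sup>2 / n b))"
      proof (rule sum.cong)
        fix b assume "b \<in> B"
        then have "n b \<noteq> 0" using npos[of b] by simp
        then show "c b * (cnj (c b) * of_real (n b)) = of_real ((cmod (b (e i)))\<^sup>2 / n b)"
          by (simp add: c_def complex_norm_square field_simps del: of_real_power)
      qed simp
      finally show ?thesis by (simp add: q_def)
    qed
    have "of_real (\<Sum>j\<in>I. (cmod (d j - s j))\<^sup>2) = (\<Sum>j\<in>I. (d j - s j) * cnj (d j - s j))"
      by (simp add: complex_norm_square del: of_real_power)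
    also have "\<dots> = (\<Sum>j\<in>I. d j * cnj (d j)) - (\<Sum>j\<in>I. d j * cnj (s j))
        - (\<Sum>j\<in>I. s j * cnj (d j)) + (\<Sum>j\<in>I. s j * cnj (s j))"
      by (simp add: algebra_simps sum.distrib sum_subtractf)
    also have "\<dots> = of_real (1 - q)" by (simp add: ds sd dd ss)
    finally have "(\<Sum>j\<in>I. (cmod (d j - s j))\<^sup>2) = 1 - q" using of_real_eq_iff by blast
    moreover have "(\<Sum>j\<in>I. (cmod (d j - s j))\<^sup>2) \<ge> 0" by (intro sum_nonneg) simp
    ultimately show ?thesis by (simp add: q_def)
  qed
  have "real (card B) = (\<Sum>b\<in>B. n b / n b)" using npos by (simp add: less_imp_neq[symmetric])
  also have "\<dots> = (\<Sum>b\<in>B. \<Sum>i\<in>I. (cmod (b (e i)))\<^sup>2 / n b)"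
    unfolding sum_divide_distrib[symmetric] n_def ..
  also have "\<dots> = (\<Sum>i\<in>I. \<Sum>b\<in>B. (cmod (b (e i)))\<^sup>2 / n b)" by (rule sum.swap)
  also have "\<dots> \<le> (\<Sum>i\<in>I. 1)" by (intro sum_mono bessel)
  finally show ?thesis by simp
qed

text \<open>Subtracting from \<open>t\<close> its components along a maximal orthogonal family in \<open>S\<close> must give 0, so
  the projection along this family is the orthogonal projection onto \<open>S\<close>.\<close>

lemma orthogonal_projection:
  assumes S: "fun_subspace S" and def: "definite S"
  shows "\<exists>s\<in>S. \<forall>t\<in>S. ip (\<lambda>g. f g - s g) t = 0"
proof -
  define fam where "fam = (\<lambda>B. finite B \<and> B \<subseteq> S \<and> (\<lambda>_. 0) \<notin> B \<and> (\<forall>b\<in>B. \<forall>c\<in>B. b \<noteq> c \<longrightarrow> ip b c = 0))"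
  have nz: "ip b b \<noteq> 0" if "fam B" "b \<in> B" for b B
    using that def by (auto simp: fam_def definite_def)
  have bound: "card B \<le> card I" if "fam B" for B
    using that nz[OF that] by (intro card_orthogonal_le) (auto simp: fam_def)
  have "fam {}" by (simp add: fam_def)
  then obtain B where B: "fam B" and max: "\<And>B'. fam B' \<Longrightarrow> card B' \<le> card B"
    using ex_has_greatest_nat[of fam "{}" card "card I + 1"] bound by (metis less_Suc_eq_le Suc_eq_plus1)
  have finB: "finite B" and BS: "B \<subseteq> S" using B by (auto simp: fam_def)
  define pr where "pr = (\<lambda>f g. \<Sum>b\<in>B. (ip f b / ip b b) * b g)"
  have pr_S: "pr f \<in> S" for f
    unfolding pr_def using S finB BS by (intro fun_subspace_sum fun_subspace_scale) auto
  have pr_orth: "ip (\<lambda>g. f g - pr f g) b = 0" if b: "b \<in> B" for f b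
  proof -
    have "ip (pr f) b = (\<Sum>c\<in>B. (ip f c / ip c c) * ip c b)"
      by (simp only: pr_def ip_sum_left ip_scale_left)
    also have "\<dots> = (\<Sum>c\<in>B. if c = b then ip f b else 0)"
      using B b nz[OF B] by (intro sum.cong) (auto simp: fam_def)
    finally show ?thesis using finB b by (simp add: ip_diff_left)
  qed
  show ?thesis
  proof (rule bexI[OF _ pr_S[of f]], rule ballI)
    fix t assume t: "t \<in> S"
    define t' where "t' = (\<lambda>g. t g - pr t g)"
    have t'S: "t' \<in> S" unfolding t'_def by (rule fun_subspace_diff[OF S t pr_S])
    have orth: "ip t' b = 0" if "b \<in> B" for b unfolding t'_def by (rule pr_orth[OF that])
    have "t' = (\<lambda>_. 0)"
    proof (rule ccontr)
      assume nz': "t' \<noteq> (\<lambda>_. 0)"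
      then have "t' \<notin> B" using orth def t'S by (auto simp: definite_def)
      moreover have "fam (insert t' B)"
        using B t'S nz' orth ip_zero_comm by (auto simp: fam_def)
      ultimately show False using max[of "insert t' B"] finB by simp
    qed
    then have tpr: "t = pr t" by (auto simp: t'_def fun_eq_iff)
    have "ip h (pr t) = (\<Sum>b\<in>B. cnj (ip t b / ip b b) * ip h b)" for h
      by (simp only: pr_def ip_sum_right ip_scale_right)
    then have "ip (\<lambda>g. f g - pr f g) (pr t) = 0" by (simp add: pr_orth)
    then show "ip (\<lambda>g. f g - pr f g) t = 0" by (simp only: tpr[symmetric])
  qed
qed

end

text \<open>A space of functions on the extended Weyl group, stable under right translations, on which the
  form is definite and invariant.\<close>

locale unitary_subrep = sample_form I e + root_datum \<Phi> \<Delta>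
  for I :: "'i set" and e :: "'i \<Rightarrow> ('v::euclidean_space \<Rightarrow> 'v)" and \<Phi> \<Delta> :: "'v set" +
  fixes M :: "'v ext_fun set"
  assumes M: "is_subrep \<Phi> M M" and M_definite: "definite M"
    and inverse: "\<And>h. h \<in> ext_weyl_group \<Phi> \<Longrightarrow> \<exists>h'\<in>ext_weyl_group \<Phi>. h' \<circ> h = id"
    and invariant: "\<And>h f f'. h \<in> ext_weyl_group \<Phi> \<Longrightarrow> f \<in> M \<Longrightarrow> f' \<in> M \<Longrightarrow>
       ip (right_translate h f) (right_translate h f') = ip f f'"
begin

abbreviation "subrep \<equiv> is_subrep \<Phi> M"

lemma subrep_trans: "subrep S \<Longrightarrow> is_subrep \<Phi> S S' \<Longrightarrow> subrep S'"
  by (auto simp: is_subrep_def)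

lemma subrep_subspace: "is_subrep \<Phi> A S \<Longrightarrow> fun_subspace S"
  by (simp add: is_subrep_def fun_subspace_def)

lemma subrep_definite: "subrep S \<Longrightarrow> definite S"
  using M_definite by (auto simp: is_subrep_def definite_def)

lemma orthogonal_complement_subrep:
  assumes S: "subrep S" and T: "\<And>T. T \<in> \<T> \<Longrightarrow> subrep T"
  shows "is_subrep \<Phi> S {f \<in> S. \<forall>T\<in>\<T>. \<forall>t\<in>T. ip f t = 0}"
proof -
  have "ip (right_translate h f) t = 0"
    if h: "h \<in> ext_weyl_group \<Phi>" and f: "f \<in> S" "\<forall>T\<in>\<T>. \<forall>t\<in>T. ip f t = 0"
      and t: "T \<in> \<T>" "t \<in> T" for h f T t
  proof -
    obtain h' where h': "h' \<in> ext_weyl_group \<Phi>" "h' \<circ> h = id" using inverse[OF h] by blast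
    have rt: "right_translate h' t \<in> T" using T[OF t(1)] t(2) h'(1) by (auto simp: is_subrep_def)
    obtain h'' where h'': "h'' \<in> ext_weyl_group \<Phi>" "h'' \<circ> h' = id" using inverse[OF h'(1)] by blast
    have "h'' = h'' \<circ> (h' \<circ> h)" using h'(2) by simp
    also have "\<dots> = h" using h''(2) by (simp add: comp_assoc[symmetric])
    finally have "h \<circ> h' = id" using h''(2) by simp
    then have "right_translate h (right_translate h' t) = t"
      by (simp add: right_translate_def comp_assoc)
    then have "ip (right_translate h f) t = ip f (right_translate h' t)"
      using invariant[OF h, of f "right_translate h' t"] f(1) S T[OF t(1)] rt by (auto simp: is_subrep_def)
    then show ?thesis using f(2) t(1) rt by auto
  qed
  then show ?thesis using S by (auto simp: is_subrep_def ip_add_left ip_scale_left)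
qed

text \<open>A family of pairwise orthogonal nonzero subrepresentations of maximal cardinality is a
  decomposition into irreducibles: otherwise an orthogonal complement would enlarge it.\<close>

lemma ex_decomposition: "\<exists>D. irreducible_decomposition \<Phi> M D"
proof -
  define fam where "fam = (\<lambda>D. finite D \<and> (\<forall>\<rho>\<in>D. subrep \<rho> \<and> \<rho> \<noteq> {\<lambda>_. 0}) \<and>
    (\<forall>\<rho>\<in>D. \<forall>\<sigma>\<in>D. \<rho> \<noteq> \<sigma> \<longrightarrow> (\<forall>f\<in>\<rho>. \<forall>h\<in>\<sigma>. ip f h = 0)))"
  have ex_nonzero: "\<exists>f\<in>\<rho>. f \<noteq> (\<lambda>_. 0)" if "subrep \<rho>" "\<rho> \<noteq> {\<lambda>_. 0}" for \<rho>
    using that by (auto simp: is_subrep_def)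
  have self_orth: "\<rho> = {\<lambda>_. 0}" if "subrep \<rho>" "\<And>f. f \<in> \<rho> \<Longrightarrow> ip f f = 0" for \<rho>
    using that subrep_definite[OF that(1)] by (auto simp: is_subrep_def definite_def)
  have fam_orth: "ip f h = 0"
    if "fam D" "\<rho> \<in> D" "\<sigma> \<in> D" "\<rho> \<noteq> \<sigma>" "f \<in> \<rho>" "h \<in> \<sigma>" for D \<rho> \<sigma> f h
    using that unfolding fam_def by metis
  have bound: "card D \<le> card I" if D: "fam D" for D
  proof -
    have "\<forall>\<rho>\<in>D. \<exists>f\<in>\<rho>. f \<noteq> (\<lambda>_. 0)" using D ex_nonzero by (auto simp: fam_def)
    then obtain v where v: "\<And>\<rho>. \<rho> \<in> D \<Longrightarrow> v \<rho> \<in> \<rho> \<and> v \<rho> \<noteq> (\<lambda>_. 0)" by metis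
    have nz: "ip (v \<rho>) (v \<rho>) \<noteq> 0" if "\<rho> \<in> D" for \<rho>
      using v[OF that] subrep_definite[of \<rho>] D that by (auto simp: fam_def definite_def)
    have orth: "ip (v \<rho>) (v \<sigma>) = 0" if "\<rho> \<in> D" "\<sigma> \<in> D" "\<rho> \<noteq> \<sigma>" for \<rho> \<sigma>
      using fam_orth[OF D that] v that by simp
    have "inj_on v D" using nz orth by (intro inj_onI) metis
    then have "card D = card (v ` D)" by (simp add: card_image)
    also have "\<dots> \<le> card I"
      by (rule card_orthogonal_le) (use D nz orth in \<open>auto simp: fam_def\<close>)
    finally show ?thesis .
  qed
  have "fam {}" by (simp add: fam_def)
  then obtain D where D: "fam D" and max: "\<And>D'. fam D' \<Longrightarrow> card D' \<le> card D"
    using ex_has_greatest_nat[of fam "{}" card "card I + 1"] bound by (metis less_Suc_eq_le Suc_eq_plus1)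
  have finD: "finite D" and subD: "\<And>\<rho>. \<rho> \<in> D \<Longrightarrow> subrep \<rho>"
    and nzD: "\<And>\<rho>. \<rho> \<in> D \<Longrightarrow> \<rho> \<noteq> {\<lambda>_. 0}"
    using D by (auto simp: fam_def)
  note orthD = fam_orth[OF D]
  have irred: "is_irreducible_subrep \<Phi> M \<rho>" if \<rho>: "\<rho> \<in> D" for \<rho>
    unfolding is_irreducible_subrep_def
  proof (intro conjI allI impI subD nzD \<rho>)
    fix S assume S: "is_subrep \<Phi> \<rho> S"
    show "S = {\<lambda>_. 0} \<or> S = \<rho>"
    proof (rule ccontr)
      assume neg: "\<not> (S = {\<lambda>_. 0} \<or> S = \<rho>)"
      have SM: "subrep S" by (rule subrep_trans[OF subD[OF \<rho>] S])
      have S\<rho>: "S \<subseteq> \<rho>" using S by (simp add: is_subrep_def)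
      define T where "T = {f \<in> \<rho>. \<forall>S'\<in>{S}. \<forall>t\<in>S'. ip f t = 0}"
      have T: "is_subrep \<Phi> \<rho> T"
        unfolding T_def by (rule orthogonal_complement_subrep) (use subD[OF \<rho>] SM in auto)
      have TM: "subrep T" by (rule subrep_trans[OF subD[OF \<rho>] T])
      obtain f where f: "f \<in> \<rho>" "f \<notin> S" using neg S\<rho> by blast
      obtain s where s: "s \<in> S" "\<And>t. t \<in> S \<Longrightarrow> ip (\<lambda>g. f g - s g) t = 0"
        using orthogonal_projection[OF subrep_subspace[OF S] subrep_definite[OF SM]] by blast
      have "(\<lambda>g. f g - s g) \<in> T"
        using fun_subspace_diff[OF subrep_subspace[OF subD[OF \<rho>]] f(1)] s S\<rho> by (auto simp: T_def)
      moreover have "(\<lambda>g. f g - s g) \<noteq> (\<lambda>_. 0)"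
      proof
        assume "(\<lambda>g. f g - s g) = (\<lambda>_. 0)"
        then have "f = s" by (auto simp: fun_eq_iff)
        then show False using f(2) s(1) by simp
      qed
      ultimately have Tnz: "T \<noteq> {\<lambda>_. 0}" by blast
      have TS: "ip f h = 0" "ip h f = 0" if "f \<in> T" "h \<in> S" for f h
        using that ip_zero_comm by (auto simp: T_def)
      have ST: "S \<noteq> T" using self_orth[OF TM] Tnz TS by blast
      have notin: "S' \<notin> D - {\<rho>}" if "S' \<subseteq> \<rho>" "subrep S'" "S' \<noteq> {\<lambda>_. 0}" for S'
      proof
        assume S': "S' \<in> D - {\<rho>}"
        have "ip f f = 0" if "f \<in> S'" for f
          using orthD[OF _ \<rho>, of S' f f] S' that \<open>S' \<subseteq> \<rho>\<close> by auto
        then show False using self_orth[OF that(2)] that(3) by blast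
      qed
      have T\<rho>: "T \<subseteq> \<rho>" by (auto simp: T_def)
      let ?D = "insert S (insert T (D - {\<rho>}))"
      have "fam ?D"
        unfolding fam_def
      proof (intro conjI ballI impI)
        show "finite ?D" using finD by simp
      next
        fix \<sigma> assume "\<sigma> \<in> ?D"
        then show "subrep \<sigma>" "\<sigma> \<noteq> {\<lambda>_. 0}" using SM TM Tnz neg subD nzD by auto
      next
        fix \<sigma> \<tau> f h assume st: "\<sigma> \<in> ?D" "\<tau> \<in> ?D" "\<sigma> \<noteq> \<tau>" and fh: "f \<in> \<sigma>" "h \<in> \<tau>"
        have "\<sigma> \<in> {S, T} \<or> \<sigma> \<in> D - {\<rho>}" "\<tau> \<in> {S, T} \<or> \<tau> \<in> D - {\<rho>}"
          using st(1,2) by simp_all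
        then consider "\<sigma> \<in> D - {\<rho>}" "\<tau> \<in> D - {\<rho>}" | "\<sigma> \<in> D - {\<rho>}" "\<tau> \<in> {S, T}"
          | "\<sigma> \<in> {S, T}" "\<tau> \<in> D - {\<rho>}" | "\<sigma> \<in> {S, T}" "\<tau> \<in> {S, T}"
          by argo
        then show "ip f h = 0"
        proof cases
          case 1 then show ?thesis using orthD[of \<sigma> \<tau> f h] st(3) fh by simp
        next
          case 2
          then have "h \<in> \<rho>" using fh S\<rho> T\<rho> by blast
          then show ?thesis using orthD[of \<sigma> \<rho> f h] 2 \<rho> fh by simp
        next
          case 3
          then have "f \<in> \<rho>" using fh S\<rho> T\<rho> by blast
          then show ?thesis using orthD[of \<rho> \<tau> f h] 3 \<rho> fh by auto
        next
          case 4
          then have "(\<sigma> = S \<and> \<tau> = T) \<or> (\<sigma> = T \<and> \<tau> = S)" using st(3) by auto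
          then show ?thesis using TS fh by auto
        qed
      qed
      then have "card ?D \<le> card D" by (rule max)
      moreover have "card ?D = Suc (Suc (card (D - {\<rho>})))"
        using notin[OF S\<rho> SM] notin[OF T\<rho> TM Tnz] neg ST finD by simp
      ultimately show False using \<rho> finD by (simp add: card_Diff_singleton_if)
    qed
  qed
  define T where "T = {f \<in> M. \<forall>\<rho>\<in>D. \<forall>t\<in>\<rho>. ip f t = 0}"
  have T: "subrep T" unfolding T_def by (rule orthogonal_complement_subrep[OF M subD])
  have T0: "T = {\<lambda>_. 0}"
  proof (rule ccontr)
    assume Tnz: "T \<noteq> {\<lambda>_. 0}"
    have TD: "ip f h = 0" "ip h f = 0" if "f \<in> T" "\<rho> \<in> D" "h \<in> \<rho>" for f h \<rho>
      using that ip_zero_comm by (auto simp: T_def)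
    have "T \<notin> D" using self_orth[OF T] Tnz TD by blast
    moreover have "fam (insert T D)"
      unfolding fam_def
    proof (intro conjI ballI impI)
      show "finite (insert T D)" using finD by simp
    next
      fix \<rho> assume "\<rho> \<in> insert T D"
      then show "subrep \<rho>" "\<rho> \<noteq> {\<lambda>_. 0}" using T Tnz subD nzD by blast+
    next
      fix \<rho> \<sigma> f h
      assume "\<rho> \<in> insert T D" "\<sigma> \<in> insert T D" "\<rho> \<noteq> \<sigma>" "f \<in> \<rho>" "h \<in> \<sigma>"
      then show "ip f h = 0" using TD orthD[of \<rho> \<sigma> f h] by auto
    qed
    ultimately show False using max[of "insert T D"] finD by simp
  qed
  have dec: "\<exists>!p. (\<forall>\<rho>\<in>D. p \<rho> \<in> \<rho>) \<and> (\<forall>\<rho>. \<rho> \<notin> D \<longrightarrow> p \<rho> = (\<lambda>_. 0)) \<and> f = (\<lambda>g. \<Sum>\<rho>\<in>D. p \<rho> g)"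
    if f: "f \<in> M" for f
  proof (rule ex_ex1I)
    have "\<exists>s\<in>\<rho>. \<forall>t\<in>\<rho>. ip (\<lambda>g. f g - s g) t = 0" if "\<rho> \<in> D" for \<rho>
      using subrep_subspace[OF subD[OF that]] subrep_definite[OF subD[OF that]]
      by (rule orthogonal_projection)
    then obtain s where s: "\<And>\<rho>. \<rho> \<in> D \<Longrightarrow> s \<rho> \<in> \<rho>"
      "\<And>\<rho> t. \<rho> \<in> D \<Longrightarrow> t \<in> \<rho> \<Longrightarrow> ip (\<lambda>g. f g - s \<rho> g) t = 0" by metis
    let ?s = "\<lambda>g. \<Sum>\<rho>\<in>D. s \<rho> g"
    have "(\<lambda>g. f g - ?s g) \<in> T"
      unfolding T_def
    proof (intro CollectI conjI ballI)
      have "s \<rho> \<in> M" if "\<rho> \<in> D" for \<rho>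
        using s(1)[OF that] subD[OF that] unfolding is_subrep_def by blast
      then have "?s \<in> M" by (rule fun_subspace_sum[OF subrep_subspace[OF M] finD])
      then show "(\<lambda>g. f g - ?s g) \<in> M" by (rule fun_subspace_diff[OF subrep_subspace[OF M] f])
    next
      fix \<sigma> t assume \<sigma>: "\<sigma> \<in> D" and t: "t \<in> \<sigma>"
      have "(\<Sum>\<rho>\<in>D. ip (s \<rho>) t) = (\<Sum>\<rho>\<in>D. if \<rho> = \<sigma> then ip (s \<sigma>) t else 0)"
        using orthD[OF _ \<sigma> _ _ t] s(1) by (intro sum.cong) auto
      also have "\<dots> = ip (s \<sigma>) t" using finD \<sigma> by simp
      also have "\<dots> = ip f t" using s(2)[OF \<sigma> t] by (simp add: ip_diff_left)
      finally show "ip (\<lambda>g. f g - ?s g) t = 0" by (simp add: ip_diff_left ip_sum_left)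
    qed
    then have "(\<lambda>g. f g - ?s g) = (\<lambda>_. 0)" using T0 by blast
    then have "f g = ?s g" for g by (metis right_minus_eq)
    then show "\<exists>p. (\<forall>\<rho>\<in>D. p \<rho> \<in> \<rho>) \<and> (\<forall>\<rho>. \<rho> \<notin> D \<longrightarrow> p \<rho> = (\<lambda>_. 0)) \<and> f = (\<lambda>g. \<Sum>\<rho>\<in>D. p \<rho> g)"
      using s(1) by (intro exI[of _ "\<lambda>\<rho>. if \<rho> \<in> D then s \<rho> else (\<lambda>_. 0)"]) auto
  next
    fix p q
    assume p: "(\<forall>\<rho>\<in>D. p \<rho> \<in> \<rho>) \<and> (\<forall>\<rho>. \<rho> \<notin> D \<longrightarrow> p \<rho> = (\<lambda>_. 0)) \<and> f = (\<lambda>g. \<Sum>\<rho>\<in>D. p \<rho> g)"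
      and q: "(\<forall>\<rho>\<in>D. q \<rho> \<in> \<rho>) \<and> (\<forall>\<rho>. \<rho> \<notin> D \<longrightarrow> q \<rho> = (\<lambda>_. 0)) \<and> f = (\<lambda>g. \<Sum>\<rho>\<in>D. q \<rho> g)"
    have "p \<sigma> = q \<sigma>" if \<sigma>: "\<sigma> \<in> D" for \<sigma>
    proof -
      define d where "d = (\<lambda>\<rho> g. p \<rho> g - q \<rho> g)"
      have d: "d \<rho> \<in> \<rho>" if "\<rho> \<in> D" for \<rho>
        unfolding d_def using fun_subspace_diff[OF subrep_subspace[OF subD[OF that]]] p q that by blast
      have "(\<lambda>g. \<Sum>\<rho>\<in>D. d \<rho> g) = (\<lambda>_. 0)"
        using p q by (simp add: d_def sum_subtractf fun_eq_iff)
      then have "0 = ip (\<lambda>g. \<Sum>\<rho>\<in>D. d \<rho> g) (d \<sigma>)" by simp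
      also have "\<dots> = (\<Sum>\<rho>\<in>D. ip (d \<rho>) (d \<sigma>))" by (rule ip_sum_left)
      also have "\<dots> = (\<Sum>\<rho>\<in>D. if \<rho> = \<sigma> then ip (d \<sigma>) (d \<sigma>) else 0)"
        using orthD[OF _ \<sigma> _ d d[OF \<sigma>]] by (intro sum.cong) auto
      also have "\<dots> = ip (d \<sigma>) (d \<sigma>)" using finD \<sigma> by simp
      finally have "d \<sigma> = (\<lambda>_. 0)"
        using subrep_definite[OF subD[OF \<sigma>]] d[OF \<sigma>] by (simp add: definite_def)
      then show ?thesis by (auto simp: d_def fun_eq_iff)
    qed
    moreover have "p \<sigma> = q \<sigma>" if "\<sigma> \<notin> D" for \<sigma> using p q that by simp
    ultimately show "p = q" by blast
  qed
  have "irreducible_decomposition \<Phi> M D"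
    unfolding irreducible_decomposition_def by (intro conjI ballI finD irred dec)
  then show ?thesis by (rule exI)
qed

end

section \<open>The regular representation of the extended Weyl group\<close>

context root_datum
begin

abbreviation Wext :: "('v \<Rightarrow> 'v) set" where "Wext \<equiv> ext_weyl_group \<Phi>"

lemma
  assumes "is_subrep \<Phi> A S"
  shows subrep_zero: "(\<lambda>_. 0) \<in> S"
    and subrep_add: "f \<in> S \<Longrightarrow> f' \<in> S \<Longrightarrow> (\<lambda>g. f g + f' g) \<in> S"
    and subrep_scale: "f \<in> S \<Longrightarrow> (\<lambda>g. c * f g) \<in> S"
    and subrep_translate: "h \<in> Wext \<Longrightarrow> f \<in> S \<Longrightarrow> right_translate h f \<in> S"
  using assms by (simp_all add: is_subrep_def)

lemma ext_weyl_iff: "g \<in> Wext \<longleftrightarrow> (\<exists>\<mu>\<in>\<Lambda>. \<exists>w\<in>W. g = (+) \<mu> \<circ> w)"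
  by (auto simp: ext_weyl_group_def o_def)

lemma ext_weylI: "\<mu> \<in> \<Lambda> \<Longrightarrow> w \<in> W \<Longrightarrow> (+) \<mu> \<circ> w \<in> Wext"
  by (auto simp: ext_weyl_iff)

lemma weyl_in_ext: "w \<in> W \<Longrightarrow> w \<in> Wext"
  using ext_weylI[of 0 w] by (simp add: o_def)

lemma translation_in_ext: "\<mu> \<in> \<Lambda> \<Longrightarrow> (+) \<mu> \<in> Wext"
  using ext_weylI[OF _ weyl_group.weyl_id] by simp

lemma id_in_ext: "id \<in> Wext"
  by (rule weyl_in_ext[OF weyl_group.weyl_id])

lemma translation_add: "(+) (\<mu> + \<nu>) = (+) \<mu> \<circ> (+) (\<nu> :: 'v)"
  by (auto simp: fun_eq_iff add.assoc)

lemma ext_weyl_comp: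
  assumes "g \<in> Wext" "h \<in> Wext"
  shows "g \<circ> h \<in> Wext"
proof -
  obtain \<mu> w \<nu> w' where *: "\<mu> \<in> \<Lambda>" "w \<in> W" "g = (+) \<mu> \<circ> w" "\<nu> \<in> \<Lambda>" "w' \<in> W" "h = (+) \<nu> \<circ> w'"
    using assms by (auto simp: ext_weyl_iff)
  have "g \<circ> h = (+) (\<mu> + w \<nu>) \<circ> (w \<circ> w')"
    using * by (auto simp: fun_eq_iff weyl_add)
  moreover have "(+) (\<mu> + w \<nu>) \<circ> (w \<circ> w') \<in> Wext"
    by (intro ext_weylI coweight_add weyl_coweight[OF *(2,4)] weyl_comp *(1,2,5))
  ultimately show ?thesis by simp
qed

lemma ext_weyl_inverse:
  assumes "g \<in> Wext"
  shows "\<exists>g'\<in>Wext. g' \<circ> g = id \<and> g \<circ> g' = id"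
proof -
  obtain \<mu> w where *: "\<mu> \<in> \<Lambda>" "w \<in> W" "g = (+) \<mu> \<circ> w" using assms by (auto simp: ext_weyl_iff)
  obtain w' where w': "w' \<in> W" "\<And>x. w (w' x) = x" "\<And>x. w' (w x) = x" using weyl_inverse[OF *(2)] by metis
  show ?thesis
  proof (rule bexI[of _ "(+) (w' (- \<mu>)) \<circ> w'"])
    show "(+) (w' (- \<mu>)) \<circ> w' \<in> Wext" by (rule ext_weylI[OF weyl_coweight[OF w'(1) coweight_neg[OF *(1)]] w'(1)])
    show "(+) (w' (- \<mu>)) \<circ> w' \<circ> g = id \<and> g \<circ> ((+) (w' (- \<mu>)) \<circ> w') = id"
      using w' *(2) by (auto simp: *(3) fun_eq_iff weyl_add weyl_add[OF w'(1), symmetric] weyl_zero)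
  qed
qed

lemma ext_weyl_comp_right_iff:
  assumes "h \<in> Wext" shows "g \<circ> h \<in> Wext \<longleftrightarrow> g \<in> Wext"
proof
  obtain h' where h': "h' \<in> Wext" "h \<circ> h' = id" using ext_weyl_inverse[OF assms] by blast
  assume "g \<circ> h \<in> Wext"
  then have "g \<circ> h \<circ> h' \<in> Wext" using h'(1) by (rule ext_weyl_comp)
  then show "g \<in> Wext" using h' by (simp add: comp_assoc)
qed (use assms ext_weyl_comp in blast)

lemma ext_weyl_comp_left_iff:
  assumes "h \<in> Wext" shows "h \<circ> g \<in> Wext \<longleftrightarrow> g \<in> Wext"
proof
  obtain h' where h': "h' \<in> Wext" "h' \<circ> h = id" using ext_weyl_inverse[OF assms] by blast
  assume "h \<circ> g \<in> Wext"
  with h'(1) have "h' \<circ> (h \<circ> g) \<in> Wext" by (rule ext_weyl_comp)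
  then show "g \<in> Wext" using h' by (simp add: comp_assoc[symmetric])
qed (use assms ext_weyl_comp in blast)

lemma ext_weyl_zero: "g \<in> Wext \<Longrightarrow> g 0 \<in> \<Lambda>"
  by (auto simp: ext_weyl_iff weyl_zero)

lemma ext_weyl_decomp: "g \<in> Wext \<Longrightarrow> \<exists>w\<in>W. g = (+) (g 0) \<circ> w"
  by (auto simp: ext_weyl_iff weyl_zero)

lemma weyl_comp_bij:
  assumes w: "w \<in> W" shows "bij_betw (\<lambda>v. v \<circ> w) W W"
proof -
  obtain w' where w': "w' \<in> W" "\<And>x. w (w' x) = x" "\<And>x. w' (w x) = x" using weyl_inverse[OF w] by metis
  then have "w \<circ> w' = id" "w' \<circ> w = id" by auto
  then show ?thesis
    by (intro bij_betwI[of _ _ _ "\<lambda>v. v \<circ> w'"]) (auto simp: weyl_comp w w' comp_assoc)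
qed

end

context root_datum_sublattice
begin

text \<open>The space of the regular representation, and the finite quotient \<open>\<Lambda>/\<Gamma>\<close>.\<close>

abbreviation M :: "'v ext_fun set" where "M \<equiv> L2_quotient \<Phi> \<Gamma>"
abbreviation Y :: "'v set set" where "Y \<equiv> apt_proj \<Gamma> ` \<Lambda>"

text \<open>A representative in \<open>\<Lambda>\<close> of a coset of \<open>\<Gamma>\<close>.\<close>

definition rep :: "'v set \<Rightarrow> 'v" where
  "rep C = (SOME x. x \<in> \<Lambda> \<and> C = apt_proj \<Gamma> x)"

lemma rep:
  assumes "C \<in> Y" shows "rep C \<in> \<Lambda>" and "apt_proj \<Gamma> (rep C) = C"
proof -
  have "\<exists>x. x \<in> \<Lambda> \<and> C = apt_proj \<Gamma> x" using assms by blast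
  from someI_ex[OF this] show "rep C \<in> \<Lambda>" "apt_proj \<Gamma> (rep C) = C" by (simp_all add: rep_def)
qed

lemma rep_apt_proj: "x \<in> \<Lambda> \<Longrightarrow> x - rep (apt_proj \<Gamma> x) \<in> \<Gamma>"
  using rep(2)[of "apt_proj \<Gamma> x"] apt_proj_eq by (metis imageI)

lemma sum_cosets_shift:
  fixes \<phi> :: "'v \<Rightarrow> complex"
  assumes per: "\<And>x \<gamma>. x \<in> \<Lambda> \<Longrightarrow> \<gamma> \<in> \<Gamma> \<Longrightarrow> \<phi> (\<gamma> + x) = \<phi> x" and \<nu>: "\<nu> \<in> \<Lambda>"
  shows "(\<Sum>C\<in>Y. \<phi> (rep C + \<nu>)) = (\<Sum>C\<in>Y. \<phi> (rep C))"
proof -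
  define s where "s = (\<lambda>\<nu> C. apt_proj \<Gamma> (rep C + \<nu>))"
  have s_Y: "s \<nu> C \<in> Y" if "C \<in> Y" "\<nu> \<in> \<Lambda>" for C \<nu>
    unfolding s_def by (intro imageI coweight_add rep(1) that)
  have s_inv: "s (- \<nu>) (s \<nu> C) = C" if "C \<in> Y" "\<nu> \<in> \<Lambda>" for C \<nu>
  proof -
    have "rep C + \<nu> - rep (s \<nu> C) \<in> \<Gamma>"
      unfolding s_def by (intro rep_apt_proj coweight_add rep(1) that)
    from \<Gamma>_neg[OF this] have "rep (s \<nu> C) + - \<nu> - rep C \<in> \<Gamma>" by (simp add: algebra_simps)
    then have "s (- \<nu>) (s \<nu> C) = apt_proj \<Gamma> (rep C)" by (simp add: s_def apt_proj_eq)
    then show ?thesis using rep(2)[OF that(1)] by simp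
  qed
  have "bij_betw (s \<nu>) Y Y"
    using s_inv[OF _ \<nu>] s_inv[OF _ coweight_neg[OF \<nu>]] s_Y[OF _ \<nu>] s_Y[OF _ coweight_neg[OF \<nu>]]
    by (intro bij_betwI[of _ _ _ "s (- \<nu>)"]) auto
  then have "(\<Sum>C\<in>Y. \<phi> (rep C)) = (\<Sum>C\<in>Y. \<phi> (rep (s \<nu> C)))"
    by (rule sum.reindex_bij_betw[symmetric])
  also have "\<dots> = (\<Sum>C\<in>Y. \<phi> (rep C + \<nu>))"
  proof (rule sum.cong)
    fix C assume C: "C \<in> Y"
    have "rep C + \<nu> - rep (s \<nu> C) \<in> \<Gamma>"
      unfolding s_def by (intro rep_apt_proj coweight_add rep(1) C \<nu>)
    from per[OF rep(1)[OF s_Y[OF C \<nu>]] this] show "\<phi> (rep (s \<nu> C)) = \<phi> (rep C + \<nu>)" by simp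
  qed simp
  finally show ?thesis by simp
qed

lemma L2_zero: "f \<in> M \<Longrightarrow> g \<notin> Wext \<Longrightarrow> f g = 0"
  and L2_invariant: "f \<in> M \<Longrightarrow> \<gamma> \<in> \<Gamma> \<Longrightarrow> g \<in> Wext \<Longrightarrow> f ((+) \<gamma> \<circ> g) = f g"
  by (auto simp: L2_quotient_def)

lemma L2_translate:
  assumes f: "f \<in> M" and h: "h \<in> Wext"
  shows "right_translate h f \<in> M"
  unfolding L2_quotient_def
proof (intro CollectI conjI allI ballI impI)
  show "right_translate h f g = 0" if "g \<notin> Wext" for g
    using that L2_zero[OF f] ext_weyl_comp_right_iff[OF h] by (simp add: right_translate_def)
  show "right_translate h f ((+) \<gamma> \<circ> g) = right_translate h f g" if "\<gamma> \<in> \<Gamma>" "g \<in> Wext" for \<gamma> g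
    using L2_invariant[OF f that(1) ext_weyl_comp[OF that(2) h]]
    by (simp add: right_translate_def comp_assoc)
qed

lemma L2_subrep: "is_subrep \<Phi> M M"
  unfolding is_subrep_def using L2_translate by (auto simp: L2_quotient_def)

text \<open>The elements \<open>\<lambda>w\<close>, with \<open>\<lambda>\<close> running over representatives of \<open>\<Lambda>/\<Gamma>\<close> and \<open>w\<close> over the Weyl
  group, represent the orbits of \<open>\<Gamma>\<close> on the extended Weyl group; the form is the inner product of
  square-summable functions on the quotient.\<close>

sublocale unitary_subrep "Y \<times> W" "\<lambda>(C, w). (+) (rep C) \<circ> w" \<Phi> \<Delta> M
proof unfold_locales
  show fin: "finite (Y \<times> W)" using finite_quotient finite_weyl by simp
  interpret S: sample_form "Y \<times> W" "\<lambda>(C, w). (+) (rep C) \<circ> w" by unfold_locales (rule fin)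
  have ip: "S.ip f h = (\<Sum>w\<in>W. \<Sum>C\<in>Y. f ((+) (rep C) \<circ> w) * cnj (h ((+) (rep C) \<circ> w)))" for f h
    unfolding S.ip_def by (subst sum.swap) (simp add: sum.cartesian_product case_prod_beta')
  show "is_subrep \<Phi> M M" by (rule L2_subrep)
  show "\<exists>h'\<in>Wext. h' \<circ> h = id" if "h \<in> Wext" for h using ext_weyl_inverse[OF that] by blast
  show "S.definite M"
    unfolding S.definite_def
  proof (intro ballI impI ext)
    fix f g assume f: "f \<in> M" and z: "S.ip f f = 0"
    have "(\<Sum>i\<in>Y \<times> W. (cmod (f ((\<lambda>(C, w). (+) (rep C) \<circ> w) i)))\<^sup>2) = 0"
      using z S.ip_self[of f] by (simp only: of_real_eq_0_iff)
    then have 0: "f ((+) (rep C) \<circ> w) = 0" if "C \<in> Y" "w \<in> W" for C w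
      using that fin by (subst (asm) sum_nonneg_eq_0_iff) auto
    show "f g = 0"
    proof (cases "g \<in> Wext")
      case True
      then obtain w where w: "w \<in> W" "g = (+) (g 0) \<circ> w" using ext_weyl_decomp by blast
      let ?C = "apt_proj \<Gamma> (g 0)"
      have C: "?C \<in> Y" using ext_weyl_zero[OF True] by blast
      have "g = (+) (g 0 - rep ?C) \<circ> ((+) (rep ?C) \<circ> w)"
        by (subst w(2)) (auto simp: fun_eq_iff)
      then have "f g = f ((+) (rep ?C) \<circ> w)"
        using L2_invariant[OF f rep_apt_proj[OF ext_weyl_zero[OF True]] ext_weylI[OF rep(1)[OF C] w(1)]]
        by metis
      then show ?thesis using 0[OF C w(1)] by simp
    qed (rule L2_zero[OF f])
  qed
  show "S.ip (right_translate h f) (right_translate h f') = S.ip f f'"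
    if h: "h \<in> Wext" and f: "f \<in> M" and f': "f' \<in> M" for h f f'
  proof -
    obtain \<nu> w\<^sub>0 where h': "\<nu> \<in> \<Lambda>" "w\<^sub>0 \<in> W" "h = (+) \<nu> \<circ> w\<^sub>0" using h by (auto simp: ext_weyl_iff)
    define F where "F = (\<lambda>w x. f ((+) x \<circ> w) * cnj (f' ((+) x \<circ> w)))"
    have F: "F w (\<gamma> + x) = F w x" if "x \<in> \<Lambda>" "\<gamma> \<in> \<Gamma>" "w \<in> W" for w x \<gamma>
      using L2_invariant[OF f that(2) ext_weylI[OF that(1,3)]] L2_invariant[OF f' that(2) ext_weylI[OF that(1,3)]]
      by (simp add: F_def translation_add comp_assoc)
    have move: "(+) x \<circ> w \<circ> h = (+) (x + w \<nu>) \<circ> (w \<circ> w\<^sub>0)" if "w \<in> W" for x w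
      using that by (auto simp: h'(3) fun_eq_iff weyl_add)
    have "S.ip (right_translate h f) (right_translate h f') = (\<Sum>w\<in>W. \<Sum>C\<in>Y. F (w \<circ> w\<^sub>0) (rep C + w \<nu>))"
      unfolding ip by (intro sum.cong refl) (simp add: right_translate_def move F_def)
    also have "\<dots> = (\<Sum>w\<in>W. \<Sum>C\<in>Y. F (w \<circ> w\<^sub>0) (rep C))"
    proof (rule sum.cong)
      fix w assume w: "w \<in> W"
      show "(\<Sum>C\<in>Y. F (w \<circ> w\<^sub>0) (rep C + w \<nu>)) = (\<Sum>C\<in>Y. F (w \<circ> w\<^sub>0) (rep C))"
        by (rule sum_cosets_shift[OF F[OF _ _ weyl_comp[OF w h'(2)]] weyl_coweight[OF w h'(1)]])
    qed simp
    also have "\<dots> = (\<Sum>w\<in>W. \<Sum>C\<in>Y. F w (rep C))"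
      by (rule sum.reindex_bij_betw[OF weyl_comp_bij[OF h'(2)]])
    finally show ?thesis by (simp add: ip F_def)
  qed
qed

text \<open>The decomposition into irreducibles from which \<open>Irr_unr\<close> takes its members.\<close>

definition D :: "'v ext_fun set set" where
  "D = (SOME D. irreducible_decomposition \<Phi> M D)"

lemma D: "irreducible_decomposition \<Phi> M D"
  unfolding D_def by (rule someI_ex[OF ex_decomposition])

lemma Irr_unr_eq: "Irr_unr \<Phi> \<Gamma> = {\<rho> \<in> D. is_unramified \<Phi> \<rho>}"
  by (simp add: Irr_unr_def D_def)

lemma finite_D: "finite D" and D_irreducible: "\<rho> \<in> D \<Longrightarrow> is_irreducible_subrep \<Phi> M \<rho>"
  using D by (auto simp: irreducible_decomposition_def)

lemma D_subrep: "\<rho> \<in> D \<Longrightarrow> is_subrep \<Phi> M \<rho>"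
  using D_irreducible by (simp add: is_irreducible_subrep_def)

lemma D_unique:
  assumes "\<And>\<rho>. \<rho> \<in> D \<Longrightarrow> p \<rho> \<in> \<rho>" "\<And>\<rho>. \<rho> \<in> D \<Longrightarrow> q \<rho> \<in> \<rho>"
    and "\<And>g. (\<Sum>\<rho>\<in>D. p \<rho> g) = (\<Sum>\<rho>\<in>D. q \<rho> g)" and "\<rho> \<in> D"
  shows "p \<rho> = q \<rho>"
proof -
  let ?cut = "\<lambda>p \<rho>. if \<rho> \<in> D then p \<rho> else (\<lambda>_. 0)"
  define P where "P = (\<lambda>f p. (\<forall>\<rho>\<in>D. p \<rho> \<in> \<rho>) \<and> (\<forall>\<rho>. \<rho> \<notin> D \<longrightarrow> p \<rho> = (\<lambda>_. 0)) \<and> f = (\<lambda>g. \<Sum>\<rho>\<in>D. p \<rho> g))"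
  let ?f = "\<lambda>g. \<Sum>\<rho>\<in>D. p \<rho> g"
  have "p \<rho> \<in> M" if "\<rho> \<in> D" for \<rho>
    using assms(1)[OF that] D_subrep[OF that] unfolding is_subrep_def by blast
  then have "?f \<in> M" by (rule fun_subspace_sum[OF subrep_subspace[OF L2_subrep] finite_D])
  then have ex: "\<exists>!p. P ?f p" using D unfolding irreducible_decomposition_def P_def by blast
  have p: "P ?f (?cut p)" unfolding P_def using assms(1) by auto
  have q: "P ?f (?cut q)" unfolding P_def using assms(2,3) by auto
  have "?cut p = ?cut q"
    by (rule trans[OF the1_equality[of "P ?f", OF ex p, symmetric] the1_equality[of "P ?f", OF ex q]])
  from fun_cong[OF this, of \<rho>] show ?thesis using assms(4) by simp
qed

end

section \<open>Characters of unramified constituents\<close>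

context root_datum_sublattice
begin

text \<open>Linear operators on the regular representation which commute with right translations. Left
  translations by elements of \<open>\<Lambda>\<close> and their linear combinations are of this kind.\<close>

definition equivariant :: "('v ext_fun \<Rightarrow> 'v ext_fun) \<Rightarrow> bool" where
  "equivariant p \<longleftrightarrow>
     (\<forall>f\<in>M. p f \<in> M) \<and>
     (\<forall>f\<in>M. \<forall>f'\<in>M. p (\<lambda>g. f g + f' g) = (\<lambda>g. p f g + p f' g)) \<and>
     (\<forall>c. \<forall>f\<in>M. p (\<lambda>g. c * f g) = (\<lambda>g. c * p f g)) \<and>
     (\<forall>h\<in>Wext. \<forall>f\<in>M. p (right_translate h f) = right_translate h (p f))"

lemma left_translate_L2:
  assumes f: "f \<in> M" and x: "x \<in> \<Lambda>"
  shows "(\<lambda>g. f ((+) x \<circ> g)) \<in> M"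
  unfolding L2_quotient_def
proof (intro CollectI conjI allI ballI impI)
  show "f ((+) x \<circ> g) = 0" if "g \<notin> Wext" for g
    using that L2_zero[OF f] ext_weyl_comp_left_iff[OF translation_in_ext[OF x]] by simp
  show "f ((+) x \<circ> ((+) \<gamma> \<circ> g)) = f ((+) x \<circ> g)" if "\<gamma> \<in> \<Gamma>" "g \<in> Wext" for \<gamma> g
  proof -
    have "(+) x \<circ> ((+) \<gamma> \<circ> g) = (+) \<gamma> \<circ> ((+) x \<circ> g)" by (simp add: fun_eq_iff add.left_commute)
    then show ?thesis
      using L2_invariant[OF f that(1) ext_weyl_comp[OF translation_in_ext[OF x] that(2)]] by simp
  qed
qed

lemma equivariant_left_translates:
  assumes p: "equivariant p" and x: "\<And>j. j \<in> J \<Longrightarrow> x j \<in> \<Lambda>" and J: "finite J"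
  shows "equivariant (\<lambda>f g. \<Sum>j\<in>J. c j * p f ((+) (x j) \<circ> g))"
proof -
  have pM: "p f \<in> M" if "f \<in> M" for f using p that by (simp add: equivariant_def)
  have "(\<lambda>g. \<Sum>j\<in>J. c j * p f ((+) (x j) \<circ> g)) \<in> M" if "f \<in> M" for f
    by (rule fun_subspace_sum[OF subrep_subspace[OF L2_subrep] J])
       (intro fun_subspace_scale[OF subrep_subspace[OF L2_subrep]] left_translate_L2 pM that x)
  moreover have "(\<Sum>j\<in>J. c j * p (right_translate h f) ((+) (x j) \<circ> g))
      = right_translate h (\<lambda>g. \<Sum>j\<in>J. c j * p f ((+) (x j) \<circ> g)) g" if "h \<in> Wext" "f \<in> M" for h f g
    using p that by (simp add: equivariant_def right_translate_def comp_assoc)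
  ultimately show ?thesis
    using p by (auto simp: equivariant_def algebra_simps sum.distrib sum_distrib_left)
qed

text \<open>Averaging against the characters of the finite cyclic group generated by \<open>x\<close> modulo \<open>\<Gamma>\<close>, for one
  \<open>x\<close> after the other, produces an equivariant operator with values in a common eigenspace of the left
  translations, without killing a given function.\<close>

lemma ex_eigen_operator:
  assumes R: "finite R" "R \<subseteq> \<Lambda>" and f\<^sub>0: "f\<^sub>0 \<in> M" "f\<^sub>0 \<noteq> (\<lambda>_. 0)"
  shows "\<exists>p. equivariant p \<and> p f\<^sub>0 \<noteq> (\<lambda>_. 0) \<and>
    (\<forall>x\<in>R. \<exists>c. \<forall>f\<in>M. \<forall>g. p f ((+) x \<circ> g) = c * p f g)"
  using R
proof (induction R rule: finite_induct)
  case empty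
  have "equivariant (\<lambda>f. f)" by (simp add: equivariant_def L2_translate)
  then show ?case using f\<^sub>0 by blast
next
  case (insert x R)
  then have "R \<subseteq> \<Lambda>" by simp
  from insert.IH[OF this] obtain p where p: "equivariant p" "p f\<^sub>0 \<noteq> (\<lambda>_. 0)"
    "\<And>y. y \<in> R \<Longrightarrow> \<exists>c. \<forall>f\<in>M. \<forall>g. p f ((+) y \<circ> g) = c * p f g" by blast
  have x: "x \<in> \<Lambda>" using insert.prems by simp
  define d where "d = deg x"
  have d: "d > 0" unfolding d_def by (rule weight_degree_pos[OF x])
  have dx: "real d *\<^sub>R x \<in> \<Gamma>" using scale_in_\<Gamma>_iff[OF x, of d] by (simp add: d_def)
  \<comment> \<open>As \<open>d x\<close> lies in \<open>\<Gamma>\<close>, left translation by \<open>x\<close> has order dividing \<open>d\<close>. For a \<open>d\<close>-th root of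
    unity \<open>\<zeta>\<close>, \<open>q \<zeta>\<close> is \<open>d\<close> times the projection onto its eigenspace for the inverse of \<open>\<zeta>\<close>, applied
    after \<open>p\<close>.\<close>
  define q where "q = (\<lambda>\<zeta>::complex. \<lambda>f g. \<Sum>j<d. \<zeta> ^ j * p f ((+) (real j *\<^sub>R x) \<circ> g))"
  have q: "equivariant (q \<zeta>)" for \<zeta>
    unfolding q_def by (rule equivariant_left_translates[OF p(1)]) (auto simp: coweight_scale_nat x)
  obtain g\<^sub>0 where g\<^sub>0: "p f\<^sub>0 g\<^sub>0 \<noteq> 0" using p(2) by auto
  have "(\<Sum>\<zeta> | \<zeta> ^ d = 1. q \<zeta> f\<^sub>0 g\<^sub>0)
      = (\<Sum>j<d. (\<Sum>\<zeta> | \<zeta> ^ d = 1. \<zeta> ^ j) * p f\<^sub>0 ((+) (real j *\<^sub>R x) \<circ> g\<^sub>0))"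
    unfolding q_def by (subst sum.swap) (simp add: sum_distrib_right)
  also have "\<dots> = (\<Sum>j<d. if j = 0 then of_nat d * p f\<^sub>0 g\<^sub>0 else 0)"
    by (intro sum.cong refl)
       (auto simp: power_sum_roots_of_unity[OF d] o_def dest: dvd_imp_le)
  also have "\<dots> = of_nat d * p f\<^sub>0 g\<^sub>0" using d by simp
  finally have "(\<Sum>\<zeta> | \<zeta> ^ d = 1. q \<zeta> f\<^sub>0 g\<^sub>0) \<noteq> 0" using g\<^sub>0 d by simp
  then obtain \<zeta> where \<zeta>: "\<zeta> ^ d = 1" "q \<zeta> f\<^sub>0 g\<^sub>0 \<noteq> 0"
    by (metis (mono_tags, lifting) mem_Collect_eq sum.not_neutral_contains_not_neutral)
  have "\<zeta> \<noteq> 0" using \<zeta>(1) d by (auto simp: power_0_left)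
  have "q \<zeta> f ((+) x \<circ> g) = inverse \<zeta> * q \<zeta> f g" if f: "f \<in> M" for f g
  proof -
    let ?a = "\<lambda>j. \<zeta> ^ j * p f ((+) (real j *\<^sub>R x) \<circ> g)"
    have pf: "p f \<in> M" using p(1) f by (simp add: equivariant_def)
    have "p f ((+) (real d *\<^sub>R x) \<circ> g) = p f g"
    proof (cases "g \<in> Wext")
      case True
      then show ?thesis by (rule L2_invariant[OF pf dx])
    next
      case False
      then show ?thesis
        using L2_zero[OF pf] ext_weyl_comp_left_iff[OF translation_in_ext[OF coweight_scale_nat[OF x]]]
        by simp
    qed
    then have ad: "?a d = ?a 0" by (simp add: \<zeta>(1) o_def)
    have "(\<Sum>j<d. ?a (Suc j)) = (\<Sum>j<Suc d. ?a j) - ?a 0"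
      by (simp only: sum.lessThan_Suc_shift) simp
    also have "\<dots> = (\<Sum>j<d. ?a j)" using ad by simp
    finally have shift: "(\<Sum>j<d. ?a (Suc j)) = (\<Sum>j<d. ?a j)" .
    have "(+) (real j *\<^sub>R x) \<circ> ((+) x \<circ> g) = (+) (real (Suc j) *\<^sub>R x) \<circ> g" for j
      by (simp add: fun_eq_iff algebra_simps)
    then have "\<zeta> * q \<zeta> f ((+) x \<circ> g) = (\<Sum>j<d. ?a (Suc j))"
      by (simp add: q_def sum_distrib_left mult.assoc)
    then have "\<zeta> * q \<zeta> f ((+) x \<circ> g) = q \<zeta> f g" using shift by (simp add: q_def)
    then show ?thesis using \<open>\<zeta> \<noteq> 0\<close> by (simp add: field_simps)
  qed
  moreover have "\<exists>c. \<forall>f\<in>M. \<forall>g. q \<zeta> f ((+) y \<circ> g) = c * q \<zeta> f g" if y: "y \<in> R" for y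
  proof -
    obtain c where c: "\<And>f g. f \<in> M \<Longrightarrow> p f ((+) y \<circ> g) = c * p f g" using p(3)[OF y] by blast
    have comm: "(+) (real j *\<^sub>R x) \<circ> ((+) y \<circ> g) = (+) y \<circ> ((+) (real j *\<^sub>R x) \<circ> g)" for j g
      by (simp add: fun_eq_iff add.left_commute)
    have "q \<zeta> f ((+) y \<circ> g) = c * q \<zeta> f g" if "f \<in> M" for f g
      by (simp only: q_def comm c[OF that] sum_distrib_left mult.left_commute)
    then show ?thesis by blast
  qed
  ultimately have "\<forall>y\<in>insert x R. \<exists>c. \<forall>f\<in>M. \<forall>g. q \<zeta> f ((+) y \<circ> g) = c * q \<zeta> f g" by blast
  moreover have "q \<zeta> f\<^sub>0 \<noteq> (\<lambda>_. 0)" using \<zeta>(2) by auto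
  ultimately show ?case using q[of \<zeta>] by blast
qed

text \<open>Applied to representatives of \<open>\<Lambda>/\<Gamma>\<close>, this gives an operator into an induced representation.\<close>

lemma ex_character_operator:
  assumes f\<^sub>0: "f\<^sub>0 \<in> M" "f\<^sub>0 \<noteq> (\<lambda>_. 0)"
  shows "\<exists>p \<psi>. equivariant p \<and> p f\<^sub>0 \<noteq> (\<lambda>_. 0) \<and> lattice_character \<Phi> \<psi> \<and> (\<forall>f\<in>M. p f \<in> induced_rep \<Phi> \<psi>)"
proof -
  have "finite (rep ` Y)" "rep ` Y \<subseteq> \<Lambda>" using finite_quotient rep(1) by auto
  from ex_eigen_operator[OF this f\<^sub>0] obtain p where p: "equivariant p" "p f\<^sub>0 \<noteq> (\<lambda>_. 0)"
    "\<And>x. x \<in> rep ` Y \<Longrightarrow> \<exists>c. \<forall>f\<in>M. \<forall>g. p f ((+) x \<circ> g) = c * p f g" by blast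
  have pM: "p f \<in> M" if "f \<in> M" for f using p(1) that by (simp add: equivariant_def)
  have "\<exists>c. \<forall>f\<in>M. \<forall>g\<in>Wext. p f ((+) x \<circ> g) = c * p f g" if x: "x \<in> \<Lambda>" for x
  proof -
    let ?r = "rep (apt_proj \<Gamma> x)"
    obtain c where c: "\<And>f g. f \<in> M \<Longrightarrow> p f ((+) ?r \<circ> g) = c * p f g" using p(3)[of ?r] x by blast
    have "p f ((+) x \<circ> g) = c * p f g" if f: "f \<in> M" and g: "g \<in> Wext" for f g
    proof -
      have "(+) x \<circ> g = (+) (x - ?r) \<circ> ((+) ?r \<circ> g)" by (simp add: fun_eq_iff)
      moreover have "(+) ?r \<circ> g \<in> Wext"
        by (rule ext_weyl_comp[OF translation_in_ext g]) (use rep(1) x in blast)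
      ultimately show ?thesis
        using L2_invariant[OF pM[OF f] rep_apt_proj[OF x], of "(+) ?r \<circ> g"] c[OF f] by simp
    qed
    then show ?thesis by blast
  qed
  then have "\<forall>x. \<exists>c. x \<in> \<Lambda> \<longrightarrow> (\<forall>f\<in>M. \<forall>g\<in>Wext. p f ((+) x \<circ> g) = c * p f g)" by blast
  then obtain \<psi> where \<psi>: "\<And>x f g. x \<in> \<Lambda> \<Longrightarrow> f \<in> M \<Longrightarrow> g \<in> Wext \<Longrightarrow> p f ((+) x \<circ> g) = \<psi> x * p f g"
    by metis
  obtain g\<^sub>0 where g\<^sub>0: "p f\<^sub>0 g\<^sub>0 \<noteq> 0" using p(2) by auto
  then have g\<^sub>0W: "g\<^sub>0 \<in> Wext" using L2_zero[OF pM[OF f\<^sub>0(1)]] by blast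
  have mult: "\<psi> (x + y) = \<psi> x * \<psi> y" if "x \<in> \<Lambda>" "y \<in> \<Lambda>" for x y
  proof -
    have "\<psi> (x + y) * p f\<^sub>0 g\<^sub>0 = p f\<^sub>0 ((+) x \<circ> ((+) y \<circ> g\<^sub>0))"
      using \<psi>[OF coweight_add[OF that] f\<^sub>0(1) g\<^sub>0W] by (simp add: translation_add comp_assoc)
    also have "\<dots> = \<psi> x * (\<psi> y * p f\<^sub>0 g\<^sub>0)"
      using \<psi>[OF that(1) f\<^sub>0(1) ext_weyl_comp[OF translation_in_ext[OF that(2)] g\<^sub>0W]] \<psi>[OF that(2) f\<^sub>0(1) g\<^sub>0W]
      by simp
    finally show ?thesis using g\<^sub>0 by simp
  qed
  have "p f\<^sub>0 ((+) 0 \<circ> g\<^sub>0) = p f\<^sub>0 g\<^sub>0" by (simp add: o_def)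
  then have \<psi>0: "\<psi> 0 = 1" using \<psi>[OF coweight_zero f\<^sub>0(1) g\<^sub>0W] g\<^sub>0 by simp
  have "\<psi> x \<noteq> 0" if "x \<in> \<Lambda>" for x
    using mult[OF that coweight_neg[OF that]] \<psi>0 by auto
  then have "lattice_character \<Phi> \<psi>" using mult by (simp add: lattice_character_def)
  moreover have "p f \<in> induced_rep \<Phi> \<psi>" if "f \<in> M" for f
    using L2_zero[OF pM[OF that]] \<psi>[OF _ that] by (simp add: induced_rep_def)
  ultimately show ?thesis using p by blast
qed

text \<open>The defining property of the character attached to an unramified representation.\<close>

definition character_of :: "'v ext_fun set \<Rightarrow> ('v \<Rightarrow> complex) \<Rightarrow> bool" where
  "character_of \<rho> \<psi> \<longleftrightarrow> lattice_character \<Phi> \<psi> \<and>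
     (\<exists>\<sigma>. is_irreducible_subrep \<Phi> (induced_rep \<Phi> \<psi>) \<sigma> \<and> is_unramified \<Phi> \<sigma> \<and> rep_iso \<Phi> \<rho> \<sigma>)"

text \<open>By irreducibility, an equivariant operator that does not kill \<open>\<rho>\<close> embeds it.\<close>

lemma ex_character_of:
  assumes \<rho>: "is_irreducible_subrep \<Phi> M \<rho>" and unr: "is_unramified \<Phi> \<rho>"
  shows "\<exists>\<psi>. character_of \<rho> \<psi>"
proof -
  have sub: "is_subrep \<Phi> M \<rho>" using \<rho> by (simp add: is_irreducible_subrep_def)
  have \<rho>M: "f \<in> M" if "f \<in> \<rho>" for f using sub that by (auto simp: is_subrep_def)
  note \<rho>_add = subrep_add[OF sub]
  note \<rho>_scale = subrep_scale[OF sub]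
  note \<rho>_rt = subrep_translate[OF sub]
  note \<rho>_0 = subrep_zero[OF sub]
  have irr: "S = {\<lambda>_. 0} \<or> S = \<rho>" if "is_subrep \<Phi> \<rho> S" for S
    using \<rho> that by (simp add: is_irreducible_subrep_def)
  obtain f\<^sub>0 where f\<^sub>0: "f\<^sub>0 \<in> \<rho>" "f\<^sub>0 \<noteq> (\<lambda>_. 0)" "\<And>w. w \<in> W \<Longrightarrow> right_translate w f\<^sub>0 = f\<^sub>0"
    using unr by (auto simp: is_unramified_def)
  obtain p \<psi> where p: "equivariant p" "p f\<^sub>0 \<noteq> (\<lambda>_. 0)" and \<psi>: "lattice_character \<Phi> \<psi>"
    and ind: "\<And>f. f \<in> M \<Longrightarrow> p f \<in> induced_rep \<Phi> \<psi>"
    using ex_character_operator[OF \<rho>M[OF f\<^sub>0(1)] f\<^sub>0(2)] by blast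
  have p_add: "p (\<lambda>g. f g + f' g) = (\<lambda>g. p f g + p f' g)" if "f \<in> \<rho>" "f' \<in> \<rho>" for f f'
    using p(1) \<rho>M that by (simp add: equivariant_def)
  have p_scale: "p (\<lambda>g. c * f g) = (\<lambda>g. c * p f g)" if "f \<in> \<rho>" for c f
    using p(1) \<rho>M that by (simp add: equivariant_def)
  have p_rt: "p (right_translate h f) = right_translate h (p f)" if "h \<in> Wext" "f \<in> \<rho>" for h f
    using p(1) \<rho>M that by (simp add: equivariant_def)
  have p_0: "p (\<lambda>_. 0) = (\<lambda>_. 0)" using p_scale[OF \<rho>_0, of 0] by simp
  have rt_0: "right_translate h (\<lambda>_. 0) = (\<lambda>_. 0)" for h :: "'v \<Rightarrow> 'v" by (simp add: right_translate_def)
  have pull: "is_subrep \<Phi> \<rho> {f \<in> \<rho>. p f \<in> S}" if S: "is_subrep \<Phi> (p ` \<rho>) S" for S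
    using S p_0 \<rho>_0 \<rho>_add \<rho>_scale \<rho>_rt by (auto simp: is_subrep_def p_add p_scale p_rt)
  have "is_subrep \<Phi> (p ` \<rho>) {\<lambda>_. 0}"
    using p_0 \<rho>_0 by (auto simp: is_subrep_def rt_0 image_iff intro!: bexI[of _ "\<lambda>_. 0"])
  from pull[OF this] have "is_subrep \<Phi> \<rho> {f \<in> \<rho>. p f \<in> {\<lambda>_. 0}}" .
  from irr[OF this] have ker: "f = (\<lambda>_. 0)" if "f \<in> \<rho>" "p f = (\<lambda>_. 0)" for f
    using that f\<^sub>0(1) p(2) by blast
  have inj: "inj_on p \<rho>"
  proof (rule inj_onI)
    fix f f' assume f: "f \<in> \<rho>" "f' \<in> \<rho>" "p f = p f'"
    have neg: "(\<lambda>g. (-1) * f' g) \<in> \<rho>" by (rule \<rho>_scale[OF f(2)])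
    have "p (\<lambda>g. f g + (-1) * f' g) = (\<lambda>_. 0)"
      by (simp only: p_add[OF f(1) neg] p_scale[OF f(2)] f(3)) simp
    then have "(\<lambda>g. f g + (-1) * f' g) = (\<lambda>_. 0)" by (rule ker[OF \<rho>_add[OF f(1) neg]])
    then show "f = f'" by (auto simp: fun_eq_iff)
  qed
  have sub\<sigma>: "is_subrep \<Phi> (induced_rep \<Phi> \<psi>) (p ` \<rho>)"
    unfolding is_subrep_def
  proof (intro conjI ballI allI)
    show "p ` \<rho> \<subseteq> induced_rep \<Phi> \<psi>" using ind \<rho>M by blast
    show "(\<lambda>_. 0) \<in> p ` \<rho>" using p_0 \<rho>_0 by (metis imageI)
  next
    fix a b assume "a \<in> p ` \<rho>" "b \<in> p ` \<rho>"
    then obtain f f' where f: "f \<in> \<rho>" "f' \<in> \<rho>" "a = p f" "b = p f'" by blast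
    have "p (\<lambda>g. f g + f' g) \<in> p ` \<rho>" by (rule imageI[OF \<rho>_add[OF f(1,2)]])
    then show "(\<lambda>g. a g + b g) \<in> p ` \<rho>" by (simp only: p_add[OF f(1,2)] f(3,4))
  next
    fix c a assume "a \<in> p ` \<rho>"
    then obtain f where f: "f \<in> \<rho>" "a = p f" by blast
    have "p (\<lambda>g. c * f g) \<in> p ` \<rho>" by (rule imageI[OF \<rho>_scale[OF f(1)]])
    then show "(\<lambda>g. c * a g) \<in> p ` \<rho>" by (simp only: p_scale[OF f(1)] f(2))
  next
    fix h a assume h: "h \<in> Wext" and "a \<in> p ` \<rho>"
    then obtain f where f: "f \<in> \<rho>" "a = p f" by blast
    have "p (right_translate h f) \<in> p ` \<rho>" by (rule imageI[OF \<rho>_rt[OF h f(1)]])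
    then show "right_translate h a \<in> p ` \<rho>" by (simp only: p_rt[OF h f(1)] f(2))
  qed
  have "is_irreducible_subrep \<Phi> (induced_rep \<Phi> \<psi>) (p ` \<rho>)"
    unfolding is_irreducible_subrep_def
  proof (intro conjI allI impI sub\<sigma>)
    show "p ` \<rho> \<noteq> {\<lambda>_. 0}" using f\<^sub>0(1) p(2) by blast
    fix S assume S: "is_subrep \<Phi> (p ` \<rho>) S"
    have "S \<subseteq> p ` \<rho>" using S by (simp add: is_subrep_def)
    then have S_eq: "S = p ` {f \<in> \<rho>. p f \<in> S}" by blast
    from irr[OF pull[OF S]] show "S = {\<lambda>_. 0} \<or> S = p ` \<rho>"
    proof
      assume "{f \<in> \<rho>. p f \<in> S} = {\<lambda>_. 0}"
      then have "S = {\<lambda>_. 0}" using S_eq p_0 by simp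
      then show ?thesis ..
    next
      assume "{f \<in> \<rho>. p f \<in> S} = \<rho>"
      then have "S = p ` \<rho>" using S_eq by simp
      then show ?thesis ..
    qed
  qed
  moreover have "is_unramified \<Phi> (p ` \<rho>)"
    unfolding is_unramified_def
  proof (intro bexI[of _ "p f\<^sub>0"] conjI ballI)
    show "right_translate w (p f\<^sub>0) = p f\<^sub>0" if "w \<in> W" for w
      using p_rt[OF weyl_in_ext[OF that] f\<^sub>0(1)] f\<^sub>0(3)[OF that] by simp
  qed (use p(2) f\<^sub>0(1) in auto)
  moreover have "rep_iso \<Phi> \<rho> (p ` \<rho>)"
    unfolding rep_iso_def using inj p_add p_scale p_rt
    by (intro exI[of _ p]) (auto simp: bij_betw_def)
  ultimately show ?thesis using \<psi> unfolding character_of_def by blast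
qed

lemma character_of_rep_character:
  assumes "\<rho> \<in> Irr_unr \<Phi> \<Gamma>"
  shows "character_of \<rho> (rep_character \<Phi> \<rho>)"
proof -
  have "\<exists>\<psi>. character_of \<rho> \<psi>"
    using assms D_irreducible by (intro ex_character_of) (auto simp: Irr_unr_eq)
  from someI_ex[OF this] show ?thesis by (simp add: rep_character_def character_of_def)
qed

end

section \<open>The trace of an orbit sum of translations\<close>

context root_datum_sublattice
begin

lemma lattice_character_zero:
  assumes "lattice_character \<Phi> \<psi>" shows "\<psi> 0 = 1"
proof -
  have "\<psi> (0 + 0) = \<psi> 0 * \<psi> 0" "\<psi> 0 \<noteq> 0"
    using assms coweight_zero unfolding lattice_character_def by blast+
  then show ?thesis by simp
qed

lemma lattice_character_add:
  "lattice_character \<Phi> \<psi> \<Longrightarrow> \<mu> \<in> \<Lambda> \<Longrightarrow> \<nu> \<in> \<Lambda> \<Longrightarrow> \<psi> (\<mu> + \<nu>) = \<psi> \<mu> * \<psi> \<nu>"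
  by (simp add: lattice_character_def)

lemma lattice_character_scale:
  assumes "lattice_character \<Phi> \<psi>" "\<mu> \<in> \<Lambda>"
  shows "\<psi> (real k *\<^sub>R \<mu>) = \<psi> \<mu> ^ k"
proof (induction k)
  case 0
  then show ?case using lattice_character_zero[OF assms(1)] by simp
next
  case (Suc k)
  have "real (Suc k) *\<^sub>R \<mu> = \<mu> + real k *\<^sub>R \<mu>" by (simp add: algebra_simps)
  then show ?case
    using lattice_character_add[OF assms coweight_scale_nat[OF assms(2)]] Suc by simp
qed

text \<open>The W-fixed vectors of a representation.\<close>

definition fixed :: "'v ext_fun set \<Rightarrow> 'v ext_fun set" where
  "fixed \<rho> = {f \<in> \<rho>. \<forall>w\<in>W. right_translate w f = f}"

lemma fixed_induced_rep:
  assumes h: "h \<in> fixed (induced_rep \<Phi> \<psi>)" and \<nu>: "\<nu> \<in> \<Lambda>" and w: "w \<in> W"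
  shows "h ((+) \<nu> \<circ> w) = \<psi> \<nu> * h id"
proof -
  have "h ((+) \<nu> \<circ> w) = right_translate w h ((+) \<nu>)" by (simp add: right_translate_def)
  also have "\<dots> = h ((+) \<nu> \<circ> id)" using h w by (simp add: fixed_def)
  also have "\<dots> = \<psi> \<nu> * h id"
    using h \<nu> id_in_ext unfolding fixed_def induced_rep_def by blast
  finally show ?thesis .
qed

lemma fixed_induced_rep_zero:
  assumes h: "h \<in> fixed (induced_rep \<Phi> \<psi>)" and "h id = 0"
  shows "h = (\<lambda>_. 0)"
proof
  fix g
  show "h g = 0"
  proof (cases "g \<in> Wext")
    case True
    then show ?thesis using fixed_induced_rep[OF h] assms(2) by (auto simp: ext_weyl_iff)
  next
    case False
    then show ?thesis using h by (simp add: fixed_def induced_rep_def)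
  qed
qed

lemma fixed_induced_rep_eigen:
  assumes h: "h \<in> fixed (induced_rep \<Phi> \<psi>)" and \<psi>: "lattice_character \<Phi> \<psi>"
    and S: "S \<subseteq> \<Lambda>" "\<And>w. w \<in> W \<Longrightarrow> bij_betw w S S"
  shows "(\<Sum>\<mu>\<in>S. right_translate ((+) (real k *\<^sub>R \<mu>)) h g) = (\<Sum>\<mu>\<in>S. \<psi> \<mu> ^ k) * h g"
proof (cases "g \<in> Wext")
  case True
  then obtain \<nu> w where g: "\<nu> \<in> \<Lambda>" "w \<in> W" "g = (+) \<nu> \<circ> w" by (auto simp: ext_weyl_iff)
  have "right_translate ((+) (real k *\<^sub>R \<mu>)) h g = \<psi> \<nu> * \<psi> (w \<mu>) ^ k * h id" if "\<mu> \<in> S" for \<mu>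
  proof -
    have \<mu>: "w \<mu> \<in> \<Lambda>" using S(1) that weyl_coweight[OF g(2)] by blast
    have "g \<circ> (+) (real k *\<^sub>R \<mu>) = (+) (\<nu> + real k *\<^sub>R w \<mu>) \<circ> w"
      using g by (auto simp: fun_eq_iff weyl_add weyl_scale)
    then show ?thesis
      using fixed_induced_rep[OF h coweight_add[OF g(1) coweight_scale_nat[OF \<mu>]] g(2)]
        lattice_character_add[OF \<psi> g(1) coweight_scale_nat[OF \<mu>]] lattice_character_scale[OF \<psi> \<mu>]
      by (simp add: right_translate_def)
  qed
  then have "(\<Sum>\<mu>\<in>S. right_translate ((+) (real k *\<^sub>R \<mu>)) h g) = (\<Sum>\<mu>\<in>S. \<psi> \<nu> * \<psi> (w \<mu>) ^ k * h id)"
    by (rule sum.cong[OF refl])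
  also have "\<dots> = (\<Sum>\<mu>\<in>S. \<psi> \<nu> * \<psi> \<mu> ^ k * h id)"
    by (rule sum.reindex_bij_betw[OF S(2)[OF g(2)]])
  also have "\<dots> = (\<Sum>\<mu>\<in>S. \<psi> \<mu> ^ k) * h g"
    using fixed_induced_rep[OF h g(1,2)] by (simp add: g(3) sum_distrib_left mult_ac)
  finally show ?thesis .
next
  case False
  have "right_translate ((+) (real k *\<^sub>R \<mu>)) h g = 0" if "\<mu> \<in> S" for \<mu>
  proof -
    have "\<mu> \<in> \<Lambda>" using S(1) that by blast
    from ext_weyl_comp_right_iff[OF translation_in_ext[OF coweight_scale_nat[OF this]]]
    have "g \<circ> (+) (real k *\<^sub>R \<mu>) \<notin> Wext" using False by blast
    then show ?thesis using h by (simp add: fixed_def induced_rep_def right_translate_def)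
  qed
  moreover have "h g = 0" using h False by (simp add: fixed_def induced_rep_def)
  ultimately show ?thesis by simp
qed

lemma rep_character_lattice_character:
  "\<rho> \<in> Irr_unr \<Phi> \<Gamma> \<Longrightarrow> lattice_character \<Phi> (rep_character \<Phi> \<rho>)"
  using character_of_rep_character by (simp add: character_of_def)

text \<open>The W-fixed vectors of an unramified constituent form a line, on which the orbit sums of
  translations act through the attached character: both hold in the induced representation, and
  the constituent embeds into it.\<close>

lemma unramified_constituent:
  assumes \<rho>: "\<rho> \<in> Irr_unr \<Phi> \<Gamma>"
  shows fixed_line: "f \<in> fixed \<rho> \<Longrightarrow> f' \<in> fixed \<rho> \<Longrightarrow> f \<noteq> (\<lambda>_. 0) \<Longrightarrow> \<exists>c. f' = (\<lambda>g. c * f g)"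
    and fixed_eigen: "f \<in> fixed \<rho> \<Longrightarrow> finite S \<Longrightarrow> S \<subseteq> \<Lambda> \<Longrightarrow> (\<And>w. w \<in> W \<Longrightarrow> bij_betw w S S) \<Longrightarrow>
      (\<Sum>\<mu>\<in>S. right_translate ((+) (real k *\<^sub>R \<mu>)) f g) = (\<Sum>\<mu>\<in>S. rep_character \<Phi> \<rho> \<mu> ^ k) * f g"
proof -
  let ?\<psi> = "rep_character \<Phi> \<rho>"
  obtain \<sigma> where \<psi>: "lattice_character \<Phi> ?\<psi>" and \<sigma>: "is_irreducible_subrep \<Phi> (induced_rep \<Phi> ?\<psi>) \<sigma>"
    and iso: "rep_iso \<Phi> \<rho> \<sigma>"
    using character_of_rep_character[OF \<rho>] by (auto simp: character_of_def)
  have sub: "is_subrep \<Phi> M \<rho>" using \<rho> D_subrep by (simp add: Irr_unr_eq)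
  note \<rho>_scale = subrep_scale[OF sub]
  note \<rho>_add = subrep_add[OF sub]
  note \<rho>_rt = subrep_translate[OF sub]
  note \<rho>_0 = subrep_zero[OF sub]
  obtain T where T: "bij_betw T \<rho> \<sigma>"
    and T_add: "\<And>f f'. f \<in> \<rho> \<Longrightarrow> f' \<in> \<rho> \<Longrightarrow> T (\<lambda>g. f g + f' g) = (\<lambda>g. T f g + T f' g)"
    and T_scale: "\<And>c f. f \<in> \<rho> \<Longrightarrow> T (\<lambda>g. c * f g) = (\<lambda>g. c * T f g)"
    and T_rt: "\<And>h f. h \<in> Wext \<Longrightarrow> f \<in> \<rho> \<Longrightarrow> T (right_translate h f) = right_translate h (T f)"
    using iso unfolding rep_iso_def by blast
  have T_inj: "f = f'" if "f \<in> \<rho>" "f' \<in> \<rho>" "T f = T f'" for f f'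
    using T that by (auto simp: bij_betw_def inj_on_def)
  have T_0: "T (\<lambda>_. 0) = (\<lambda>_. 0)" using T_scale[OF \<rho>_0, of 0] by simp
  have T_fixed: "T f \<in> fixed (induced_rep \<Phi> ?\<psi>)" if "f \<in> fixed \<rho>" for f
  proof -
    have "T f \<in> induced_rep \<Phi> ?\<psi>"
      using that T \<sigma> by (auto simp: fixed_def bij_betw_def is_irreducible_subrep_def is_subrep_def)
    moreover have "right_translate w (T f) = T f" if w: "w \<in> W" for w
      using T_rt[OF weyl_in_ext[OF w], of f] \<open>f \<in> fixed \<rho>\<close> w by (simp add: fixed_def)
    ultimately show ?thesis by (simp add: fixed_def)
  qed
  show "\<exists>c. f' = (\<lambda>g. c * f g)" if f: "f \<in> fixed \<rho>" "f' \<in> fixed \<rho>" "f \<noteq> (\<lambda>_. 0)"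
  proof -
    have \<rho>f: "f \<in> \<rho>" "f' \<in> \<rho>" using f by (auto simp: fixed_def)
    have "T f \<noteq> (\<lambda>_. 0)" using T_inj[OF \<rho>f(1) \<rho>_0] T_0 f(3) by auto
    then have nz: "T f id \<noteq> 0" using fixed_induced_rep_zero[OF T_fixed[OF f(1)]] by blast
    define c where "c = T f' id / T f id"
    have "T f' g = c * T f g" for g
    proof (cases "g \<in> Wext")
      case True
      then obtain \<nu> w where g: "\<nu> \<in> \<Lambda>" "w \<in> W" "g = (+) \<nu> \<circ> w" by (auto simp: ext_weyl_iff)
      show ?thesis
        using fixed_induced_rep[OF T_fixed[OF f(1)] g(1,2)] fixed_induced_rep[OF T_fixed[OF f(2)] g(1,2)] nz
        by (simp add: g(3) c_def)
    next
      case False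
      then show ?thesis using T_fixed[OF f(1)] T_fixed[OF f(2)] by (simp add: fixed_def induced_rep_def)
    qed
    then have "T f' = T (\<lambda>g. c * f g)" using T_scale[OF \<rho>f(1)] by auto
    then show ?thesis using T_inj[OF \<rho>f(2) \<rho>_scale[OF \<rho>f(1)]] by blast
  qed
  show "(\<Sum>\<mu>\<in>S. right_translate ((+) (real k *\<^sub>R \<mu>)) f g) = (\<Sum>\<mu>\<in>S. ?\<psi> \<mu> ^ k) * f g"
    if f: "f \<in> fixed \<rho>" and fin: "finite S" and S: "S \<subseteq> \<Lambda>" and bij: "\<And>w. w \<in> W \<Longrightarrow> bij_betw w S S"
  proof -
    have \<rho>f: "f \<in> \<rho>" using f by (auto simp: fixed_def)
    let ?R = "\<lambda>\<mu>. right_translate ((+) (real k *\<^sub>R \<mu>))"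
    have sum: "(\<lambda>g. \<Sum>\<mu>\<in>S'. ?R \<mu> f g) \<in> \<rho> \<and> T (\<lambda>g. \<Sum>\<mu>\<in>S'. ?R \<mu> f g) = (\<lambda>g. \<Sum>\<mu>\<in>S'. ?R \<mu> (T f) g)"
      if "S' \<subseteq> S" for S'
    proof -
      have "finite S'" using that fin finite_subset by blast
      then show ?thesis using that
      proof (induction S' rule: finite_induct)
        case empty
        then show ?case using \<rho>_0 T_0 by simp
      next
        case (insert \<mu> S')
        have W: "(+) (real k *\<^sub>R \<mu>) \<in> Wext"
          using insert.prems S by (intro translation_in_ext coweight_scale_nat) auto
        have IH: "(\<lambda>g. \<Sum>\<mu>\<in>S'. ?R \<mu> f g) \<in> \<rho>"
          "T (\<lambda>g. \<Sum>\<mu>\<in>S'. ?R \<mu> f g) = (\<lambda>g. \<Sum>\<mu>\<in>S'. ?R \<mu> (T f) g)" using insert by auto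
        show ?case
          unfolding sum.insert[OF insert.hyps]
          using \<rho>_add[OF \<rho>_rt[OF W \<rho>f] IH(1)] T_add[OF \<rho>_rt[OF W \<rho>f] IH(1)] IH(2) T_rt[OF W \<rho>f] by simp
      qed
    qed
    have "T (\<lambda>g. \<Sum>\<mu>\<in>S. ?R \<mu> f g) = (\<lambda>g. \<Sum>\<mu>\<in>S. ?R \<mu> (T f) g)" using sum by blast
    also have "\<dots> = (\<lambda>g. (\<Sum>\<mu>\<in>S. ?\<psi> \<mu> ^ k) * T f g)"
      using fixed_induced_rep_eigen[OF T_fixed[OF f] \<psi> S bij] by blast
    also have "\<dots> = T (\<lambda>g. (\<Sum>\<mu>\<in>S. ?\<psi> \<mu> ^ k) * f g)" by (rule T_scale[OF \<rho>f, symmetric])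
    finally have "T (\<lambda>g. \<Sum>\<mu>\<in>S. ?R \<mu> f g) = T (\<lambda>g. (\<Sum>\<mu>\<in>S. ?\<psi> \<mu> ^ k) * f g)" .
    moreover have "(\<lambda>g. \<Sum>\<mu>\<in>S. ?R \<mu> f g) \<in> \<rho>" using sum by blast
    ultimately have "(\<lambda>g. \<Sum>\<mu>\<in>S. ?R \<mu> f g) = (\<lambda>g. (\<Sum>\<mu>\<in>S. ?\<psi> \<mu> ^ k) * f g)"
      by (intro T_inj[OF _ \<rho>_scale[OF \<rho>f]])
    then show ?thesis by (rule fun_cong)
  qed
qed

text \<open>The indicator function of the elements of the extended Weyl group whose translation part lies in
  the coset \<open>C\<close>; these functions form a basis of the W-fixed vectors.\<close>

definition coset_indicator :: "'v set \<Rightarrow> 'v ext_fun" where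
  "coset_indicator C g = (if g \<in> Wext \<and> g 0 \<in> C then 1 else 0)"

lemma coset_indicator_fixed:
  assumes C: "C \<in> Y"
  shows "coset_indicator C \<in> fixed M"
proof -
  obtain x where x: "C = apt_proj \<Gamma> x" using C by blast
  have "coset_indicator C \<in> M"
    unfolding L2_quotient_def
  proof (intro CollectI conjI allI ballI impI)
    fix \<gamma> g assume \<gamma>: "\<gamma> \<in> \<Gamma>" and g: "g \<in> Wext"
    have "\<gamma> + g 0 \<in> C \<longleftrightarrow> g 0 \<in> C"
      unfolding x apt_proj_mem using \<Gamma>_add[OF \<gamma>, of "g 0 - x"] \<Gamma>_diff[OF _ \<gamma>, of "\<gamma> + g 0 - x"]
      by (auto simp: algebra_simps)
    then show "coset_indicator C ((+) \<gamma> \<circ> g) = coset_indicator C g"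
      using ext_weyl_comp_left_iff[OF translation_in_ext[OF \<Gamma>_coweight[OF \<gamma>]]] g
      by (simp add: coset_indicator_def)
  qed (simp add: coset_indicator_def)
  moreover have "right_translate w (coset_indicator C) = coset_indicator C" if "w \<in> W" for w
    using ext_weyl_comp_right_iff[OF weyl_in_ext[OF that]] that
    by (simp add: fun_eq_iff right_translate_def coset_indicator_def weyl_zero)
  ultimately show ?thesis by (simp add: fixed_def)
qed

lemma fixed_expansion:
  assumes f: "f \<in> fixed M"
  shows "f g = (\<Sum>C\<in>Y. f ((+) (rep C)) * coset_indicator C g)"
proof (cases "g \<in> Wext")
  case True
  let ?C = "apt_proj \<Gamma> (g 0)"
  have g0: "g 0 \<in> \<Lambda>" by (rule ext_weyl_zero[OF True])
  then have C: "?C \<in> Y" by blast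
  have ind: "coset_indicator C g = (if C = ?C then 1 else 0)" if "C \<in> Y" for C
  proof -
    obtain x where "C = apt_proj \<Gamma> x" using \<open>C \<in> Y\<close> by blast
    then show ?thesis using True \<Gamma>_neg[of "x - g 0"] \<Gamma>_neg[of "g 0 - x"]
      by (auto simp: coset_indicator_def apt_proj_mem apt_proj_eq)
  qed
  obtain w where w: "w \<in> W" "g = (+) (g 0) \<circ> w" using ext_weyl_decomp[OF True] by blast
  have "f g = right_translate w f ((+) (g 0))" by (subst w(2)) (simp add: right_translate_def)
  also have "\<dots> = f ((+) (g 0))" using f w(1) by (simp add: fixed_def)
  also have "(+) (g 0) = (+) (g 0 - rep ?C) \<circ> (+) (rep ?C)" by (simp add: fun_eq_iff)
  also have "f \<dots> = f ((+) (rep ?C))"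
    using f L2_invariant[OF _ rep_apt_proj[OF g0] translation_in_ext[OF rep(1)[OF C]]] by (simp add: fixed_def)
  also have "\<dots> = (\<Sum>C\<in>Y. f ((+) (rep C)) * coset_indicator C g)"
  proof -
    have "(\<Sum>C\<in>Y. f ((+) (rep C)) * coset_indicator C g) = (\<Sum>C\<in>Y. if C = ?C then f ((+) (rep ?C)) else 0)"
      by (intro sum.cong refl) (simp add: ind)
    then show ?thesis using finite_quotient C by simp
  qed
  finally show ?thesis .
next
  case False
  then show ?thesis using f L2_zero by (simp add: fixed_def coset_indicator_def)
qed

text \<open>Both sides are the trace, on the W-fixed vectors, of the sum of the translations by \<open>k \<mu>\<close> for \<open>\<mu>\<close>
  in \<open>S\<close>: on the left in a basis of fixed vectors of the unramified constituents, each of which is an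
  eigenvector, and on the right in the basis of coset indicators.\<close>

lemma orbit_power_sum:
  assumes fin: "finite S" and S: "S \<subseteq> \<Lambda>" and bij: "\<And>w. w \<in> W \<Longrightarrow> bij_betw w S S"
  shows "(\<Sum>\<rho>\<in>Irr_unr \<Phi> \<Gamma>. \<Sum>\<mu>\<in>S. rep_character \<Phi> \<rho> \<mu> ^ k)
    = of_nat (index * card {\<mu> \<in> S. real k *\<^sub>R \<mu> \<in> \<Gamma>})"
proof -
  let ?U = "Irr_unr \<Phi> \<Gamma>"
  have U: "finite ?U" "?U \<subseteq> D" using finite_D by (auto simp: Irr_unr_eq)
  have "\<exists>f. f \<in> fixed \<rho> \<and> f \<noteq> (\<lambda>_. 0)" if "\<rho> \<in> ?U" for \<rho>
    using that by (auto simp: Irr_unr_eq is_unramified_def fixed_def)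
  then obtain v where v: "\<And>\<rho>. \<rho> \<in> ?U \<Longrightarrow> v \<rho> \<in> fixed \<rho>" "\<And>\<rho>. \<rho> \<in> ?U \<Longrightarrow> v \<rho> \<noteq> (\<lambda>_. 0)" by metis
  have "\<exists>c. \<forall>g. coset_indicator C g = (\<Sum>\<rho>\<in>?U. c \<rho> * v \<rho> g)" if C: "C \<in> Y" for C
  proof -
    let ?\<delta> = "coset_indicator C"
    have \<delta>: "?\<delta> \<in> M" "\<And>w. w \<in> W \<Longrightarrow> right_translate w ?\<delta> = ?\<delta>"
      using coset_indicator_fixed[OF C] by (auto simp: fixed_def)
    have "\<forall>f\<in>M. \<exists>!p. (\<forall>\<rho>\<in>D. p \<rho> \<in> \<rho>) \<and> (\<forall>\<rho>. \<rho> \<notin> D \<longrightarrow> p \<rho> = (\<lambda>_. 0)) \<and> f = (\<lambda>g. \<Sum>\<rho>\<in>D. p \<rho> g)"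
      using D unfolding irreducible_decomposition_def by (elim conjE)
    from ex1_implies_ex[OF bspec[OF this \<delta>(1)]]
    obtain p where p: "\<And>\<rho>. \<rho> \<in> D \<Longrightarrow> p \<rho> \<in> \<rho>" "?\<delta> = (\<lambda>g. \<Sum>\<rho>\<in>D. p \<rho> g)"
      by (elim exE conjE) blast
    have p_fixed: "p \<rho> \<in> fixed \<rho>" if \<rho>: "\<rho> \<in> D" for \<rho>
    proof -
      have "right_translate w (p \<rho>) = p \<rho>" if w: "w \<in> W" for w
      proof (rule D_unique[OF _ _ _ \<rho>, of "\<lambda>\<rho>. right_translate w (p \<rho>)" p])
        show "right_translate w (p \<rho>) \<in> \<rho>" if "\<rho> \<in> D" for \<rho>
          using D_subrep[OF that] p(1)[OF that] weyl_in_ext[OF w] unfolding is_subrep_def by blast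
        show "(\<Sum>\<rho>\<in>D. right_translate w (p \<rho>) g) = (\<Sum>\<rho>\<in>D. p \<rho> g)" for g
          using fun_cong[OF \<delta>(2)[OF w], of g] unfolding p(2) by (simp add: right_translate_def)
      qed (rule p(1))
      then show ?thesis using p(1)[OF \<rho>] by (simp add: fixed_def)
    qed
    have "\<exists>c. p \<rho> = (\<lambda>g. c * v \<rho> g)" if "\<rho> \<in> ?U" for \<rho>
      using fixed_line[OF that v(1)[OF that] p_fixed v(2)[OF that]] that U by blast
    then obtain c where c: "\<And>\<rho>. \<rho> \<in> ?U \<Longrightarrow> p \<rho> = (\<lambda>g. c \<rho> * v \<rho> g)" by metis
    have "p \<rho> = (\<lambda>_. 0)" if "\<rho> \<in> D" "\<rho> \<notin> ?U" for \<rho>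
      using p_fixed[OF that(1)] that by (auto simp: Irr_unr_eq is_unramified_def fixed_def)
    then have "(\<Sum>\<rho>\<in>D. p \<rho> g) = (\<Sum>\<rho>\<in>?U. p \<rho> g)" for g
      using finite_D U by (intro sum.mono_neutral_right) auto
    then have "?\<delta> g = (\<Sum>\<rho>\<in>?U. c \<rho> * v \<rho> g)" for g
      using p(2) c by (simp cong: sum.cong)
    then show ?thesis by blast
  qed
  then have "\<forall>C. \<exists>c. C \<in> Y \<longrightarrow> (\<forall>g. coset_indicator C g = (\<Sum>\<rho>\<in>?U. c \<rho> * v \<rho> g))" by blast
  then obtain c where c: "\<And>C g. C \<in> Y \<Longrightarrow> coset_indicator C g = (\<Sum>\<rho>\<in>?U. c C \<rho> * v \<rho> g)" by metis
  \<comment> \<open>The change of basis and its inverse, on the diagonal.\<close>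
  have dual: "(\<Sum>C\<in>Y. c C \<rho> * v \<rho> ((+) (rep C))) = 1" if \<rho>: "\<rho> \<in> ?U" for \<rho>
  proof -
    let ?a = "\<lambda>\<sigma>. \<Sum>C\<in>Y. c C \<sigma> * v \<rho> ((+) (rep C))"
    have \<rho>D: "\<rho> \<in> D" using \<rho> U by blast
    have v\<rho>: "v \<rho> \<in> fixed M" using v(1)[OF \<rho>] D_subrep[OF \<rho>D] by (auto simp: fixed_def is_subrep_def)
    have exp: "v \<rho> g = (\<Sum>\<sigma>\<in>?U. ?a \<sigma> * v \<sigma> g)" for g
    proof -
      have "v \<rho> g = (\<Sum>C\<in>Y. v \<rho> ((+) (rep C)) * (\<Sum>\<sigma>\<in>?U. c C \<sigma> * v \<sigma> g))"
        by (subst fixed_expansion[OF v\<rho>]) (simp add: c)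
      also have "\<dots> = (\<Sum>\<sigma>\<in>?U. \<Sum>C\<in>Y. v \<rho> ((+) (rep C)) * (c C \<sigma> * v \<sigma> g))"
        unfolding sum_distrib_left by (rule sum.swap)
      also have "\<dots> = (\<Sum>\<sigma>\<in>?U. ?a \<sigma> * v \<sigma> g)"
        by (simp add: sum_distrib_left mult_ac)
      finally show ?thesis .
    qed
    have v\<sigma>: "v \<sigma> \<in> \<sigma>" if "\<sigma> \<in> ?U" for \<sigma> using v(1)[OF that] by (simp add: fixed_def)
    define p where "p = (\<lambda>\<sigma>. if \<sigma> = \<rho> then v \<rho> else (\<lambda>_. 0))"
    define q where "q = (\<lambda>\<sigma>. if \<sigma> \<in> ?U then (\<lambda>g. ?a \<sigma> * v \<sigma> g) else (\<lambda>_. 0))"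
    have "p \<rho> = q \<rho>"
    proof (rule D_unique[of p q, OF _ _ _ \<rho>D])
      show "p \<sigma> \<in> \<sigma>" if "\<sigma> \<in> D" for \<sigma>
        using v\<sigma>[OF \<rho>] D_subrep[OF that] by (simp add: p_def is_subrep_def)
      show "q \<sigma> \<in> \<sigma>" if "\<sigma> \<in> D" for \<sigma>
        using v\<sigma> D_subrep[OF that] by (simp add: q_def is_subrep_def)
    next
      fix g
      have "(\<Sum>\<sigma>\<in>D. p \<sigma> g) = (\<Sum>\<sigma>\<in>D. if \<sigma> = \<rho> then v \<rho> g else 0)"
        by (rule sum.cong) (auto simp: p_def)
      also have "\<dots> = v \<rho> g" using finite_D \<rho>D by simp
      also have "\<dots> = (\<Sum>\<sigma>\<in>?U. ?a \<sigma> * v \<sigma> g)" by (rule exp)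
      also have "\<dots> = (\<Sum>\<sigma>\<in>D. q \<sigma> g)"
        using finite_D U(2) by (intro sum.mono_neutral_cong_left) (auto simp: q_def)
      finally show "(\<Sum>\<sigma>\<in>D. p \<sigma> g) = (\<Sum>\<sigma>\<in>D. q \<sigma> g)" .
    qed
    then have "v \<rho> = (\<lambda>g. ?a \<rho> * v \<rho> g)" using \<rho> by (simp add: p_def q_def)
    then have eq: "v \<rho> g = ?a \<rho> * v \<rho> g" for g by (rule fun_cong)
    obtain g where "v \<rho> g \<noteq> 0" using v(2)[OF \<rho>] by auto
    then show ?thesis using eq[of g] by simp
  qed
  let ?e = "\<lambda>\<rho>. \<Sum>\<mu>\<in>S. rep_character \<Phi> \<rho> \<mu> ^ k"
  have trace: "(\<Sum>\<mu>\<in>S. coset_indicator C ((+) (rep C) \<circ> (+) (real k *\<^sub>R \<mu>)))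
      = (\<Sum>\<rho>\<in>?U. ?e \<rho> * (c C \<rho> * v \<rho> ((+) (rep C))))" if C: "C \<in> Y" for C
  proof -
    have "(\<Sum>\<mu>\<in>S. coset_indicator C ((+) (rep C) \<circ> (+) (real k *\<^sub>R \<mu>)))
        = (\<Sum>\<mu>\<in>S. \<Sum>\<rho>\<in>?U. c C \<rho> * right_translate ((+) (real k *\<^sub>R \<mu>)) (v \<rho>) ((+) (rep C)))"
      by (simp only: c[OF C] right_translate_def)
    also have "\<dots> = (\<Sum>\<rho>\<in>?U. c C \<rho> * (\<Sum>\<mu>\<in>S. right_translate ((+) (real k *\<^sub>R \<mu>)) (v \<rho>) ((+) (rep C))))"
      by (subst sum.swap) (simp only: sum_distrib_left)
    also have "\<dots> = (\<Sum>\<rho>\<in>?U. c C \<rho> * (?e \<rho> * v \<rho> ((+) (rep C))))"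
      by (intro sum.cong refl arg_cong2[where f = "(*)"] fixed_eigen v fin S bij)
    finally show ?thesis by (simp only: mult.left_commute)
  qed
  have "(\<Sum>C\<in>Y. \<Sum>\<mu>\<in>S. coset_indicator C ((+) (rep C) \<circ> (+) (real k *\<^sub>R \<mu>)))
      = (\<Sum>C\<in>Y. \<Sum>\<rho>\<in>?U. ?e \<rho> * (c C \<rho> * v \<rho> ((+) (rep C))))"
    by (intro sum.cong refl trace)
  also have "\<dots> = (\<Sum>\<rho>\<in>?U. ?e \<rho> * (\<Sum>C\<in>Y. c C \<rho> * v \<rho> ((+) (rep C))))"
    by (subst sum.swap) (simp only: sum_distrib_left)
  also have "\<dots> = (\<Sum>\<rho>\<in>?U. ?e \<rho>)" by (simp add: dual)
  finally have "(\<Sum>\<rho>\<in>?U. ?e \<rho>)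
      = (\<Sum>C\<in>Y. \<Sum>\<mu>\<in>S. coset_indicator C ((+) (rep C) \<circ> (+) (real k *\<^sub>R \<mu>)))" ..
  also have "\<dots> = (\<Sum>C\<in>Y. of_nat (card {\<mu> \<in> S. real k *\<^sub>R \<mu> \<in> \<Gamma>}))"
  proof (rule sum.cong)
    fix C assume C: "C \<in> Y"
    have "coset_indicator C ((+) (rep C) \<circ> (+) (real k *\<^sub>R \<mu>)) = (if real k *\<^sub>R \<mu> \<in> \<Gamma> then 1 else 0)"
      if "\<mu> \<in> S" for \<mu>
    proof -
      have "\<mu> \<in> \<Lambda>" using S that by blast
      then have "(+) (rep C) \<circ> (+) (real k *\<^sub>R \<mu>) \<in> Wext"
        by (intro ext_weyl_comp translation_in_ext rep(1) C coweight_scale_nat)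
      moreover have "((+) (rep C) \<circ> (+) (real k *\<^sub>R \<mu>)) 0 \<in> C \<longleftrightarrow> real k *\<^sub>R \<mu> \<in> \<Gamma>"
        using apt_proj_mem[of "rep C + real k *\<^sub>R \<mu>" "rep C"] rep(2)[OF C] by simp
      ultimately show ?thesis by (simp add: coset_indicator_def)
    qed
    then have "(\<Sum>\<mu>\<in>S. coset_indicator C ((+) (rep C) \<circ> (+) (real k *\<^sub>R \<mu>)))
        = (\<Sum>\<mu>\<in>S. if real k *\<^sub>R \<mu> \<in> \<Gamma> then 1 else 0)" by (rule sum.cong[OF refl])
    also have "\<dots> = of_nat (card {\<mu> \<in> S. real k *\<^sub>R \<mu> \<in> \<Gamma>})"
      using fin by (simp add: sum.If_cases Int_def)
    finally show "(\<Sum>\<mu>\<in>S. coset_indicator C ((+) (rep C) \<circ> (+) (real k *\<^sub>R \<mu>)))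
        = of_nat (card {\<mu> \<in> S. real k *\<^sub>R \<mu> \<in> \<Gamma>})" .
  qed simp
  finally show ?thesis by (simp add: lattice_index_eq)
qed

lemma finite_Irr_unr: "finite (Irr_unr \<Phi> \<Gamma>)"
  using finite_D by (simp add: Irr_unr_eq)

lemma card_Irr_unr: "card (Irr_unr \<Phi> \<Gamma>) = index"
proof -
  have "{\<mu> \<in> {0::'v}. real 0 *\<^sub>R \<mu> \<in> \<Gamma>} = {0}" by auto
  then have "of_nat (card (Irr_unr \<Phi> \<Gamma>)) = (of_nat (index) :: complex)"
    using orbit_power_sum[of "{0}" 0] by (simp add: weyl_zero bij_betw_def)
  then show ?thesis by (simp only: of_nat_eq_iff)
qed

text \<open>The two families \<open>\<chi>\<^sub>\<rho>(\<mu>)\<close> and, for each \<open>\<mu>\<close>, the roots of unity of order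
  dividing \<open>deg \<mu>\<close> taken \<open>N / deg \<mu>\<close> times have the same power sums.\<close>

lemma orbit_euler_product:
  assumes fin: "finite S" and S: "S \<subseteq> \<Lambda>" and bij: "\<And>w. w \<in> W \<Longrightarrow> bij_betw w S S"
  shows "(\<Prod>\<rho>\<in>Irr_unr \<Phi> \<Gamma>. \<Prod>\<mu>\<in>S. 1 - rep_character \<Phi> \<rho> \<mu> * u)
    = (\<Prod>\<mu>\<in>S. (1 - u ^ deg \<mu>) ^ (index div deg \<mu>))"
proof -
  let ?R = "\<lambda>\<mu>. {\<zeta>::complex. \<zeta> ^ deg \<mu> = 1}"
  let ?I = "Irr_unr \<Phi> \<Gamma> \<times> S"
  let ?J = "SIGMA \<mu>:S. ?R \<mu> \<times> {..<index div deg \<mu>}"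
  have d: "deg \<mu> > 0" if "\<mu> \<in> S" for \<mu> using weight_degree_pos S that by blast
  have R: "finite (?R \<mu>)" if "\<mu> \<in> S" for \<mu> using d[OF that] by (intro finite_roots_unity) simp
  have I: "finite ?I" using fin finite_Irr_unr by simp
  have J: "finite ?J" using fin R by (intro finite_SigmaI) auto
  have "(\<Prod>(\<rho>, \<mu>)\<in>?I. 1 - rep_character \<Phi> \<rho> \<mu> * u) = (\<Prod>(\<mu>, \<zeta>, j)\<in>?J. 1 - \<zeta> * u)"
    unfolding case_prod_beta
  proof (rule prod_eq_of_power_sums[OF I J, where f = "\<lambda>z. 1 - z * u"])
    fix k
    have "(\<Sum>(\<mu>, \<zeta>, j)\<in>?J. \<zeta> ^ k) = (\<Sum>\<mu>\<in>S. \<Sum>(\<zeta>, j)\<in>?R \<mu> \<times> {..<index div deg \<mu>}. \<zeta> ^ k)"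
      using fin R by (subst sum.Sigma) auto
    also have "\<dots> = (\<Sum>\<mu>\<in>S. of_nat (index div deg \<mu>) * (\<Sum>\<zeta>\<in>?R \<mu>. \<zeta> ^ k))"
      by (simp add: sum.cartesian_product[symmetric] sum_distrib_left)
    also have "\<dots> = (\<Sum>\<mu>\<in>S. if real k *\<^sub>R \<mu> \<in> \<Gamma> then of_nat index else 0)"
    proof (rule sum.cong)
      fix \<mu> assume \<mu>: "\<mu> \<in> S"
      then have \<mu>\<Lambda>: "\<mu> \<in> \<Lambda>" using S by blast
      have "index div deg \<mu> * deg \<mu> = index" using weight_degree_dvd_index[OF \<mu>\<Lambda>] by simp
      then have "of_nat (index div deg \<mu>) * of_nat (deg \<mu>) = (of_nat index :: complex)"
        by (simp only: of_nat_mult[symmetric])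
      then show "of_nat (index div deg \<mu>) * (\<Sum>\<zeta>\<in>?R \<mu>. \<zeta> ^ k) = (if real k *\<^sub>R \<mu> \<in> \<Gamma> then of_nat index else (0::complex))"
        using power_sum_roots_of_unity[OF d[OF \<mu>], of k] scale_in_\<Gamma>_iff[OF \<mu>\<Lambda>, of k] by simp
    qed simp
    also have "\<dots> = of_nat (index * card {\<mu> \<in> S. real k *\<^sub>R \<mu> \<in> \<Gamma>})"
      using fin by (simp add: sum.If_cases Int_def)
    also have "\<dots> = (\<Sum>(\<rho>, \<mu>)\<in>?I. rep_character \<Phi> \<rho> \<mu> ^ k)"
      using orbit_power_sum[OF fin S bij, of k] by (simp add: sum.cartesian_product)
    finally show "(\<Sum>i\<in>?I. rep_character \<Phi> (fst i) (snd i) ^ k) = (\<Sum>j\<in>?J. fst (snd j) ^ k)"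
      by (simp add: case_prod_beta)
  qed
  also have "(\<Prod>(\<mu>, \<zeta>, j)\<in>?J. 1 - \<zeta> * u) = (\<Prod>\<mu>\<in>S. \<Prod>(\<zeta>, j)\<in>?R \<mu> \<times> {..<index div deg \<mu>}. 1 - \<zeta> * u)"
    using fin R by (subst prod.Sigma) auto
  also have "\<dots> = (\<Prod>\<mu>\<in>S. (1 - u ^ deg \<mu>) ^ (index div deg \<mu>))"
  proof (rule prod.cong)
    fix \<mu> assume \<mu>: "\<mu> \<in> S"
    have "(\<Prod>(\<zeta>, j)\<in>?R \<mu> \<times> {..<index div deg \<mu>}. 1 - \<zeta> * u) = (\<Prod>\<zeta>\<in>?R \<mu>. 1 - \<zeta> * u) ^ (index div deg \<mu>)"
      by (simp add: prod.cartesian_product[symmetric] prod_power_distrib)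
    then show "(\<Prod>(\<zeta>, j)\<in>?R \<mu> \<times> {..<index div deg \<mu>}. 1 - \<zeta> * u) = (1 - u ^ deg \<mu>) ^ (index div deg \<mu>)"
      by (simp add: prod_one_minus_roots_of_unity[OF d[OF \<mu>]])
  qed simp
  finally show ?thesis by (simp add: prod.cartesian_product)
qed

end

section \<open>Closed geodesics in the quotient of the apartment\<close>

lemma prod_inverse: "(\<Prod>a\<in>A. inverse (f a :: complex)) = inverse (\<Prod>a\<in>A. f a)"
  using prod_inversef[of f A] by (simp add: o_def)

locale geodesic_datum = minuscule_datum \<Phi> \<Delta> \<pi> \<alpha>\<^sub>0 \<omega> + root_datum_sublattice \<Phi> \<Delta> \<Gamma>
  for \<Phi> \<Delta> :: "'v::euclidean_space set" and \<pi> :: "('v, 'n::finite) dual_rep" and \<alpha>\<^sub>0 \<omega> :: 'v and \<Gamma> :: "'v set"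
begin

text \<open>For a nontrivial weight \<open>\<mu>\<close>, its least positive multiple in \<open>\<Gamma>\<close>.\<close>

abbreviation period :: "'v \<Rightarrow> 'v" where "period \<mu> \<equiv> real (deg \<mu>) *\<^sub>R \<mu>"

lemma norm_\<omega>_pos: "norm \<omega> > 0"
  using Wt_nonzero[OF \<omega>_weight] by simp

lemma weight_length_eq: "weight_length \<Phi> \<Delta> \<pi> = norm \<omega>"
  unfolding weight_length_def
proof (rule the_equality)
  show "\<forall>\<mu>\<in>Wt. norm \<mu> = norm \<omega>" using norm_Wt by blast
  show "r = norm \<omega>" if "\<forall>\<mu>\<in>Wt. norm \<mu> = r" for r using that \<omega>_weight by simp
qed

text \<open>Weights conjugate to a fundamental coweight are indivisible in \<open>\<Lambda>\<close>.\<close>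

lemma weight_multiple_coweight:
  assumes \<mu>: "\<mu> \<in> Wt" and t: "t *\<^sub>R \<mu> \<in> \<Lambda>"
  shows "t \<in> \<int>"
proof -
  obtain w where w: "w \<in> W" "\<mu> = w \<omega>" using \<mu> by (auto simp: orbit)
  have "w (t *\<^sub>R \<omega>) \<in> \<Lambda>" using t w by (simp add: weyl_scale)
  then have "t *\<^sub>R \<omega> \<in> \<Lambda>" by (simp add: weyl_coweight_iff[OF w(1)])
  then have "\<alpha>\<^sub>0 \<bullet> (t *\<^sub>R \<omega>) \<in> \<int>" using \<alpha>\<^sub>0 base_subset by (auto simp: coweight_lattice_def)
  then show ?thesis using \<omega>[OF \<alpha>\<^sub>0] by simp
qed

lemma weight_multiple_\<Gamma>:
  assumes \<mu>: "\<mu> \<in> Wt" and t: "t > 0" "t *\<^sub>R \<mu> \<in> \<Gamma>"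
  obtains m :: nat where "m \<ge> 1" "t = real (m * deg \<mu>)"
proof -
  have "t \<in> \<int>" using weight_multiple_coweight[OF \<mu>] t \<Gamma>_coweight by blast
  then obtain i :: int where i: "t = of_int i" by (elim Ints_cases)
  then have k: "t = real (nat i)" using t(1) by simp
  then have "deg \<mu> dvd nat i" using scale_in_\<Gamma>_iff[OF Wt_coweight[OF \<mu>], of "nat i"] t(2) by simp
  then obtain m where m: "nat i = m * deg \<mu>" by (metis dvdE mult.commute)
  have "m \<noteq> 0"
  proof
    assume "m = 0"
    then have "nat i = 0" using m by simp
    then show False using k t(1) by simp
  qed
  then show thesis using that[of m] k m by simp
qed

lemma deg_pos: "\<mu> \<in> Wt \<Longrightarrow> deg \<mu> > 0"
  by (rule weight_degree_pos[OF Wt_coweight])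

lemma deg_multiple: "\<mu> \<in> Wt \<Longrightarrow> period \<mu> \<in> \<Gamma>"
  by (simp add: scale_in_\<Gamma>_iff[OF Wt_coweight])

lemma weight_positive_multiple_eq:
  assumes "\<mu> \<in> Wt" "\<nu> \<in> Wt" "s > 0" "t > 0" "s *\<^sub>R \<mu> = t *\<^sub>R \<nu>"
  shows "s = t" "\<mu> = \<nu>"
proof -
  have "norm (s *\<^sub>R \<mu>) = norm (t *\<^sub>R \<nu>)" by (simp add: assms(5))
  then show "s = t" using assms(1-4) norm_Wt norm_\<omega>_pos by simp
  then show "\<mu> = \<nu>" using assms by simp
qed

text \<open>A loop determines its displacement because \<open>\<Gamma>\<close> contains no nonzero line.\<close>

lemma apt_loop_eq_iff: "apt_loop \<Gamma> v \<gamma> = apt_loop \<Gamma> v' \<gamma>' \<longleftrightarrow> \<gamma> = \<gamma>' \<and> v - v' \<in> \<Gamma>"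
proof
  assume eq: "apt_loop \<Gamma> v \<gamma> = apt_loop \<Gamma> v' \<gamma>'"
  have *: "v + s *\<^sub>R \<gamma> - (v' + s *\<^sub>R \<gamma>') \<in> \<Gamma>" for s
    using fun_cong[OF eq, of s] by (simp add: apt_loop_def apt_proj_eq)
  have v: "v - v' \<in> \<Gamma>" using *[of 0] by simp
  have d: "s *\<^sub>R (\<gamma> - \<gamma>') \<in> \<Gamma>" for s
    using \<Gamma>_diff[OF *[of s] v] by (simp add: algebra_simps)
  have "\<gamma> - \<gamma>' = 0"
  proof (rule eq_zero_if_orthogonal_to_spanning[OF span_roots])
    fix \<alpha> assume \<alpha>: "\<alpha> \<in> \<Phi>"
    show "\<alpha> \<bullet> (\<gamma> - \<gamma>') = 0"
    proof (rule ccontr)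
      assume nz: "\<alpha> \<bullet> (\<gamma> - \<gamma>') \<noteq> 0"
      let ?s = "1 / (2 * (\<alpha> \<bullet> (\<gamma> - \<gamma>')))"
      have "\<alpha> \<bullet> (?s *\<^sub>R (\<gamma> - \<gamma>')) \<in> \<int>"
        using \<Gamma>_coweight[OF d[of ?s]] \<alpha> unfolding coweight_lattice_def by blast
      moreover have "\<alpha> \<bullet> (?s *\<^sub>R (\<gamma> - \<gamma>')) = 1 / 2" using nz unfolding inner_scaleR_right by simp
      ultimately have "1 / 2 \<in> (\<int> :: real set)" by (simp only:)
      then obtain k :: int where "1 / 2 = (of_int k :: real)" by (elim Ints_cases)
      then have "(of_int (2 * k) :: real) = of_int 1" by simp
      then have "2 * k = 1" by (simp only: of_int_eq_iff)
      then show False by presburger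
    qed
  qed
  then show "\<gamma> = \<gamma>' \<and> v - v' \<in> \<Gamma>" using v by simp
next
  assume "\<gamma> = \<gamma>' \<and> v - v' \<in> \<Gamma>"
  then show "apt_loop \<Gamma> v \<gamma> = apt_loop \<Gamma> v' \<gamma>'"
    by (auto simp: apt_loop_def fun_eq_iff apt_proj_eq)
qed

lemma apt_loop_shift: "apt_loop \<Gamma> v \<gamma> (s + a) = apt_loop \<Gamma> (v + a *\<^sub>R \<gamma>) \<gamma> s"
  by (simp add: apt_loop_def algebra_simps)

lemma apt_loop_scale: "apt_loop \<Gamma> v \<gamma> (k * s) = apt_loop \<Gamma> v (k *\<^sub>R \<gamma>) s"
  by (simp add: apt_loop_def mult.commute)

lemma closed_geodesic_onI:
  assumes "v \<in> geodesic_line p \<mu>" "\<gamma> \<in> \<Gamma>" "t > 0" "\<gamma> = t *\<^sub>R \<mu>"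
  shows "closed_geodesic_on \<Gamma> (geodesic_line p \<mu>) \<mu> (apt_loop \<Gamma> v \<gamma>)"
proof -
  have "(+) \<gamma> ` geodesic_line p \<mu> = geodesic_line p \<mu>"
  proof (intro equalityI subsetI)
    fix x assume "x \<in> (+) \<gamma> ` geodesic_line p \<mu>"
    then obtain s where "x = \<gamma> + (p + s *\<^sub>R \<mu>)" by (auto simp: geodesic_line_def)
    then have "x = p + (s + t) *\<^sub>R \<mu>" by (simp add: assms(4) algebra_simps)
    then show "x \<in> geodesic_line p \<mu>" by (auto simp: geodesic_line_def)
  next
    fix x assume "x \<in> geodesic_line p \<mu>"
    then obtain s where "x = p + s *\<^sub>R \<mu>" by (auto simp: geodesic_line_def)
    then have "x = \<gamma> + (p + (s - t) *\<^sub>R \<mu>)" by (simp add: assms(4) algebra_simps)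
    then show "x \<in> (+) \<gamma> ` geodesic_line p \<mu>" unfolding geodesic_line_def by blast
  qed
  then show ?thesis unfolding closed_geodesic_on_def using assms by blast
qed

lemma closed_geodesic_iff:
  "closed_geodesic \<Phi> \<Delta> \<Gamma> \<pi> c \<longleftrightarrow> (\<exists>v. \<exists>\<mu>\<in>Wt. \<exists>t>0. t *\<^sub>R \<mu> \<in> \<Gamma> \<and> c = apt_loop \<Gamma> v (t *\<^sub>R \<mu>))"
proof
  assume "closed_geodesic \<Phi> \<Delta> \<Gamma> \<pi> c"
  then show "\<exists>v. \<exists>\<mu>\<in>Wt. \<exists>t>0. t *\<^sub>R \<mu> \<in> \<Gamma> \<and> c = apt_loop \<Gamma> v (t *\<^sub>R \<mu>)"
    unfolding closed_geodesic_def closed_geodesic_on_def by blast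
next
  assume "\<exists>v. \<exists>\<mu>\<in>Wt. \<exists>t>0. t *\<^sub>R \<mu> \<in> \<Gamma> \<and> c = apt_loop \<Gamma> v (t *\<^sub>R \<mu>)"
  then obtain v \<mu> t where *: "\<mu> \<in> Wt" "t > 0" "t *\<^sub>R \<mu> \<in> \<Gamma>" "c = apt_loop \<Gamma> v (t *\<^sub>R \<mu>)" by blast
  have "v \<in> geodesic_line v \<mu>" unfolding geodesic_line_def by (intro CollectI exI[of _ 0]) simp
  from closed_geodesic_onI[OF this *(3,2) refl] show "closed_geodesic \<Phi> \<Delta> \<Gamma> \<pi> c"
    unfolding closed_geodesic_def using * by blast
qed

text \<open>The multiples of \<open>\<mu>\<close> in \<open>\<Gamma>\<close> are those of \<open>deg \<mu> \<mu>\<close>, so the primitive closed geodesics are those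
  with this displacement.\<close>

lemma primitive_closed_geodesic_iff:
  "primitive_closed_geodesic \<Phi> \<Delta> \<Gamma> \<pi> c
    \<longleftrightarrow> (\<exists>v. \<exists>\<mu>\<in>Wt. c = apt_loop \<Gamma> v (period \<mu>))"
proof
  assume c: "primitive_closed_geodesic \<Phi> \<Delta> \<Gamma> \<pi> c"
  then obtain v \<mu> t where *: "\<mu> \<in> Wt" "t > 0" "t *\<^sub>R \<mu> \<in> \<Gamma>" "c = apt_loop \<Gamma> v (t *\<^sub>R \<mu>)"
    by (auto simp: primitive_closed_geodesic_def closed_geodesic_iff)
  obtain m where m: "m \<ge> 1" "t = real (m * deg \<mu>)" using weight_multiple_\<Gamma>[OF *(1-3)] .
  have "\<not> m \<ge> 2"
  proof
    assume m2: "m \<ge> 2"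
    let ?c = "apt_loop \<Gamma> v (period \<mu>)"
    have "closed_geodesic \<Phi> \<Delta> \<Gamma> \<pi> ?c"
      unfolding closed_geodesic_iff using *(1) deg_pos[OF *(1)] deg_multiple[OF *(1)]
      by (intro exI[of _ v] bexI[of _ \<mu>] exI[of _ "real (deg \<mu>)"]) auto
    moreover have "\<forall>s. c s = ?c (real m * s)" by (simp add: apt_loop_scale *(4) m(2))
    ultimately show False using c m2 unfolding primitive_closed_geodesic_def by blast
  qed
  then have "m = 1" using m(1) by simp
  then show "\<exists>v. \<exists>\<mu>\<in>Wt. c = apt_loop \<Gamma> v (period \<mu>)" using * m(2) by auto
next
  assume "\<exists>v. \<exists>\<mu>\<in>Wt. c = apt_loop \<Gamma> v (period \<mu>)"
  then obtain v \<mu> where *: "\<mu> \<in> Wt" "c = apt_loop \<Gamma> v (period \<mu>)" by blast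
  show "primitive_closed_geodesic \<Phi> \<Delta> \<Gamma> \<pi> c"
    unfolding primitive_closed_geodesic_def
  proof (intro conjI notI)
    show "closed_geodesic \<Phi> \<Delta> \<Gamma> \<pi> c"
      unfolding closed_geodesic_iff using * deg_pos[OF *(1)] deg_multiple[OF *(1)]
      by (intro exI[of _ v] bexI[of _ \<mu>] exI[of _ "real (deg \<mu>)"]) auto
  next
    assume "\<exists>c'. \<exists>k::nat. closed_geodesic \<Phi> \<Delta> \<Gamma> \<pi> c' \<and> k \<ge> 2 \<and> (\<forall>s. c s = c' (real k * s))"
    then obtain c' k where c': "closed_geodesic \<Phi> \<Delta> \<Gamma> \<pi> c'" "(k::nat) \<ge> 2" "\<And>s. c s = c' (real k * s)"
      by blast
    then obtain v' \<nu> t where \<nu>: "\<nu> \<in> Wt" "t > 0" "t *\<^sub>R \<nu> \<in> \<Gamma>" "c' = apt_loop \<Gamma> v' (t *\<^sub>R \<nu>)"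
      by (auto simp: closed_geodesic_iff)
    have "c = apt_loop \<Gamma> v' (real k *\<^sub>R (t *\<^sub>R \<nu>))"
      using c'(3) by (simp add: fun_eq_iff \<nu>(4) apt_loop_scale)
    then have eq: "period \<mu> = (real k * t) *\<^sub>R \<nu>" by (simp add: *(2) apt_loop_eq_iff)
    have kt: "real (deg \<mu>) = real k * t" and "\<mu> = \<nu>"
      using weight_positive_multiple_eq[OF *(1) \<nu>(1) _ _ eq] deg_pos[OF *(1)] c'(2) \<nu>(2) by auto
    obtain m where "m \<ge> 1" "t = real (m * deg \<mu>)"
      using weight_multiple_\<Gamma>[OF \<nu>(1-3)] \<open>\<mu> = \<nu>\<close> by metis
    then have "real (deg \<mu>) = real (k * (m * deg \<mu>))" using kt by simp
    then have "deg \<mu> = k * m * deg \<mu>" unfolding of_nat_eq_iff by simp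
    then have "k * m = 1" using deg_pos[OF *(1)] by simp
    then show False using c'(2) by simp
  qed
qed

text \<open>A line through a point of \<open>\<Lambda>\<close> whose direction is conjugate to a fundamental coweight is cut out
  by walls: apply the Weyl group element to the simple roots other than \<open>\<alpha>\<^sub>0\<close>.\<close>

lemma geodesic_line_subset_one_skeleton:
  assumes x: "x \<in> \<Lambda>" and \<mu>: "\<mu> \<in> Wt"
  shows "geodesic_line x \<mu> \<subseteq> one_skeleton \<Phi>"
proof
  fix v assume "v \<in> geodesic_line x \<mu>"
  then obtain t where v: "v = x + t *\<^sub>R \<mu>" by (auto simp: geodesic_line_def)
  obtain w where w: "w \<in> W" "\<mu> = w \<omega>" using \<mu> by (auto simp: orbit)
  obtain w' where w': "w' \<in> W" "\<And>x. w (w' x) = x" using weyl_inverse[OF w(1)] by metis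
  have "apt_face \<Phi> v \<subseteq> affine hull {x, x + \<mu>}"
  proof
    fix y assume y: "y \<in> apt_face \<Phi> v"
    define z where "z = w' (y - x)"
    have "\<beta> \<bullet> z = \<beta> \<bullet> ((\<alpha>\<^sub>0 \<bullet> z) *\<^sub>R \<omega>)" if \<beta>: "\<beta> \<in> \<Delta>" for \<beta>
    proof (cases "\<beta> = \<alpha>\<^sub>0")
      case True
      then show ?thesis using \<omega>[OF \<alpha>\<^sub>0] by simp
    next
      case False
      have root: "w \<beta> \<in> \<Phi>" using weyl_roots[OF w(1)] \<beta> base_subset by blast
      then obtain k :: int where k: "w \<beta> \<bullet> x = of_int k"
        using x by (auto simp: coweight_lattice_def elim: Ints_cases)
      have "w \<beta> \<bullet> v = of_int k"
        using \<omega>[OF \<beta>] False by (simp add: v w(2) inner_add_right k weyl_inner[OF w(1)])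
      moreover have "sgn (w \<beta> \<bullet> y - of_int k) = sgn (w \<beta> \<bullet> v - of_int k)"
        using y root unfolding apt_face_def by blast
      ultimately have "w \<beta> \<bullet> y = w \<beta> \<bullet> x" by (simp add: k sgn_0_0)
      then have "w \<beta> \<bullet> w z = 0" by (simp add: z_def w'(2) inner_diff_right)
      then show ?thesis using \<omega>[OF \<beta>] False by (simp add: weyl_inner[OF w(1)])
    qed
    then have "z = (\<alpha>\<^sub>0 \<bullet> z) *\<^sub>R \<omega>" by (rule eq_if_base_inner_eq)
    then have "w z = (\<alpha>\<^sub>0 \<bullet> z) *\<^sub>R \<mu>" using w(2) weyl_scale[OF w(1)] by metis
    then have "y = x + (\<alpha>\<^sub>0 \<bullet> z) *\<^sub>R \<mu>" by (simp add: z_def w'(2) algebra_simps)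
    then show "y \<in> affine hull {x, x + \<mu>}"
      unfolding affine_hull_2_alt by (intro range_eqI[of _ _ "\<alpha>\<^sub>0 \<bullet> z"]) simp
  qed
  then have "aff_dim (apt_face \<Phi> v) \<le> aff_dim (affine hull {x, x + \<mu>})" by (rule aff_dim_subset)
  also have "\<dots> \<le> 1" by (simp add: aff_dim_affine_hull aff_dim_2)
  finally show "v \<in> one_skeleton \<Phi>" by (simp add: one_skeleton_def)
qed

text \<open>The class of the primitive closed geodesics through the image of \<open>x\<close> in direction \<open>\<mu>\<close>.\<close>

definition geodesic_class :: "'v \<Rightarrow> 'v \<Rightarrow> (real \<Rightarrow> 'v set) set" where
  "geodesic_class x \<mu> = {apt_loop \<Gamma> (x + a *\<^sub>R \<mu>) (period \<mu>) | a. True}"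

lemma primitive_rational_iff:
  "primitive_closed_geodesic \<Phi> \<Delta> \<Gamma> \<pi> c \<and> rational_closed_geodesic \<Phi> \<Delta> \<Gamma> \<pi> c
    \<longleftrightarrow> (\<exists>x\<in>\<Lambda>. \<exists>\<mu>\<in>Wt. c \<in> geodesic_class x \<mu>)"
proof
  assume "primitive_closed_geodesic \<Phi> \<Delta> \<Gamma> \<pi> c \<and> rational_closed_geodesic \<Phi> \<Delta> \<Gamma> \<pi> c"
  then obtain v \<mu> s where *: "\<mu> \<in> Wt" "c = apt_loop \<Gamma> v (period \<mu>)"
    and s: "c s \<in> apt_proj \<Gamma> ` \<Lambda>"
    by (auto simp: primitive_closed_geodesic_iff rational_closed_geodesic_def)
  let ?x = "v + (s * real (deg \<mu>)) *\<^sub>R \<mu>"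
  obtain y where y: "y \<in> \<Lambda>" "c s = apt_proj \<Gamma> y" using s by blast
  then have "?x - y \<in> \<Gamma>" by (simp add: *(2) apt_loop_def apt_proj_eq)
  then have "?x \<in> \<Lambda>" using coweight_add[OF \<Gamma>_coweight y(1)] by fastforce
  moreover have "c \<in> geodesic_class ?x \<mu>"
    unfolding geodesic_class_def by (intro CollectI exI[of _ "- (s * real (deg \<mu>))"]) (simp add: *(2))
  ultimately show "\<exists>x\<in>\<Lambda>. \<exists>\<mu>\<in>Wt. c \<in> geodesic_class x \<mu>" using *(1) by blast
next
  assume "\<exists>x\<in>\<Lambda>. \<exists>\<mu>\<in>Wt. c \<in> geodesic_class x \<mu>"
  then obtain x \<mu> a where *: "x \<in> \<Lambda>" "\<mu> \<in> Wt" "c = apt_loop \<Gamma> (x + a *\<^sub>R \<mu>) (period \<mu>)"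
    by (auto simp: geodesic_class_def)
  have "x + a *\<^sub>R \<mu> \<in> geodesic_line x \<mu>" by (auto simp: geodesic_line_def)
  from closed_geodesic_onI[OF this deg_multiple[OF *(2)] _ refl]
  have "closed_geodesic_on \<Gamma> (geodesic_line x \<mu>) \<mu> c" using deg_pos[OF *(2)] by (simp add: *(3))
  moreover have "c (- a / real (deg \<mu>)) = apt_proj \<Gamma> x"
    using deg_pos[OF *(2)] by (simp add: *(3) apt_loop_def)
  ultimately have "rational_closed_geodesic \<Phi> \<Delta> \<Gamma> \<pi> c"
    unfolding rational_closed_geodesic_def
    using geodesic_line_subset_one_skeleton[OF *(1,2)] *(1,2) by blast
  then show "primitive_closed_geodesic \<Phi> \<Delta> \<Gamma> \<pi> c \<and> rational_closed_geodesic \<Phi> \<Delta> \<Gamma> \<pi> c"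
    using *(2,3) by (auto simp: primitive_closed_geodesic_iff)
qed

lemma start_equiv_class:
  assumes \<mu>: "\<mu> \<in> Wt" and c: "c \<in> geodesic_class x \<mu>"
  shows "start_equiv `` {c} = geodesic_class x \<mu>"
proof -
  let ?\<gamma> = "period \<mu>"
  obtain a where a: "c = apt_loop \<Gamma> (x + a *\<^sub>R \<mu>) ?\<gamma>" using c by (auto simp: geodesic_class_def)
  have shift: "c (s + b) = apt_loop \<Gamma> (x + (a + b * real (deg \<mu>)) *\<^sub>R \<mu>) ?\<gamma> s" for s b
    unfolding a apt_loop_shift by (simp add: algebra_simps)
  show ?thesis
  proof (intro equalityI subsetI)
    fix c' assume "c' \<in> start_equiv `` {c}"
    then obtain b where "\<And>s. c' s = c (s + b)" by (auto simp: start_equiv_def)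
    then have "c' = apt_loop \<Gamma> (x + (a + b * real (deg \<mu>)) *\<^sub>R \<mu>) ?\<gamma>" by (simp add: fun_eq_iff shift)
    then show "c' \<in> geodesic_class x \<mu>" unfolding geodesic_class_def by blast
  next
    fix c' assume "c' \<in> geodesic_class x \<mu>"
    then obtain a' where a': "c' = apt_loop \<Gamma> (x + a' *\<^sub>R \<mu>) ?\<gamma>" by (auto simp: geodesic_class_def)
    have "c' s = c (s + (a' - a) / real (deg \<mu>))" for s
      using deg_pos[OF \<mu>] by (simp add: shift a')
    then show "c' \<in> start_equiv `` {c}" by (auto simp: start_equiv_def)
  qed
qed

lemma base_loop_in_class: "apt_loop \<Gamma> x (period \<mu>) \<in> geodesic_class x \<mu>"
  unfolding geodesic_class_def by (intro CollectI exI[of _ 0]) simp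

lemma primitive_rational_classes_eq:
  "primitive_rational_classes \<Phi> \<Delta> \<Gamma> \<pi> = (\<Union>\<mu>\<in>Wt. (\<lambda>x. geodesic_class x \<mu>) ` \<Lambda>)"
proof (intro equalityI subsetI)
  fix C assume "C \<in> primitive_rational_classes \<Phi> \<Delta> \<Gamma> \<pi>"
  then obtain c where "\<exists>x\<in>\<Lambda>. \<exists>\<mu>\<in>Wt. c \<in> geodesic_class x \<mu>" "C = start_equiv `` {c}"
    by (auto simp: primitive_rational_classes_def quotient_def primitive_rational_iff)
  then show "C \<in> (\<Union>\<mu>\<in>Wt. (\<lambda>x. geodesic_class x \<mu>) ` \<Lambda>)" using start_equiv_class by blast
next
  fix C assume "C \<in> (\<Union>\<mu>\<in>Wt. (\<lambda>x. geodesic_class x \<mu>) ` \<Lambda>)"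
  then obtain x \<mu> where *: "x \<in> \<Lambda>" "\<mu> \<in> Wt" "C = geodesic_class x \<mu>" by blast
  then show "C \<in> primitive_rational_classes \<Phi> \<Delta> \<Gamma> \<pi>"
    using start_equiv_class[OF *(2) base_loop_in_class] base_loop_in_class[of x \<mu>]
    unfolding primitive_rational_classes_def quotient_def primitive_rational_iff by blast
qed

lemma geodesic_class_eqD:
  assumes \<mu>: "\<mu> \<in> Wt" "\<nu> \<in> Wt" and x: "x \<in> \<Lambda>" "y \<in> \<Lambda>" and eq: "geodesic_class x \<mu> = geodesic_class y \<nu>"
  shows "\<mu> = \<nu>" and "\<exists>k::int. x - y - of_int k *\<^sub>R \<mu> \<in> \<Gamma>"
proof -
  have "apt_loop \<Gamma> x (period \<mu>) \<in> geodesic_class y \<nu>"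
    using base_loop_in_class[of x \<mu>] eq by simp
  then obtain a where "apt_loop \<Gamma> x (period \<mu>) = apt_loop \<Gamma> (y + a *\<^sub>R \<nu>) (period \<nu>)"
    by (auto simp: geodesic_class_def)
  then have g: "period \<mu> = period \<nu>" and d: "x - (y + a *\<^sub>R \<nu>) \<in> \<Gamma>"
    by (auto simp: apt_loop_eq_iff)
  show mn: "\<mu> = \<nu>" by (rule weight_positive_multiple_eq(2)[OF \<mu> _ _ g]) (use deg_pos \<mu> in auto)
  have "(x - y) - (x - (y + a *\<^sub>R \<nu>)) = a *\<^sub>R \<mu>" using mn by simp
  with coweight_diff[OF coweight_diff[OF x] \<Gamma>_coweight[OF d]] have "a *\<^sub>R \<mu> \<in> \<Lambda>" by (simp only:)
  then have "a \<in> \<int>" by (rule weight_multiple_coweight[OF \<mu>(1)])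
  then obtain k :: int where "a = of_int k" by (elim Ints_cases)
  then show "\<exists>k::int. x - y - of_int k *\<^sub>R \<mu> \<in> \<Gamma>" using d mn by (auto simp: algebra_simps)
qed

lemma geodesic_class_eqI:
  assumes "x - y - t *\<^sub>R \<mu> \<in> \<Gamma>"
  shows "geodesic_class x \<mu> = geodesic_class y \<mu>"
proof -
  have 1: "apt_loop \<Gamma> (x + a *\<^sub>R \<mu>) \<gamma> = apt_loop \<Gamma> (y + (a + t) *\<^sub>R \<mu>) \<gamma>" for a \<gamma>
    using assms by (simp add: apt_loop_eq_iff algebra_simps)
  have 2: "apt_loop \<Gamma> (y + a *\<^sub>R \<mu>) \<gamma> = apt_loop \<Gamma> (x + (a - t) *\<^sub>R \<mu>) \<gamma>" for a \<gamma>
    using 1[of "a - t"] by simp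
  show ?thesis unfolding geodesic_class_def using 1 2 by blast
qed

text \<open>The map from \<open>\<Lambda>/\<Gamma>\<close> to the classes with direction \<open>\<mu>\<close> has fibres the cosets of the cyclic
  group generated by \<open>\<mu>\<close>.\<close>

lemma card_geodesic_classes:
  assumes \<mu>: "\<mu> \<in> Wt"
  shows "card ((\<lambda>x. geodesic_class x \<mu>) ` \<Lambda>) * deg \<mu> = index"
    and "finite ((\<lambda>x. geodesic_class x \<mu>) ` \<Lambda>)"
proof -
  let ?h = "\<lambda>C. geodesic_class (rep C) \<mu>"
  let ?K = "(\<lambda>x. geodesic_class x \<mu>) ` \<Lambda>"
  have h: "?h (apt_proj \<Gamma> x) = geodesic_class x \<mu>" if "x \<in> \<Lambda>" for x
    using geodesic_class_eqI[of x "rep (apt_proj \<Gamma> x)" 0] rep_apt_proj[OF that] by simp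
  have img: "?h ` Y = ?K"
  proof -
    have "?h ` Y = (\<lambda>x. ?h (apt_proj \<Gamma> x)) ` \<Lambda>" by (simp add: image_image)
    also have "\<dots> = ?K" by (intro image_cong refl h)
    finally show ?thesis .
  qed
  show "finite ?K" using finite_quotient img by (metis finite_imageI)
  have fibre: "card {C \<in> Y. ?h C = K} = deg \<mu>" if K: "K \<in> ?K" for K
  proof -
    obtain x where x: "x \<in> \<Lambda>" "K = geodesic_class x \<mu>" using K by blast
    let ?f = "\<lambda>j. apt_proj \<Gamma> (x + real j *\<^sub>R \<mu>)"
    have \<mu>\<Lambda>: "\<mu> \<in> \<Lambda>" by (rule Wt_coweight[OF \<mu>])
    have xj: "x + real j *\<^sub>R \<mu> \<in> \<Lambda>" for j by (intro coweight_add x coweight_scale_nat \<mu>\<Lambda>)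
    have eq: "{C \<in> Y. ?h C = K} = ?f ` {..<deg \<mu>}"
    proof (intro equalityI subsetI)
      fix C assume C: "C \<in> {C \<in> Y. ?h C = K}"
      then obtain y where y: "y \<in> \<Lambda>" "C = apt_proj \<Gamma> y" by blast
      then have "geodesic_class y \<mu> = geodesic_class x \<mu>" using C h[OF y(1)] x(2) by simp
      then obtain k :: int where k: "y - x - of_int k *\<^sub>R \<mu> \<in> \<Gamma>"
        using geodesic_class_eqD(2)[OF \<mu> \<mu> y(1) x(1)] by blast
      define j where "j = nat (k mod int (deg \<mu>))"
      have "int j = k mod int (deg \<mu>)" using deg_pos[OF \<mu>] by (simp add: j_def)
      then have kj: "k = int (deg \<mu>) * (k div int (deg \<mu>)) + int j" by simp
      have mult: "of_int i *\<^sub>R (period \<mu>) \<in> \<Gamma>" for i :: int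
      proof (cases i rule: int_cases2)
        case (nonneg n)
        then show ?thesis using \<Gamma>_scale_nat[OF deg_multiple[OF \<mu>], of n] by simp
      next
        case (nonpos n)
        then show ?thesis using \<Gamma>_neg[OF \<Gamma>_scale_nat[OF deg_multiple[OF \<mu>], of n]] by simp
      qed
      have "(of_int k :: real) = of_int (k div int (deg \<mu>)) * real (deg \<mu>) + real j"
        by (subst kj) (simp add: mult.commute)
      then have e: "y - (x + real j *\<^sub>R \<mu>)
          = (y - x - of_int k *\<^sub>R \<mu>) + of_int (k div int (deg \<mu>)) *\<^sub>R (period \<mu>)"
        by (simp add: algebra_simps)
      have "C = ?f j" unfolding y(2) apt_proj_eq e by (rule \<Gamma>_add[OF k mult])
      moreover have "j < deg \<mu>" using deg_pos[OF \<mu>] by (simp add: j_def nat_less_iff)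
      ultimately show "C \<in> ?f ` {..<deg \<mu>}" by blast
    next
      fix C assume "C \<in> ?f ` {..<deg \<mu>}"
      then obtain j where C: "C = ?f j" by blast
      have "x + real j *\<^sub>R \<mu> - x - real j *\<^sub>R \<mu> \<in> \<Gamma>" by simp
      then have "?h C = K" unfolding C h[OF xj] x(2) by (rule geodesic_class_eqI)
      then show "C \<in> {C \<in> Y. ?h C = K}" using C xj by blast
    qed
    have aux: "i = j" if ij: "?f i = ?f j" "i \<le> j" "j < deg \<mu>" for i j
    proof -
      have "x + real j *\<^sub>R \<mu> - (x + real i *\<^sub>R \<mu>) = real (j - i) *\<^sub>R \<mu>"
        using ij(2) by (simp add: of_nat_diff algebra_simps)
      moreover have "x + real j *\<^sub>R \<mu> - (x + real i *\<^sub>R \<mu>) \<in> \<Gamma>" using ij(1)[symmetric] unfolding apt_proj_eq .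
      ultimately have "deg \<mu> dvd j - i" using scale_in_\<Gamma>_iff[OF \<mu>\<Lambda>, of "j - i"] by simp
      then show ?thesis using ij(2,3) by (metis diff_is_0_eq dvd_imp_le le_antisym less_imp_diff_less not_le not_less_zero gr0I)
    qed
    have "inj_on ?f {..<deg \<mu>}"
      by (rule inj_onI) (metis aux lessThan_iff nle_le)
    then show ?thesis unfolding eq by (simp add: card_image)
  qed
  have "card Y = (\<Sum>K\<in>?h ` Y. card {C \<in> Y. ?h C = K})"
    using sum.image_gen[OF finite_quotient, of "\<lambda>_. 1::nat" ?h] by simp
  also have "\<dots> = (\<Sum>K\<in>?K. deg \<mu>)" unfolding img by (intro sum.cong refl fibre)
  finally show "card ?K * deg \<mu> = index" by (simp add: lattice_index_eq)
qed

lemma class_length_eq: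
  assumes \<mu>: "\<mu> \<in> Wt"
  shows "class_length \<Phi> \<Delta> \<Gamma> \<pi> (geodesic_class x \<mu>) = real (deg \<mu>)"
proof -
  have len: "loop_length \<Gamma> c / weight_length \<Phi> \<Delta> \<pi> = real (deg \<mu>)" if "c \<in> geodesic_class x \<mu>" for c
  proof -
    obtain v where c: "c = apt_loop \<Gamma> v (period \<mu>)" using \<open>c \<in> geodesic_class x \<mu>\<close>
      by (auto simp: geodesic_class_def)
    have "loop_length \<Gamma> c = norm (period \<mu>)"
      unfolding loop_length_def c
    proof (rule the_equality)
      show "\<exists>v'. \<exists>\<gamma>\<in>\<Gamma>. apt_loop \<Gamma> v (period \<mu>) = apt_loop \<Gamma> v' \<gamma> \<and> norm (period \<mu>) = norm \<gamma>"
        using deg_multiple[OF \<mu>] by blast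
    next
      fix r assume "\<exists>v'. \<exists>\<gamma>\<in>\<Gamma>. apt_loop \<Gamma> v (period \<mu>) = apt_loop \<Gamma> v' \<gamma> \<and> r = norm \<gamma>"
      then show "r = norm (period \<mu>)" by (auto simp: apt_loop_eq_iff)
    qed
    then show ?thesis using norm_\<omega>_pos by (simp add: weight_length_eq norm_Wt[OF \<mu>])
  qed
  show ?thesis
    unfolding class_length_def
  proof (rule the_equality)
    show "\<forall>c\<in>geodesic_class x \<mu>. real (deg \<mu>) = loop_length \<Gamma> c / weight_length \<Phi> \<Delta> \<pi>"
      using len by simp
    show "l = real (deg \<mu>)"
      if "\<forall>c\<in>geodesic_class x \<mu>. l = loop_length \<Gamma> c / weight_length \<Phi> \<Delta> \<pi>" for l
      using bspec[OF that base_loop_in_class] len[OF base_loop_in_class] by simp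
  qed
qed

section \<open>The zeta function and the L-function\<close>

lemma Z_function_eq:
  "Z_function \<Phi> \<Delta> \<Gamma> \<pi> u
    = (\<Prod>\<mu>\<in>Wt. inverse ((1 - u ^ deg \<mu>) ^ (index div deg \<mu>)))"
proof -
  let ?K = "\<lambda>\<mu>. (\<lambda>x. geodesic_class x \<mu>) ` \<Lambda>"
  let ?F = "\<lambda>C. inverse (1 - u powr complex_of_real (class_length \<Phi> \<Delta> \<Gamma> \<pi> C))"
  have disj: "\<forall>\<mu>\<in>Wt. \<forall>\<nu>\<in>Wt. \<mu> \<noteq> \<nu> \<longrightarrow> ?K \<mu> \<inter> ?K \<nu> = {}"
    using geodesic_class_eqD(1) by blast
  have "Z_function \<Phi> \<Delta> \<Gamma> \<pi> u = (\<Prod>\<mu>\<in>Wt. prod ?F (?K \<mu>))"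
    unfolding Z_function_def primitive_rational_classes_eq
    by (rule prod.UNION_disjoint[OF finite_Wt _ disj]) (use card_geodesic_classes(2) in blast)
  also have "\<dots> = (\<Prod>\<mu>\<in>Wt. inverse ((1 - u ^ deg \<mu>) ^ (index div deg \<mu>)))"
  proof (rule prod.cong)
    fix \<mu> assume \<mu>: "\<mu> \<in> Wt"
    have pw: "u powr complex_of_real (real (deg \<mu>)) = u ^ deg \<mu>"
      using deg_pos[OF \<mu>] powr_nat[of u "deg \<mu>"] by (simp add: power_0_left)
    have "prod ?F (?K \<mu>) = (\<Prod>C\<in>?K \<mu>. inverse (1 - u ^ deg \<mu>))"
      by (intro prod.cong refl) (auto simp: class_length_eq[OF \<mu>] pw simp del: of_real_of_nat_eq)
    also have "\<dots> = inverse (1 - u ^ deg \<mu>) ^ card (?K \<mu>)" by simp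
    also have "card (?K \<mu>) = index div deg \<mu>"
      using card_geodesic_classes(1)[OF \<mu>] deg_pos[OF \<mu>] by (metis nonzero_mult_div_cancel_right less_irrefl)
    finally show "prod ?F (?K \<mu>) = inverse ((1 - u ^ deg \<mu>) ^ (index div deg \<mu>))"
      by (simp add: power_inverse)
  qed simp
  finally show ?thesis .
qed

text \<open>The trivial weight contributes to the factors of each of the \<open>N\<close> unramified constituents, with
  its multiplicity, the inverse of \<open>1 - u\<close>.\<close>

lemma L_function_eq:
  "(1 - u) ^ (trivial_weight_mult \<Phi> \<Delta> \<pi> * index) * L_function \<Phi> \<Delta> \<Gamma> \<pi> u
    = (\<Prod>\<mu>\<in>Wt. inverse ((1 - u ^ deg \<mu>) ^ (index div deg \<mu>)))"
proof -
  let ?U = "Irr_unr \<Phi> \<Gamma>" and ?\<epsilon> = "trivial_weight_mult \<Phi> \<Delta> \<pi>"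
  let ?\<psi> = "rep_character \<Phi>"
  let ?P = "\<Prod>\<mu>\<in>Wt. inverse ((1 - u ^ deg \<mu>) ^ (index div deg \<mu>))"
  have "(\<Prod>\<mu>\<in>#wt \<Phi> \<Delta> \<pi>. inverse (1 - ?\<psi> \<rho> \<mu> * u))
      = inverse (1 - u) ^ ?\<epsilon> * (\<Prod>\<mu>\<in>Wt. inverse (1 - ?\<psi> \<rho> \<mu> * u))" if "\<rho> \<in> ?U" for \<rho>
    using lattice_character_zero[OF rep_character_lattice_character[OF that]]
    by (subst wt_eq) (simp add: prod_unfold_prod_mset)
  then have "L_function \<Phi> \<Delta> \<Gamma> \<pi> u
      = (\<Prod>\<rho>\<in>?U. inverse (1 - u) ^ ?\<epsilon> * (\<Prod>\<mu>\<in>Wt. inverse (1 - ?\<psi> \<rho> \<mu> * u)))"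
    unfolding L_function_def by (rule prod.cong[OF refl])
  also have "\<dots> = inverse (1 - u) ^ (?\<epsilon> * index) * inverse (\<Prod>\<rho>\<in>?U. \<Prod>\<mu>\<in>Wt. 1 - ?\<psi> \<rho> \<mu> * u)"
    by (simp add: prod.distrib card_Irr_unr power_mult prod_inverse)
  also have "inverse (\<Prod>\<rho>\<in>?U. \<Prod>\<mu>\<in>Wt. 1 - ?\<psi> \<rho> \<mu> * u) = ?P"
    using orbit_euler_product[OF finite_Wt _ weyl_bij_Wt, of u] Wt_coweight
    by (simp add: prod_inverse subset_iff)
  finally have L: "L_function \<Phi> \<Delta> \<Gamma> \<pi> u = inverse (1 - u) ^ (?\<epsilon> * index) * ?P" .
  show ?thesis
  proof (cases "u = 1")
    case True
    \<comment> \<open>Inverses of 0 are 0, so that both sides vanish.\<close>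
    have "index div deg \<omega> \<noteq> 0"
      using card_geodesic_classes[OF \<omega>_weight] deg_pos[OF \<omega>_weight] \<omega>_weight
      by (metis (no_types, lifting) card_0_eq coweight_zero div_by_1 empty_iff image_is_empty mult_is_0 nonzero_mult_div_cancel_right less_irrefl)
    then have "?P = 0" using True finite_Wt \<omega>_weight by (intro prod_zero) auto
    then show ?thesis using L by simp
  next
    case False
    then have "(1 - u) ^ (?\<epsilon> * index) * inverse (1 - u) ^ (?\<epsilon> * index) = 1"
      by (simp add: power_mult_distrib[symmetric])
    then show ?thesis unfolding L by (simp only: mult.assoc[symmetric] mult_1_left)
  qed
qed

end

theorem theorem3p3:
  fixes \<Phi> \<Delta> \<Gamma> :: "'v::euclidean_space set"
    and \<pi> :: "('v, 'n::finite) dual_rep"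
    and N :: nat and u :: complex
  assumes "irreducible_root_system \<Phi>"
    and "root_base \<Phi> \<Delta>"
    and "subgroup \<Gamma> (lattice_group (coroot_lattice \<Phi>))"
    and "finite (rcosets\<^bsub>lattice_group (coroot_lattice \<Phi>)\<^esub> \<Gamma>)"
    and "N = lattice_index \<Phi> \<Gamma>"
    and "minuscule_or_fund_quasi_minuscule \<Phi> \<Delta> \<pi>"
  shows "Z_function \<Phi> \<Delta> \<Gamma> \<pi> u
           = (1 - u) ^ (trivial_weight_mult \<Phi> \<Delta> \<pi> * N) * L_function \<Phi> \<Delta> \<Gamma> \<pi> u
       \<and> (1 - u) ^ (trivial_weight_mult \<Phi> \<Delta> \<pi> * N) * L_function \<Phi> \<Delta> \<Gamma> \<pi> u
           = (\<Prod>\<mu>\<in>wt' \<Phi> \<Delta> \<pi>.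
                (1 - u ^ weight_degree \<Phi> \<Gamma> \<mu>) powi (- int (N div weight_degree \<Phi> \<Gamma> \<mu>)))"
proof -
  from assms(6) obtain \<alpha>\<^sub>0 \<omega> where *: "irreducible_dual_rep \<Delta> \<pi>" "\<alpha>\<^sub>0 \<in> \<Delta>"
    "\<forall>\<beta>\<in>\<Delta>. \<beta> \<bullet> \<omega> = (if \<beta> = \<alpha>\<^sub>0 then 1 else 0)" "wt' \<Phi> \<Delta> \<pi> = {w \<omega> | w. w \<in> weyl_group \<Phi>}"
    unfolding minuscule_or_fund_quasi_minuscule_def by blast
  interpret geodesic_datum \<Phi> \<Delta> \<pi> \<alpha>\<^sub>0 \<omega> \<Gamma>
    by (intro geodesic_datum.intro minuscule_datum.intro dual_irrep.intro root_datum.intro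
        dual_irrep_axioms.intro minuscule_datum_axioms.intro root_datum_sublattice.intro
        root_datum_sublattice_axioms.intro) (use assms * in blast)+
  have "(1 - u ^ weight_degree \<Phi> \<Gamma> \<mu>) powi (- int (N div weight_degree \<Phi> \<Gamma> \<mu>))
      = inverse ((1 - u ^ weight_degree \<Phi> \<Gamma> \<mu>) ^ (lattice_index \<Phi> \<Gamma> div weight_degree \<Phi> \<Gamma> \<mu>))" for \<mu>
    by (simp add: power_int_minus assms(5))
  then show ?thesis unfolding assms(5) Z_function_eq L_function_eq by simp
qed

end
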